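(* Let $\mathcal E$ be a Banach space of functions $f:\mathbb R^d\to\mathbb R$ and let $\mathcal A:\mathscr D(\mathcal A)\to\mathcal E$, with $\mathscr D(\mathcal A)\subset\mathcal E$ dense, be a Lévy-type operator with characteristic triplet $(a,b,\Pi)$; assume $\mathcal C_c^\infty(\mathbb R^d)\subset\mathscr D(\mathcal A)$. Let $\pi=(\nu,\mu,\rho)$ be a convenient decomposition of the Lévy kernel $\Pi$, and let $(\mathcal A',\mathscr D(\mathcal A'))$ be the adjoint of $(\mathcal A,\mathscr D(\mathcal A))$. For all measures $\phi\in\mathscr D(\mathcal A')\cap\mathcal M(\mathcal A,\pi)$ on $\mathbb R^d$ it holds $$(\mathcal A'\phi)\big|_{\mathcal C_c^\infty(\mathbb R^d)}=-\nabla\cdot((a+a_\pi)\phi)+\tfrac12\nabla\cdot b\nabla\phi+U^\pi(\phi)+\nabla\cdot V^\pi(\phi)+\mathbf H\cdot W^\pi(\phi).$$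
   Context: **Adjoint.** $\mathscr D(\mathcal A')=\{\phi\in\mathcal E':\exists c\ge0:\ |\phi(\mathcal Af)|\le c\|f\|_{\mathcal E}\ \forall f\in\mathscr D(\mathcal A)\}$, where $\mathcal E'$ is the dual of $\mathcal E$, and $\mathcal A':\mathscr D(\mathcal A')\to\mathcal E'$ is determined by $(\mathcal A'\phi)(f)=\phi(\mathcal Af)$ for all $f\in\mathscr D(\mathcal A)$. A measure $\phi$ is viewed as an element of $\mathcal E'$ via $g\mapsto\int g\,d\phi$. **Lévy-type operators.** A Lévy-type operator is a pair $(\mathcal A,\mathscr D(\mathcal A))$ with $\mathscr D(\mathcal A)\subset\mathcal E$ and $\mathcal A:\mathscr D(\mathcal A)\to\mathcal E$ of the form $$\mathcal Af(x)=a(x)\cdot\nabla f(x)+\tfrac12\nabla\cdot b(x)\nabla f(x)+\int_{\mathbb R^d}\big(f(x+y)-f(x)-\nabla f(x)\cdot y\mathbf 1_{\{|y|<1\}}\big)\Pi(x,dy),$$ where $\nabla\cdot b\nabla f=\sum_{i,j}\partial_i(b_{ij}\partial_jf)$, $a:\mathbb R^d\to\mathbb R^d$ is Borel, $b$ is Borel with values in the symmetric positive semidefinite $d\times d$ matrices, and $\Pi$ is a Lévy kernel: $\Pi(x,\cdot)$ is a Lévy measure on $\mathbb R^d$ for each $x$, $\Pi(\cdot,B)$ is Borel for each Borel $B$, $\Pi(x,\{0\})=0$. $(a,b,\Pi)$ is the characteristic triplet. **Convenient decomposition.** $\pi=(\nu,\mu,\rho)$ is a convenient decomposition of $\Pi$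 if there are non-negative continuous functions $h_\nu,h_\mu,h_\rho$ on $\mathbb R^d$ with $\nu=h_\nu\Pi$, $\mu=h_\mu\Pi$, $\rho=h_\rho\Pi$ (i.e. $\nu(x,dy)=h_\nu(y)\Pi(x,dy)$ etc.), $\Pi=\nu+\mu+\rho$, and for all $x$: $\nu(x,\mathbb R^d)<\infty$, $\int(1\wedge|y|)\mu(x,dy)<\infty$, $\int(|y|\wedge|y|^2)\rho(x,dy)<\infty$. Put $a_\pi(x)=-\int_{|y|<1}y\,\nu(x,dy)-\int_{|y|<1}y\,\mu(x,dy)+\int_{|y|\ge1}y\,\rho(x,dy)$. **Integrated tails.** A polar decomposition of a $\sigma$-finite measure $Q$ on $\mathbb R^d$ with $Q(\{0\})=0$ is a finite measure $Q_o$ on the unit sphere $S^{d-1}$ and a measurable family $(Q_\xi)_{\xi\in S^{d-1}}$ of $\sigma$-finite measures on $(0,\infty)$ with $Q_\xi((0,\infty))>0$ and $Q(B)=\int_{S^{d-1}}\int_{(0,\infty)}\mathbf 1_B(r\xi)Q_\xi(dr)Q_o(d\xi)$. For a Lévy kernel $Q$ choose for each $x$ a polar decomposition of $Q(x,\cdot)$ whose radial parts are Lévy measures. The integrated radial tail is $\overline Q(x,B)=\int_{S^{d-1}}\int_{(0,\infty)}\mathbf 1_B(z\xi)\int_{(z,\infty)}Q_\xi(x,dr)\,dz\,Q_o(x,d\xi)$, and, if $\int(|y|\wedge|y|^2)Q(x,dy)<\infty$ for all $x$ (radial parts chosen with $\int(r\wedge r^2)Q_\xi(x,dr)<\infty$),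 the double-integrated radial tail is $\overline{\overline Q}(x,B)=\int_{S^{d-1}}\int_{(0,\infty)}\mathbf 1_B(z_2\xi)\int_{(z_2,\infty)}\int_{(z_1,\infty)}Q_\xi(x,dr)\,dz_1\,dz_2\,Q_o(x,d\xi)$. Both are independent of the choice. **Jump functionals.** For a measure $\eta$ and test functions $f$: $\langle U^\pi(\eta),f\rangle=\int\big(\int f(x+y)\nu(x,dy)-f(x)\nu(x,\mathbb R^d)\big)\eta(dx)$, $\langle V^\pi_i(\eta),f\rangle=\int\int f(x+y)\frac{y_i}{|y|}\overline\mu(x,dy)\eta(dx)$, $\langle W^\pi_{ij}(\eta),f\rangle=\int\int f(x+y)\frac{y_iy_j}{|y|^2}\overline{\overline\rho}(x,dy)\eta(dx)$. **The space $\mathcal M(\mathcal A,\pi)$.** It is the set of measures $\eta$ on $\mathbb R^d$ such that $\nabla\cdot((a+a_\pi)\eta)$, $\frac12\nabla\cdot b\nabla\eta$, $U^\pi(\eta)$, $\nabla\cdot V^\pi(\eta)$, $\mathbf H\cdot W^\pi(\eta)$ define distributions. Here $\nabla\cdot F=\sum_i\partial_iF_i$ and $\mathbf H\cdot M=\sum_{i,j}\partial_i\partial_jM_{ij}$, with derivatives understood in the distributional sense; $\frac12\nabla\cdot b\nabla\eta$ is the functional $f\mapsto\int\frac12\nabla\cdot b\nabla f\,d\eta$.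
   Formalization: The sign of the term ∇·V^π(φ) is corrected from + to −: with distributional derivatives the printed + fails, e.g. for d=1, a=b=0, Π=μ=δ_1, φ=δ_0, where A'φ=δ_1−δ_0 but ∇·V^π(φ)=δ_0−δ_1. *)

theory Defs
  imports "HOL-Analysis.Analysis"
begin

section \<open>Derivatives, test functions and distributions\<close>

definition has_partial :: "'d::finite \<Rightarrow> (real^'d \<Rightarrow> real) \<Rightarrow> real^'d \<Rightarrow> bool" where
  "has_partial i f x \<longleftrightarrow> (\<lambda>t::real. f (x + t *\<^sub>R axis i 1)) field_differentiable (at 0)"

definition partial :: "'d::finite \<Rightarrow> (real^'d \<Rightarrow> real) \<Rightarrow> real^'d \<Rightarrow> real" where
  "partial i f x = deriv (\<lambda>t::real. f (x + t *\<^sub>R axis i 1)) 0"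

definition grad :: "(real^'d::finite \<Rightarrow> real) \<Rightarrow> real^'d \<Rightarrow> real^'d" where
  "grad f x = (\<chi> i. partial i f x)"

text \<open>Multi-indices are represented by lists of directions.\<close>

definition partials :: "'d::finite list \<Rightarrow> (real^'d \<Rightarrow> real) \<Rightarrow> real^'d \<Rightarrow> real" where
  "partials is f = foldr partial is f"

text \<open>Differentiability of all iterated partial derivatives entails their continuity, so this
  is the usual space of infinitely differentiable functions with compact support.\<close>

definition test_functions :: "(real^'d::finite \<Rightarrow> real) set" where
  "test_functions = {f. (\<forall>is. partials is f differentiable_on UNIV) \<and>
     compact (closure {x. f x \<noteq> 0})}"

type_synonym 'd functional = "(real^'d \<Rightarrow> real) \<Rightarrow> real"

definition distribution :: "'d::finite functional \<Rightarrow> bool" where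
  "distribution T \<longleftrightarrow>
     (\<forall>f\<in>test_functions. \<forall>g\<in>test_functions. T (\<lambda>x. f x + g x) = T f + T g) \<and>
     (\<forall>f\<in>test_functions. \<forall>c. T (\<lambda>x. c * f x) = c * T f) \<and>
     (\<forall>K. compact K \<longrightarrow> (\<exists>C m. \<forall>f\<in>test_functions. closure {x. f x \<noteq> 0} \<subseteq> K \<longrightarrow>
        \<bar>T f\<bar> \<le> C * (\<Sum>is | length is \<le> m. SUP x. \<bar>partials is f x\<bar>)))"

definition dist_partial :: "'d::finite \<Rightarrow> 'd functional \<Rightarrow> 'd functional" where
  "dist_partial i T f = - T (partial i f)"

definition dist_div :: "('d::finite \<Rightarrow> 'd functional) \<Rightarrow> 'd functional" where
  "dist_div F f = (\<Sum>i\<in>UNIV. dist_partial i (F i) f)"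

definition dist_hess :: "('d::finite \<Rightarrow> 'd \<Rightarrow> 'd functional) \<Rightarrow> 'd functional" where
  "dist_hess M f = (\<Sum>i\<in>UNIV. \<Sum>j\<in>UNIV. dist_partial i (dist_partial j (M i j)) f)"

section \<open>Banach spaces of functions and adjoints\<close>

definition fun_subspace :: "('a \<Rightarrow> real) set \<Rightarrow> bool" where
  "fun_subspace E \<longleftrightarrow> (\<lambda>_. 0) \<in> E \<and> (\<forall>f\<in>E. \<forall>g\<in>E. (\<lambda>x. f x + g x) \<in> E) \<and>
     (\<forall>f\<in>E. \<forall>c. (\<lambda>x. c * f x) \<in> E)"

definition banach_function_space :: "('a \<Rightarrow> real) set \<Rightarrow> (('a \<Rightarrow> real) \<Rightarrow> real) \<Rightarrow> bool" where
  "banach_function_space E N \<longleftrightarrow> fun_subspace E \<and>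
     (\<forall>f\<in>E. 0 \<le> N f \<and> (N f = 0 \<longleftrightarrow> f = (\<lambda>_. 0))) \<and>
     (\<forall>f\<in>E. \<forall>c. N (\<lambda>x. c * f x) = \<bar>c\<bar> * N f) \<and>
     (\<forall>f\<in>E. \<forall>g\<in>E. N (\<lambda>x. f x + g x) \<le> N f + N g) \<and>
     (\<forall>F::nat \<Rightarrow> 'a \<Rightarrow> real. (\<forall>n. F n \<in> E) \<longrightarrow>
        (\<forall>e>0. \<exists>n0. \<forall>m\<ge>n0. \<forall>n\<ge>n0. N (\<lambda>x. F m x - F n x) < e) \<longrightarrow>
        (\<exists>f\<in>E. (\<lambda>n. N (\<lambda>x. F n x - f x)) \<longlonglongrightarrow> 0))"

definition dense_in :: "(('a \<Rightarrow> real) \<Rightarrow> real) \<Rightarrow> ('a \<Rightarrow> real) set \<Rightarrow> ('a \<Rightarrow> real) set \<Rightarrow> bool" where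
  "dense_in N E D \<longleftrightarrow> D \<subseteq> E \<and> (\<forall>f\<in>E. \<forall>e>0. \<exists>g\<in>D. N (\<lambda>x. f x - g x) < e)"

text \<open>Functionals on \<open>E\<close> are made extensional, so that equality of elements of the dual is
  equality in HOL.\<close>

definition dual_space ::
    "('a \<Rightarrow> real) set \<Rightarrow> (('a \<Rightarrow> real) \<Rightarrow> real) \<Rightarrow> (('a \<Rightarrow> real) \<Rightarrow> real) set" where
  "dual_space E N = {T \<in> extensional E.
     (\<forall>f\<in>E. \<forall>g\<in>E. T (\<lambda>x. f x + g x) = T f + T g) \<and>
     (\<forall>f\<in>E. \<forall>c. T (\<lambda>x. c * f x) = c * T f) \<and>
     (\<exists>c. \<forall>f\<in>E. \<bar>T f\<bar> \<le> c * N f)}"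

definition adjoint_domain ::
    "('a \<Rightarrow> real) set \<Rightarrow> (('a \<Rightarrow> real) \<Rightarrow> real) \<Rightarrow> ('a \<Rightarrow> real) set
      \<Rightarrow> (('a \<Rightarrow> real) \<Rightarrow> 'a \<Rightarrow> real) \<Rightarrow> (('a \<Rightarrow> real) \<Rightarrow> real) set" where
  "adjoint_domain E N D A = {T \<in> dual_space E N. \<exists>c\<ge>0. \<forall>f\<in>D. \<bar>T (A f)\<bar> \<le> c * N f}"

definition adjoint_op ::
    "('a \<Rightarrow> real) set \<Rightarrow> (('a \<Rightarrow> real) \<Rightarrow> real) \<Rightarrow> ('a \<Rightarrow> real) set
      \<Rightarrow> (('a \<Rightarrow> real) \<Rightarrow> 'a \<Rightarrow> real) \<Rightarrow> (('a \<Rightarrow> real) \<Rightarrow> real) \<Rightarrow> (('a \<Rightarrow> real) \<Rightarrow> real)" where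
  "adjoint_op E N D A T = (THE S. S \<in> dual_space E N \<and> (\<forall>f\<in>D. S f = T (A f)))"

definition measure_functional :: "('a \<Rightarrow> real) set \<Rightarrow> 'a measure \<Rightarrow> ('a \<Rightarrow> real) \<Rightarrow> real" where
  "measure_functional E M = (\<lambda>g\<in>E. \<integral>x. g x \<partial>M)"

section \<open>Levy-type operators\<close>

text \<open>The jump kernel is written \<open>K\<close>, because the capital letter Pi is binder syntax in HOL.\<close>

definition levy_measure :: "(real^'d::finite) measure \<Rightarrow> bool" where
  "levy_measure Q \<longleftrightarrow> sets Q = sets borel \<and> emeasure Q {0} = 0 \<and>
     (\<integral>\<^sup>+y. ennreal (min 1 ((norm y)\<^sup>2)) \<partial>Q) < \<infinity>"

definition levy_kernel :: "(real^'d::finite \<Rightarrow> (real^'d) measure) \<Rightarrow> bool" where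
  "levy_kernel Q \<longleftrightarrow> (\<forall>x. levy_measure (Q x)) \<and>
     (\<forall>B\<in>sets borel. (\<lambda>x. emeasure (Q x) B) \<in> borel_measurable borel)"

definition characteristic_triplet ::
    "(real^'d::finite \<Rightarrow> real^'d) \<Rightarrow> (real^'d \<Rightarrow> real^'d^'d) \<Rightarrow> (real^'d \<Rightarrow> (real^'d) measure) \<Rightarrow> bool"
  where
  "characteristic_triplet a b K \<longleftrightarrow> a \<in> borel_measurable borel \<and> b \<in> borel_measurable borel \<and>
     (\<forall>x. transpose (b x) = b x \<and> (\<forall>v. 0 \<le> v \<bullet> (b x *v v))) \<and> levy_kernel K"

definition div_form :: "(real^'d::finite \<Rightarrow> real^'d^'d) \<Rightarrow> (real^'d \<Rightarrow> real) \<Rightarrow> real^'d \<Rightarrow> real" where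
  "div_form b f x = (\<Sum>i\<in>UNIV. \<Sum>j\<in>UNIV. partial i (\<lambda>z. b z $ i $ j * partial j f z) x)"

text \<open>The matrix function \<open>b\<close> is only Borel; the expression above is meaningful at \<open>x\<close> when the
  partial derivatives in it exist.\<close>

definition div_form_exists ::
    "(real^'d::finite \<Rightarrow> real^'d^'d) \<Rightarrow> (real^'d \<Rightarrow> real) \<Rightarrow> real^'d \<Rightarrow> bool" where
  "div_form_exists b f x \<longleftrightarrow> (\<forall>i j. has_partial i (\<lambda>z. b z $ i $ j * partial j f z) x)"

definition jump_integrand ::
    "(real^'d::finite \<Rightarrow> real) \<Rightarrow> real^'d \<Rightarrow> real^'d \<Rightarrow> real" where
  "jump_integrand f x y = f (x + y) - f x - (grad f x \<bullet> y) * indicator {y. norm y < 1} y"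

text \<open>That the operator is of the stated form includes that all derivatives and integrals in the
  formula exist for functions in the domain. The domain is a linear subspace, as for every linear
  operator; linearity of \<open>A\<close> then follows from the formula.\<close>

definition levy_type_operator ::
    "(real^'d::finite \<Rightarrow> real) set \<Rightarrow> (real^'d \<Rightarrow> real) set \<Rightarrow> ((real^'d \<Rightarrow> real) \<Rightarrow> real^'d \<Rightarrow> real)
      \<Rightarrow> (real^'d \<Rightarrow> real^'d) \<Rightarrow> (real^'d \<Rightarrow> real^'d^'d) \<Rightarrow> (real^'d \<Rightarrow> (real^'d) measure) \<Rightarrow> bool"
  where
  "levy_type_operator E D A a b K \<longleftrightarrow>
     D \<subseteq> E \<and> fun_subspace D \<and> (\<forall>f\<in>D. A f \<in> E) \<and> characteristic_triplet a b K \<and>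
     (\<forall>f\<in>D. \<forall>x. (\<forall>i. has_partial i f x) \<and> div_form_exists b f x \<and>
        integrable (K x) (jump_integrand f x) \<and>
        A f x = a x \<bullet> grad f x + 1/2 * div_form b f x + (\<integral>y. jump_integrand f x y \<partial>K x))"

section \<open>Convenient decompositions and integrated tails\<close>

definition convenient_decomposition ::
    "(real^'d::finite \<Rightarrow> (real^'d) measure) \<Rightarrow> (real^'d \<Rightarrow> (real^'d) measure)
      \<Rightarrow> (real^'d \<Rightarrow> (real^'d) measure) \<Rightarrow> (real^'d \<Rightarrow> (real^'d) measure) \<Rightarrow> bool" where
  "convenient_decomposition K \<nu> \<mu> \<rho> \<longleftrightarrow>
     (\<exists>h\<^sub>\<nu> h\<^sub>\<mu> h\<^sub>\<rho> :: real^'d \<Rightarrow> real.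
        continuous_on UNIV h\<^sub>\<nu> \<and> continuous_on UNIV h\<^sub>\<mu> \<and> continuous_on UNIV h\<^sub>\<rho> \<and>
        (\<forall>y. 0 \<le> h\<^sub>\<nu> y \<and> 0 \<le> h\<^sub>\<mu> y \<and> 0 \<le> h\<^sub>\<rho> y) \<and>
        (\<forall>x. \<nu> x = density (K x) (\<lambda>y. ennreal (h\<^sub>\<nu> y)) \<and>
             \<mu> x = density (K x) (\<lambda>y. ennreal (h\<^sub>\<mu> y)) \<and>
             \<rho> x = density (K x) (\<lambda>y. ennreal (h\<^sub>\<rho> y)))) \<and>
     (\<forall>x. \<forall>B\<in>sets borel.
        emeasure (K x) B = emeasure (\<nu> x) B + emeasure (\<mu> x) B + emeasure (\<rho> x) B) \<and>
     (\<forall>x. emeasure (\<nu> x) UNIV < \<infinity> \<and>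
        (\<integral>\<^sup>+y. ennreal (min 1 (norm y)) \<partial>\<mu> x) < \<infinity> \<and>
        (\<integral>\<^sup>+y. ennreal (min (norm y) ((norm y)\<^sup>2)) \<partial>\<rho> x) < \<infinity>)"

definition a_pi ::
    "(real^'d::finite \<Rightarrow> (real^'d) measure) \<Rightarrow> (real^'d \<Rightarrow> (real^'d) measure)
      \<Rightarrow> (real^'d \<Rightarrow> (real^'d) measure) \<Rightarrow> real^'d \<Rightarrow> real^'d" where
  "a_pi \<nu> \<mu> \<rho> x = - (LINT y:{y. norm y < 1}|\<nu> x. y) - (LINT y:{y. norm y < 1}|\<mu> x. y)
     + (LINT y:{y. 1 \<le> norm y}|\<rho> x. y)"

text \<open>\<open>So\<close> is the spherical part, with underlying space the unit sphere, and \<open>R \<xi>\<close> the radial part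
  in direction \<open>\<xi>\<close>, with underlying space \<open>{0<..}\<close>.\<close>

definition polar_decomposition ::
    "(real^'d::finite) measure \<Rightarrow> (real^'d) measure \<Rightarrow> (real^'d \<Rightarrow> real measure) \<Rightarrow> bool" where
  "polar_decomposition Q So R \<longleftrightarrow>
     sets So = sets (restrict_space borel (sphere 0 1)) \<and> finite_measure So \<and>
     (\<forall>\<xi>\<in>sphere 0 1. sets (R \<xi>) = sets (restrict_space borel {0<..}) \<and>
        sigma_finite_measure (R \<xi>) \<and> 0 < emeasure (R \<xi>) {0<..}) \<and>
     (\<forall>B\<in>sets (restrict_space borel {0<..}). (\<lambda>\<xi>. emeasure (R \<xi>) B) \<in> borel_measurable So) \<and>
     (\<forall>B\<in>sets borel. emeasure Q B = (\<integral>\<^sup>+\<xi>. (\<integral>\<^sup>+r. indicator B (r *\<^sub>R \<xi>) \<partial>R \<xi>) \<partial>So))"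

definition levy_polar ::
    "(real^'d::finite) measure \<Rightarrow> (real^'d) measure \<times> (real^'d \<Rightarrow> real measure)" where
  "levy_polar Q = (SOME (So, R). polar_decomposition Q So R \<and>
     (\<forall>\<xi>\<in>sphere 0 1. (\<integral>\<^sup>+r. ennreal (min 1 (r\<^sup>2)) \<partial>R \<xi>) < \<infinity>))"

definition integrated_tail :: "(real^'d::finite) measure \<Rightarrow> (real^'d) measure" where
  "integrated_tail Q = (case levy_polar Q of (So, R) \<Rightarrow> measure_of UNIV (sets borel) (\<lambda>B.
     \<integral>\<^sup>+\<xi>. (\<integral>\<^sup>+z\<in>{0<..}. indicator B (z *\<^sub>R \<xi>) * emeasure (R \<xi>) {z<..} \<partial>lborel) \<partial>So))"

definition levy_polar_int ::
    "(real^'d::finite) measure \<Rightarrow> (real^'d) measure \<times> (real^'d \<Rightarrow> real measure)" where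
  "levy_polar_int Q = (SOME (So, R). polar_decomposition Q So R \<and>
     (\<forall>\<xi>\<in>sphere 0 1. (\<integral>\<^sup>+r. ennreal (min r (r\<^sup>2)) \<partial>R \<xi>) < \<infinity>))"

definition double_integrated_tail :: "(real^'d::finite) measure \<Rightarrow> (real^'d) measure" where
  "double_integrated_tail Q =
     (case levy_polar_int Q of (So, R) \<Rightarrow> measure_of UNIV (sets borel) (\<lambda>B.
       \<integral>\<^sup>+\<xi>. (\<integral>\<^sup>+z\<^sub>2\<in>{0<..}. indicator B (z\<^sub>2 *\<^sub>R \<xi>) *
         (\<integral>\<^sup>+z\<^sub>1\<in>{z\<^sub>2<..}. emeasure (R \<xi>) {z\<^sub>1<..} \<partial>lborel) \<partial>lborel) \<partial>So))"

section \<open>The functionals associated with a measure\<close>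

definition vector_measure :: "(real^'d::finite \<Rightarrow> real^'d) \<Rightarrow> (real^'d) measure \<Rightarrow> 'd \<Rightarrow> 'd functional"
  where "vector_measure c \<eta> i f = (\<integral>x. f x * c x $ i \<partial>\<eta>)"

definition diffusion_functional ::
    "(real^'d::finite \<Rightarrow> real^'d^'d) \<Rightarrow> (real^'d) measure \<Rightarrow> 'd functional" where
  "diffusion_functional b \<eta> f = (\<integral>x. 1/2 * div_form b f x \<partial>\<eta>)"

definition U_inner :: "(real^'d::finite \<Rightarrow> (real^'d) measure) \<Rightarrow> (real^'d \<Rightarrow> real) \<Rightarrow> real^'d \<Rightarrow> real"
  where "U_inner \<nu> f x = (\<integral>y. f (x + y) \<partial>\<nu> x) - f x * measure (\<nu> x) UNIV"

definition V_inner ::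
    "(real^'d::finite \<Rightarrow> (real^'d) measure) \<Rightarrow> 'd \<Rightarrow> (real^'d \<Rightarrow> real) \<Rightarrow> real^'d \<Rightarrow> real" where
  "V_inner \<mu> i f x = (\<integral>y. f (x + y) * (y $ i / norm y) \<partial>integrated_tail (\<mu> x))"

definition W_inner ::
    "(real^'d::finite \<Rightarrow> (real^'d) measure) \<Rightarrow> 'd \<Rightarrow> 'd \<Rightarrow> (real^'d \<Rightarrow> real) \<Rightarrow> real^'d \<Rightarrow> real" where
  "W_inner \<rho> i j f x =
     (\<integral>y. f (x + y) * (y $ i * y $ j / (norm y)\<^sup>2) \<partial>double_integrated_tail (\<rho> x))"

definition U_functional ::
    "(real^'d::finite \<Rightarrow> (real^'d) measure) \<Rightarrow> (real^'d) measure \<Rightarrow> 'd functional" where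
  "U_functional \<nu> \<eta> f = (\<integral>x. U_inner \<nu> f x \<partial>\<eta>)"

definition V_functional ::
    "(real^'d::finite \<Rightarrow> (real^'d) measure) \<Rightarrow> (real^'d) measure \<Rightarrow> 'd \<Rightarrow> 'd functional" where
  "V_functional \<mu> \<eta> i f = (\<integral>x. V_inner \<mu> i f x \<partial>\<eta>)"

text \<open>Sign pitfall: for a test function \<open>f\<close> one has
  \<open>\<integral>(f (x + y) - f x) \<mu>(x, dy) = (\<Sum>i. V_inner \<mu> i (partial i f) x)\<close>, and the distributional
  derivative is \<open>dist_partial i T f = - T (partial i f)\<close>. Hence the \<open>\<mu>\<close>-part of the operator,
  integrated against \<open>\<eta>\<close>, is \<open>- dist_div (V_functional \<mu> \<eta>) f\<close>, with a minus sign as in the drift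
  part, whereas the second-order \<open>\<rho>\<close>-part is \<open>+ dist_hess (W_functional \<rho> \<eta>) f\<close>.\<close>

definition W_functional ::
    "(real^'d::finite \<Rightarrow> (real^'d) measure) \<Rightarrow> (real^'d) measure \<Rightarrow> 'd \<Rightarrow> 'd \<Rightarrow> 'd functional" where
  "W_functional \<rho> \<eta> i j f = (\<integral>x. W_inner \<rho> i j f x \<partial>\<eta>)"

text \<open>A functional given by integrals defines a distribution if the integrals it consists of
  converge absolutely for every test function, and the resulting functional is a distribution.
  Convergence has to be required explicitly, because divergent Bochner integrals are \<open>0\<close> in HOL.
  For derivatives of \<open>V\<close> and \<open>W\<close>, only the values on derivatives of test functions matter.\<close>

definition M_space ::
    "(real^'d::finite \<Rightarrow> real^'d) \<Rightarrow> (real^'d \<Rightarrow> real^'d^'d) \<Rightarrow> (real^'d \<Rightarrow> (real^'d) measure)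
      \<Rightarrow> (real^'d \<Rightarrow> (real^'d) measure) \<Rightarrow> (real^'d \<Rightarrow> (real^'d) measure) \<Rightarrow> (real^'d) measure set"
  where
  "M_space a b \<nu> \<mu> \<rho> = {\<eta>. sets \<eta> = sets borel \<and>
     (\<forall>f\<in>test_functions.
        (\<forall>i. integrable \<eta> (\<lambda>x. partial i f x * (a x + a_pi \<nu> \<mu> \<rho> x) $ i)) \<and>
        (\<forall>x. div_form_exists b f x) \<and> integrable \<eta> (\<lambda>x. 1/2 * div_form b f x) \<and>
        integrable \<eta> (U_inner \<nu> f) \<and>
        (\<forall>i. integrable \<eta> (V_inner \<mu> i (partial i f))) \<and>
        (\<forall>i j. integrable \<eta> (W_inner \<rho> i j (partial j (partial i f))))) \<and>
     distribution (dist_div (vector_measure (\<lambda>x. a x + a_pi \<nu> \<mu> \<rho> x) \<eta>)) \<and>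
     distribution (diffusion_functional b \<eta>) \<and>
     distribution (U_functional \<nu> \<eta>) \<and>
     distribution (dist_div (V_functional \<mu> \<eta>)) \<and>
     distribution (dist_hess (W_functional \<rho> \<eta>))}"

end

theory Submission
  imports Defs "HOL-Probability.Probability"
begin

text \<open>Since the domain is dense, the adjoint applied to \<open>\<phi>\<close> is the unique bounded extension of
  \<open>f \<mapsto> \<integral> A f d\<phi>\<close>, so everything reduces to a pointwise identity for the jump part of \<open>A f\<close> at a
  test function \<open>f\<close>. By Tonelli, integrating \<open>g\<close> against the integrated radial tail of \<open>Q\<close> amounts to
  integrating \<open>y \<mapsto> \<integral>\<^sub>0\<^sup>r g (z \<theta>) dz\<close>, where \<open>r = norm y\<close> and \<open>\<theta> = sgn y\<close>, against \<open>Q\<close>; for the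
  double tail there is an additional factor \<open>r - z\<close>. Hence the two tails turn first and second
  derivatives along rays into \<open>f (x + y) - f x\<close> and \<open>f (x + y) - f x - grad f x \<bullet> y\<close>, which is
  Taylor's formula with integral remainder. Both tails are defined through a chosen
  polar decomposition, so its existence has to be established: it is a disintegration of \<open>Q\<close> along
  \<open>sgn\<close>, obtained from Radon-Nikodym densities of \<open>B \<mapsto> Q {y. sgn y \<in> B, norm y \<le> t}\<close>.\<close>

section \<open>Extension of bounded functionals\<close>

text \<open>The jump measure \<open>Q\<close> may have infinite mass near the origin, while
  disintegration needs a finite measure. So \<open>Q\<close> is weighted with
  \<open>w (norm y)\<close> and the radial parts are divided by \<open>w\<close> afterwards.
  Choosing for \<open>w\<close> the very function that the definition of the tail wants integrable
  along each ray, \<open>min 1 (r^2)\<close> or \<open>min r (r^2)\<close>, yields that radial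
  integrability as well. What SOME picks is known only through its defining properties, so each tail
  is rewritten as \<open>radial_smear Q u\<close>, an expression in \<open>Q\<close> alone; the
  later analysis lives on the product of \<open>Q\<close> with Lebesgue measure. On the
  functional-analytic side \<open>adjoint_op\<close> is a THE: it says nothing until unique
  existence is proved, and this needs linearity of \<open>A\<close>, which has to be read off from
  its formula. Divergent Bochner integrals are 0, so every splitting of an integral must be paid for
  with integrability: in \<open>y\<close> it comes from bounded support and the moment conditions on
  the three kernels, in \<open>x\<close> from membership in \<open>M_space\<close>.\<close>

lemma banach_function_spaceD:
  assumes "banach_function_space E N"
  shows "fun_subspace E" "f \<in> E \<Longrightarrow> 0 \<le> N f" "f \<in> E \<Longrightarrow> N (\<lambda>x. c * f x) = \<bar>c\<bar> * N f"
    "f \<in> E \<Longrightarrow> g \<in> E \<Longrightarrow> N (\<lambda>x. f x + g x) \<le> N f + N g"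
  using assms unfolding banach_function_space_def by auto

lemma fun_subspace_add: "fun_subspace E \<Longrightarrow> f \<in> E \<Longrightarrow> g \<in> E \<Longrightarrow> (\<lambda>x. f x + g x) \<in> E"
  and fun_subspace_scale: "fun_subspace E \<Longrightarrow> f \<in> E \<Longrightarrow> (\<lambda>x. c * f x) \<in> E"
  by (simp_all add: fun_subspace_def)

lemma fun_subspace_diff: "fun_subspace E \<Longrightarrow> f \<in> E \<Longrightarrow> g \<in> E \<Longrightarrow> (\<lambda>x. f x - g x) \<in> E"
  using fun_subspace_add[of E f "\<lambda>x. - 1 * g x"] fun_subspace_scale[of E g "- 1"] by simp

lemma norm_diff_commute:
  assumes "banach_function_space E N" "f \<in> E" "g \<in> E"
  shows "N (\<lambda>x. f x - g x) = N (\<lambda>x. g x - f x)"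
  using banach_function_spaceD(3)[OF assms(1) fun_subspace_diff[OF banach_function_spaceD(1)[OF assms(1)] assms(2,3)], of "-1"]
  by simp

lemma norm_diff_triangle:
  assumes "banach_function_space E N" "f \<in> E" "g \<in> E" "h \<in> E"
  shows "N (\<lambda>x. f x - h x) \<le> N (\<lambda>x. f x - g x) + N (\<lambda>x. g x - h x)"
proof -
  have s: "fun_subspace E" using assms banach_function_spaceD by blast
  have "N (\<lambda>x. (f x - g x) + (g x - h x)) \<le> N (\<lambda>x. f x - g x) + N (\<lambda>x. g x - h x)"
    using banach_function_spaceD(4)[OF assms(1)] fun_subspace_diff[OF s] assms by blast
  then show ?thesis by simp
qed

lemma dual_space_add:
  "T \<in> dual_space E N \<Longrightarrow> f \<in> E \<Longrightarrow> g \<in> E \<Longrightarrow> T (\<lambda>x. f x + g x) = T f + T g"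
  by (simp add: dual_space_def)

text \<open>The bound makes \<open>L\<close> Lipschitz on \<open>D\<close>, so it maps
  norm-convergent sequences in \<open>D\<close> to Cauchy sequences of reals, whose limit depends
  only on the point approximated. Uniqueness holds because a bounded functional is continuous, hence
  determined by its values on a dense set; extensionality settles the values outside
  \<open>E\<close>.\<close>

lemma bounded_extension:
  fixes E D :: "('a \<Rightarrow> real) set"
  assumes B: "banach_function_space E N" and dense: "dense_in N E D" and D: "fun_subspace D"
    and add: "\<And>f g. f \<in> D \<Longrightarrow> g \<in> D \<Longrightarrow> L (\<lambda>x. f x + g x) = L f + L g"
    and scale: "\<And>f c. f \<in> D \<Longrightarrow> L (\<lambda>x. c * f x) = c * L f"
    and bound: "\<And>f. f \<in> D \<Longrightarrow> \<bar>L f\<bar> \<le> c * N f" and c: "0 \<le> c"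
  shows "\<exists>!S. S \<in> dual_space E N \<and> (\<forall>f\<in>D. S f = L f)"
proof -
  have DE: "D \<subseteq> E" using dense unfolding dense_in_def by blast
  have sE: "fun_subspace E" using B banach_function_spaceD by blast
  have Ldiff: "\<bar>L f - L g\<bar> \<le> c * N (\<lambda>x. f x - g x)" if "f \<in> D" "g \<in> D" for f g
  proof -
    have m: "(\<lambda>x. (-1) * g x) \<in> D" using fun_subspace_scale[OF D that(2)] .
    have "L (\<lambda>x. f x + (-1) * g x) = L f + (-1) * L g"
      using add[OF that(1) m] scale[OF that(2), of "-1"] by simp
    then have "L (\<lambda>x. f x - g x) = L f - L g" by simp
    then show ?thesis using bound[OF fun_subspace_diff[OF D that]] by simp
  qed
  \<comment> \<open>One approximating sequence \<open>G f\<close> is fixed for every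
    \<open>f\<close>, so that the extension can be written down as a function.\<close>
  have "\<exists>g. \<forall>n. g n \<in> D \<and> N (\<lambda>x. f x - g n x) < inverse (Suc n)" if "f \<in> E" for f
    using dense that unfolding dense_in_def by (intro choice) (auto simp: Bex_def)
  then obtain G where G: "\<And>f n. f \<in> E \<Longrightarrow> G f n \<in> D"
      "\<And>f n. f \<in> E \<Longrightarrow> N (\<lambda>x. f x - G f n x) < inverse (Suc n)"
    by metis
  have nonneg: "0 \<le> N (\<lambda>x. f x - g x)" if "f \<in> E" "g \<in> E" for f g
    using banach_function_spaceD(2)[OF B] fun_subspace_diff[OF sE] that by blast
  have GN: "(\<lambda>n. N (\<lambda>x. f x - G f n x)) \<longlonglongrightarrow> 0" if f: "f \<in> E" for f
  proof (rule tendsto_sandwich[OF _ _ tendsto_const LIMSEQ_inverse_real_of_nat])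
    show "\<forall>\<^sub>F n in sequentially. 0 \<le> N (\<lambda>x. f x - G f n x)"
      by (intro always_eventually allI nonneg[OF f] subsetD[OF DE] G(1)[OF f])
    show "\<forall>\<^sub>F n in sequentially. N (\<lambda>x. f x - G f n x) \<le> inverse (real (Suc n))"
      by (intro always_eventually allI less_imp_le G(2)[OF f])
  qed
  have conv: "convergent (\<lambda>n. L (G f n))" if f: "f \<in> E" for f
  proof (rule Cauchy_convergent, rule CauchyI)
    fix e :: real assume e: "0 < e"
    \<comment> \<open>The 2 accounts for the two approximants compared; the \<open>+ 1\<close>
      avoids division by zero when \<open>c = 0\<close> and makes the final inequality
      strict.\<close>
    define d where "d = e / (2 * (c + 1))"
    have d: "0 < d" using e c by (simp add: d_def)
    obtain M where M: "\<And>n. n \<ge> M \<Longrightarrow> N (\<lambda>x. f x - G f n x) < d"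
      using order_tendstoD(2)[OF GN[OF f] d] unfolding eventually_sequentially by blast
    have "norm (L (G f m) - L (G f n)) < e" if "m \<ge> M" "n \<ge> M" for m n
    proof -
      have "N (\<lambda>x. G f m x - G f n x) \<le> N (\<lambda>x. G f m x - f x) + N (\<lambda>x. f x - G f n x)"
        using norm_diff_triangle[OF B] G(1)[OF f] DE f by blast
      also have "N (\<lambda>x. G f m x - f x) = N (\<lambda>x. f x - G f m x)"
        using norm_diff_commute[OF B] G(1)[OF f] DE f by blast
      finally have *: "N (\<lambda>x. G f m x - G f n x) \<le> 2 * d" using M[OF that(1)] M[OF that(2)] by linarith
      have "\<bar>L (G f m) - L (G f n)\<bar> \<le> c * N (\<lambda>x. G f m x - G f n x)" using Ldiff G(1)[OF f] by blast
      also have "\<dots> \<le> c * (2 * d)" using * c by (intro mult_left_mono)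
      also have "\<dots> < (c + 1) * (2 * d)" using d by simp
      also have "\<dots> = e" using c by (simp add: d_def field_simps)
      finally show ?thesis by simp
    qed
    then show "\<exists>M. \<forall>m\<ge>M. \<forall>n\<ge>M. norm (L (G f m) - L (G f n)) < e" by blast
  qed
  define S where "S = (\<lambda>f\<in>E. lim (\<lambda>n. L (G f n)))"
  \<comment> \<open>The limit does not depend on the approximating sequence. Additivity and
    homogeneity follow by using sums and multiples of the chosen sequences, and agreement with
    \<open>L\<close> on \<open>D\<close> by using a constant sequence.\<close>
  have lim: "(\<lambda>n. L (h n)) \<longlonglongrightarrow> S f"
    if f: "f \<in> E" and h: "\<And>n. h n \<in> D" and hf: "(\<lambda>n. N (\<lambda>x. f x - h n x)) \<longlonglongrightarrow> 0" for f h
  proof -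
    have 1: "(\<lambda>n. L (G f n)) \<longlonglongrightarrow> S f"
      using conv[OF f] f by (simp add: S_def convergent_LIMSEQ_iff)
    have "(\<lambda>n. L (h n) - L (G f n)) \<longlonglongrightarrow> 0"
    proof (rule Lim_null_comparison)
      show "\<forall>\<^sub>F n in sequentially. norm (L (h n) - L (G f n))
              \<le> c * (N (\<lambda>x. f x - h n x) + N (\<lambda>x. f x - G f n x))"
      proof (rule always_eventually, rule allI)
        fix n
        have "N (\<lambda>x. h n x - G f n x) \<le> N (\<lambda>x. h n x - f x) + N (\<lambda>x. f x - G f n x)"
          using norm_diff_triangle[OF B] G(1)[OF f] DE f h by blast
        also have "N (\<lambda>x. h n x - f x) = N (\<lambda>x. f x - h n x)"
          using norm_diff_commute[OF B] DE f h by blast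
        finally show "norm (L (h n) - L (G f n)) \<le> c * (N (\<lambda>x. f x - h n x) + N (\<lambda>x. f x - G f n x))"
          using Ldiff[OF h G(1)[OF f], of n n] c by (smt (verit) mult_left_mono real_norm_def)
      qed
      show "(\<lambda>n. c * (N (\<lambda>x. f x - h n x) + N (\<lambda>x. f x - G f n x))) \<longlonglongrightarrow> 0"
        by (rule tendsto_eq_intros hf GN[OF f] refl | simp)+
    qed
    from tendsto_add[OF this 1] show ?thesis by simp
  qed
  have S_D: "S f = L f" if "f \<in> D" for f
  proof -
    have "N (\<lambda>x. f x - f x) = 0"
      using B unfolding banach_function_space_def fun_subspace_def by simp
    then have "(\<lambda>n::nat. L f) \<longlonglongrightarrow> S f" using lim[of f "\<lambda>_. f"] that DE by auto
    then show ?thesis using LIMSEQ_unique tendsto_const by metis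
  qed
  have S_add: "S (\<lambda>x. f x + g x) = S f + S g" if f: "f \<in> E" and g: "g \<in> E" for f g
  proof -
    have fg: "(\<lambda>x. f x + g x) \<in> E" using fun_subspace_add[OF sE f g] .
    have GD: "(\<lambda>x. G f n x + G g n x) \<in> D" for n
      using fun_subspace_add[OF D G(1)[OF f] G(1)[OF g]] .
    have "(\<lambda>n. N (\<lambda>x. (f x + g x) - (G f n x + G g n x))) \<longlonglongrightarrow> 0"
    proof (rule tendsto_sandwich[OF _ _ tendsto_const])
      show "\<forall>\<^sub>F n in sequentially. 0 \<le> N (\<lambda>x. f x + g x - (G f n x + G g n x))"
        by (intro always_eventually allI nonneg[OF fg] subsetD[OF DE] GD)
      show "\<forall>\<^sub>F n in sequentially. N (\<lambda>x. f x + g x - (G f n x + G g n x))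
          \<le> N (\<lambda>x. f x - G f n x) + N (\<lambda>x. g x - G g n x)"
      proof (rule always_eventually, rule allI)
        fix n
        have "N (\<lambda>x. (f x - G f n x) + (g x - G g n x)) \<le> N (\<lambda>x. f x - G f n x) + N (\<lambda>x. g x - G g n x)"
          using banach_function_spaceD(4)[OF B] fun_subspace_diff[OF sE] f g G(1) DE by blast
        then show "N (\<lambda>x. f x + g x - (G f n x + G g n x))
            \<le> N (\<lambda>x. f x - G f n x) + N (\<lambda>x. g x - G g n x)" by (simp add: algebra_simps)
      qed
      show "(\<lambda>n. N (\<lambda>x. f x - G f n x) + N (\<lambda>x. g x - G g n x)) \<longlonglongrightarrow> 0"
        using tendsto_add[OF GN[OF f] GN[OF g]] by simp
    qed
    then have "(\<lambda>n. L (\<lambda>x. G f n x + G g n x)) \<longlonglongrightarrow> S (\<lambda>x. f x + g x)" by (rule lim[OF fg GD])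
    moreover have "(\<lambda>n. L (\<lambda>x. G f n x + G g n x)) \<longlonglongrightarrow> S f + S g"
      using tendsto_add[OF lim[OF f G(1)[OF f] GN[OF f]] lim[OF g G(1)[OF g] GN[OF g]]]
        add[OF G(1)[OF f] G(1)[OF g]] by simp
    ultimately show ?thesis using LIMSEQ_unique by blast
  qed
  have S_scale: "S (\<lambda>x. k * f x) = k * S f" if f: "f \<in> E" for f k
  proof -
    have kf: "(\<lambda>x. k * f x) \<in> E" using fun_subspace_scale[OF sE f] .
    have GD: "(\<lambda>x. k * G f n x) \<in> D" for n
      using fun_subspace_scale[OF D G(1)[OF f]] .
    have "N (\<lambda>x. k * f x - k * G f n x) = \<bar>k\<bar> * N (\<lambda>x. f x - G f n x)" for n
      using banach_function_spaceD(3)[OF B, of "\<lambda>x. f x - G f n x" k] fun_subspace_diff[OF sE f] G(1)[OF f] DE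
      by (auto simp: algebra_simps)
    then have "(\<lambda>n. N (\<lambda>x. k * f x - k * G f n x)) \<longlonglongrightarrow> 0"
      using tendsto_mult_left[OF GN[OF f], of "\<bar>k\<bar>"] by simp
    then have "(\<lambda>n. L (\<lambda>x. k * G f n x)) \<longlonglongrightarrow> S (\<lambda>x. k * f x)" by (rule lim[OF kf GD])
    moreover have "(\<lambda>n. L (\<lambda>x. k * G f n x)) \<longlonglongrightarrow> k * S f"
      using tendsto_mult_left[OF lim[OF f G(1)[OF f] GN[OF f]], of k] scale[OF G(1)[OF f]] by simp
    ultimately show ?thesis using LIMSEQ_unique by blast
  qed
  have S_bound: "\<bar>S f\<bar> \<le> c * N f" if f: "f \<in> E" for f
  proof (rule tendsto_le[OF _ _ tendsto_rabs[OF lim[OF f G(1)[OF f] GN[OF f]]]])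
    show "(\<lambda>n. c * (N f + N (\<lambda>x. f x - G f n x))) \<longlonglongrightarrow> c * N f"
      by (rule tendsto_eq_intros GN[OF f] refl | simp)+
    show "\<forall>\<^sub>F n in sequentially. \<bar>L (G f n)\<bar> \<le> c * (N f + N (\<lambda>x. f x - G f n x))"
    proof (rule always_eventually, rule allI)
      fix n
      have "N (\<lambda>x. f x + (G f n x - f x)) \<le> N f + N (\<lambda>x. G f n x - f x)"
        using banach_function_spaceD(4)[OF B] fun_subspace_diff[OF sE] f G(1) DE by blast
      also have "N (\<lambda>x. G f n x - f x) = N (\<lambda>x. f x - G f n x)"
        using norm_diff_commute[OF B] DE f G(1)[OF f] by blast
      finally have "N (G f n) \<le> N f + N (\<lambda>x. f x - G f n x)" by simp
      then show "\<bar>L (G f n)\<bar> \<le> c * (N f + N (\<lambda>x. f x - G f n x))"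
        using bound[OF G(1)[OF f], of n] c by (smt (verit) mult_left_mono)
    qed
  qed simp
  have "S \<in> dual_space E N"
    unfolding dual_space_def mem_Collect_eq
    using S_add S_scale S_bound by (intro conjI) (auto simp: S_def intro!: exI[of _ c])
  moreover have "S' = S" if S': "S' \<in> dual_space E N" and eq: "\<forall>f\<in>D. S' f = L f" for S'
  proof (rule extensionalityI[where A = E])
    show "S' \<in> extensional E" using S' by (simp add: dual_space_def)
    show "S \<in> extensional E" by (simp add: S_def)
    fix f assume f: "f \<in> E"
    have S'diff: "S' f - S' g = S' (\<lambda>x. f x - g x)" if "g \<in> E" for g
      using dual_space_add[OF S' fun_subspace_diff[OF sE f that] that] by simp
    obtain c' where c': "\<And>f. f \<in> E \<Longrightarrow> \<bar>S' f\<bar> \<le> c' * N f" using S' unfolding dual_space_def by blast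
    have "(\<lambda>n. S' (G f n) - S' f) \<longlonglongrightarrow> 0"
    proof (rule Lim_null_comparison)
      show "\<forall>\<^sub>F n in sequentially. norm (S' (G f n) - S' f) \<le> c' * N (\<lambda>x. f x - G f n x)"
      proof (rule always_eventually, rule allI)
        fix n
        have g: "G f n \<in> E" using G(1)[OF f] DE by blast
        show "norm (S' (G f n) - S' f) \<le> c' * N (\<lambda>x. f x - G f n x)"
          using S'diff[OF g] c'[OF fun_subspace_diff[OF sE f g]] by simp
      qed
      show "(\<lambda>n. c' * N (\<lambda>x. f x - G f n x)) \<longlonglongrightarrow> 0" using tendsto_mult_right_zero[OF GN[OF f]] .
    qed
    then have "(\<lambda>n. L (G f n)) \<longlonglongrightarrow> S' f" using eq G(1)[OF f] by (simp add: LIM_zero_iff)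
    then show "S' f = S f" using lim[OF f G(1)[OF f] GN[OF f]] LIMSEQ_unique by blast
  qed
  ultimately show ?thesis using S_D by blast
qed

section \<open>Disintegration along a map\<close>

text \<open>The set \<open>A\<close> where \<open>g < f\<close> serves as test set: on it
  \<open>f - g\<close> is positive, yet its integral is at most 0. Finiteness of the integral of
  \<open>g\<close> keeps the subtraction of the two integrals meaningful in
  \<open>ennreal\<close>.\<close>

lemma AE_le_if_set_nn_integral_le:
  assumes [measurable]: "f \<in> borel_measurable M" "g \<in> borel_measurable M"
    and fin: "(\<integral>\<^sup>+x. g x \<partial>M) < \<infinity>"
    and le: "\<And>A. A \<in> sets M \<Longrightarrow> (\<integral>\<^sup>+x\<in>A. f x \<partial>M) \<le> (\<integral>\<^sup>+x\<in>A. g x \<partial>M)"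
  shows "AE x in M. f x \<le> (g x :: ennreal)"
proof -
  define A where "A = {x \<in> space M. g x < f x}"
  have A[measurable]: "A \<in> sets M" unfolding A_def by measurable
  have finA: "(\<integral>\<^sup>+x\<in>A. g x \<partial>M) < \<infinity>"
    by (rule le_less_trans[OF nn_integral_mono fin]) (auto simp: indicator_def)
  have "(\<integral>\<^sup>+x. f x * indicator A x - g x * indicator A x \<partial>M)
      = (\<integral>\<^sup>+x\<in>A. f x \<partial>M) - (\<integral>\<^sup>+x\<in>A. g x \<partial>M)"
    using finA by (intro nn_integral_diff) (auto simp: A_def indicator_def less_top)
  also have "\<dots> = 0" using le[OF A] finA by (auto simp: diff_eq_0_iff_ennreal intro: le_less_trans)
  finally have "AE x in M. f x * indicator A x - g x * indicator A x = 0"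
    by (subst (asm) nn_integral_0_iff_AE) auto
  with AE_space show ?thesis
  proof eventually_elim
    case (elim x)
    then show ?case
      by (cases "g x < f x") (auto simp: A_def diff_eq_0_iff_ennreal)
  qed
qed

context
  fixes M :: "'a measure" and S :: "'b measure" and d :: "'a \<Rightarrow> 'b" and r :: "'a \<Rightarrow> real"
  assumes fin: "finite_measure M" and d[measurable]: "d \<in> measurable M S"
    and r[measurable]: "r \<in> borel_measurable M"
begin

text \<open>\<open>F t \<xi>\<close> is the conditional probability of \<open>r y \<le> t\<close>
  given \<open>d y = \<xi>\<close>. The image under \<open>d\<close> of the part of \<open>M\<close>
  where \<open>r y \<le> t\<close> is dominated by the full image, hence has a density. Each
  \<open>t\<close> gets its own density up to its own null set, so nothing links different
  \<open>t\<close> yet.\<close>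

lemma conditional_distribution_function:
  obtains F :: "real \<Rightarrow> 'b \<Rightarrow> ennreal"
  where "\<And>t. F t \<in> borel_measurable S"
    and "\<And>t B. B \<in> sets S \<Longrightarrow> (\<integral>\<^sup>+\<xi>\<in>B. F t \<xi> \<partial>distr M S d) = emeasure M {y \<in> space M. d y \<in> B \<and> r y \<le> t}"
proof -
  interpret M: finite_measure M by (fact fin)
  interpret So: finite_measure "distr M S d" by (rule M.finite_measure_distr) simp
  define V where "V t = distr (density M (indicator {y. r y \<le> t})) S d" for t
  have V: "emeasure (V t) B = emeasure M {y \<in> space M. d y \<in> B \<and> r y \<le> t}" if [measurable]: "B \<in> sets S" for t B
  proof -
    have "emeasure (V t) B = emeasure (density M (indicator {y. r y \<le> t})) (d -` B \<inter> space M)"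
      unfolding V_def by (subst emeasure_distr) auto
    also have "\<dots> = (\<integral>\<^sup>+y. indicator {y. r y \<le> t} y * indicator (d -` B \<inter> space M) y \<partial>M)"
      by (intro emeasure_density) measurable
    also have "\<dots> = (\<integral>\<^sup>+y. indicator {y \<in> space M. d y \<in> B \<and> r y \<le> t} y \<partial>M)"
      by (intro nn_integral_cong) (auto simp: indicator_def)
    finally show ?thesis by simp
  qed
  have "\<exists>f. f \<in> borel_measurable (distr M S d) \<and> density (distr M S d) f = V t" for t
  proof -
    have "absolutely_continuous (distr M S d) (V t)"
      unfolding absolutely_continuous_def
    proof
      fix B assume B: "B \<in> null_sets (distr M S d)"
      then have [measurable]: "B \<in> sets S" by auto
      have "emeasure (V t) B \<le> emeasure M (d -` B \<inter> space M)"
        unfolding V[OF \<open>B \<in> sets S\<close>] by (intro emeasure_mono) auto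
      also have "\<dots> = 0" using B by (simp add: null_sets_distr_iff null_sets_def emeasure_distr)
      finally show "B \<in> null_sets (V t)" by (auto simp: null_sets_def V_def)
    qed
    then show ?thesis using So.Radon_Nikodym[of "V t"] by (auto simp: V_def)
  qed
  then obtain F where F: "\<And>t. F t \<in> borel_measurable (distr M S d)" "\<And>t. density (distr M S d) (F t) = V t"
    by metis
  show ?thesis
  proof (rule that[of F])
    show m[measurable]: "F t \<in> borel_measurable S" for t using F(1)[of t] by simp
    show "(\<integral>\<^sup>+\<xi>\<in>B. F t \<xi> \<partial>distr M S d) = emeasure M {y \<in> space M. d y \<in> B \<and> r y \<le> t}"
      if "B \<in> sets S" for t B
      using V[OF that, of t] that unfolding F(2)[symmetric] by (simp add: emeasure_density)
  qed
qed

text \<open>The densities are only almost everywhere monotone in \<open>t\<close>; the infimum over rational \<open>q > t\<close>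
  is monotone and right-continuous everywhere.\<close>

lemma right_continuous_conditional_distribution_function:
  obtains G :: "'b \<Rightarrow> real \<Rightarrow> real"
  where "\<And>t. (\<lambda>\<xi>. G \<xi> t) \<in> borel_measurable S"
    and "\<And>\<xi> t. 0 \<le> G \<xi> t \<and> G \<xi> t \<le> 1" and "\<And>\<xi> s t. s \<le> t \<Longrightarrow> G \<xi> s \<le> G \<xi> t"
    and "\<And>\<xi> t. continuous (at_right t) (G \<xi>)"
    and "\<And>t B. B \<in> sets S \<Longrightarrow>
      (\<integral>\<^sup>+\<xi>\<in>B. ennreal (G \<xi> t) \<partial>distr M S d) = emeasure M {y \<in> space M. d y \<in> B \<and> r y \<le> t}"
proof -
  interpret M: finite_measure M by (fact fin)
  interpret So: finite_measure "distr M S d" by (rule M.finite_measure_distr) simp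
  let ?So = "distr M S d"
  obtain F :: "real \<Rightarrow> 'b \<Rightarrow> ennreal" where F[measurable]: "\<And>t. F t \<in> borel_measurable S"
    and FM: "\<And>t B. B \<in> sets S \<Longrightarrow> (\<integral>\<^sup>+\<xi>\<in>B. F t \<xi> \<partial>?So) = emeasure M {y \<in> space M. d y \<in> B \<and> r y \<le> t}"
    by (rule conditional_distribution_function) (rule that)
  have F_fin: "(\<integral>\<^sup>+\<xi>. F t \<xi> \<partial>?So) < \<infinity>" for t
  proof -
    have "(\<integral>\<^sup>+\<xi>. F t \<xi> \<partial>?So) = (\<integral>\<^sup>+\<xi>\<in>space S. F t \<xi> \<partial>?So)"
      by (intro nn_integral_cong) auto
    also have "\<dots> < \<infinity>" using FM[of "space S" t] M.emeasure_finite by (auto simp: less_top[symmetric])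
    finally show ?thesis .
  qed
  have mono: "AE \<xi> in ?So. F s \<xi> \<le> F t \<xi>" if "s \<le> t" for s t
  proof (rule AE_le_if_set_nn_integral_le)
    fix B assume "B \<in> sets ?So"
    then have [measurable]: "B \<in> sets S" by simp
    show "(\<integral>\<^sup>+\<xi>\<in>B. F s \<xi> \<partial>?So) \<le> (\<integral>\<^sup>+\<xi>\<in>B. F t \<xi> \<partial>?So)"
      unfolding FM[OF \<open>B \<in> sets S\<close>] using that by (intro emeasure_mono) auto
  qed (use F_fin in auto)
  have le1: "AE \<xi> in ?So. F t \<xi> \<le> 1" for t
  proof (rule AE_le_if_set_nn_integral_le)
    fix B assume "B \<in> sets ?So"
    then have [measurable]: "B \<in> sets S" by simp
    have "(\<integral>\<^sup>+\<xi>\<in>B. F t \<xi> \<partial>?So) \<le> emeasure M (d -` B \<inter> space M)"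
      unfolding FM[OF \<open>B \<in> sets S\<close>] by (intro emeasure_mono) auto
    then show "(\<integral>\<^sup>+\<xi>\<in>B. F t \<xi> \<partial>?So) \<le> (\<integral>\<^sup>+\<xi>\<in>B. 1 \<partial>?So)"
      by (simp add: emeasure_distr)
  qed (use So.emeasure_finite[of "space S"] in \<open>auto simp: less_top[symmetric]\<close>)
  \<comment> \<open>Truncation at 1 changes \<open>F q\<close> only on a null set, by
    \<open>le1\<close>, and makes \<open>H\<close> finite at every point.\<close>
  define H where "H \<xi> t = (INF q\<in>\<rat> \<inter> {t<..}. min 1 (F q \<xi>))" for \<xi> t
  have [measurable]: "(\<lambda>\<xi>. H \<xi> t) \<in> borel_measurable S" for t
    unfolding H_def by (intro borel_measurable_INF) (auto simp: countable_rat)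
  have H1: "H \<xi> t \<le> 1" for \<xi> t
  proof -
    obtain q where "q \<in> \<rat>" "t < q" using Rats_no_top_le Rats_dense_in_real[of t "t + 1"] by auto
    then have "H \<xi> t \<le> min 1 (F q \<xi>)" unfolding H_def by (intro INF_lower) auto
    then show ?thesis by simp
  qed
  have Hmono: "H \<xi> s \<le> H \<xi> t" if "s \<le> t" for \<xi> s t
    unfolding H_def using that by (intro INF_superset_mono) auto
  have Htop: "H \<xi> t \<noteq> \<top>" for \<xi> t using H1[of \<xi> t] by (auto simp: top_unique)
  have Hright: "(H \<xi> \<longlongrightarrow> H \<xi> t) (at_right t)" for \<xi> t
  proof (rule order_tendstoI)
    fix c assume "c < H \<xi> t"
    then have "c < H \<xi> s" if "t < s" for s
      using Hmono[of t s \<xi>] that by auto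
    then show "\<forall>\<^sub>F s in at_right t. c < H \<xi> s"
      unfolding eventually_at_right_field by (intro exI[of _ "t + 1"]) auto
  next
    fix c assume "H \<xi> t < c"
    then obtain q where q: "q \<in> \<rat>" "t < q" "min 1 (F q \<xi>) < c"
      unfolding H_def INF_less_iff by auto
    have "H \<xi> s < c" if "s < q" for s
      by (rule le_less_trans[OF _ q(3)], unfold H_def, rule INF_lower) (use that q in auto)
    then show "\<forall>\<^sub>F s in at_right t. H \<xi> s < c"
      unfolding eventually_at_right_field using q by (intro exI[of _ q]) auto
  qed
  have HM: "(\<integral>\<^sup>+\<xi>\<in>B. H \<xi> t \<partial>?So) = emeasure M {y \<in> space M. d y \<in> B \<and> r y \<le> t}" if B: "B \<in> sets S" for t B
  proof (rule antisym)
    note B[measurable]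
    \<comment> \<open>\<open>H \<xi> t\<close> is built from values at \<open>q > t\<close>, so only
      bounds by the mass at levels \<open>s > t\<close> come directly. Letting \<open>s\<close>
      decrease to \<open>t\<close> along \<open>t + 1 / (n + 1)\<close>, continuity of the finite
      measure \<open>M\<close> from above gives the bound at \<open>t\<close> itself.\<close>
    have le: "(\<integral>\<^sup>+\<xi>\<in>B. H \<xi> t \<partial>?So) \<le> emeasure M {y \<in> space M. d y \<in> B \<and> r y \<le> s}" if s: "t < s" for s
    proof -
      obtain q where q: "q \<in> \<rat>" "t < q" "q < s" using Rats_dense_in_real[OF s] by auto
      have "H \<xi> t \<le> F q \<xi>" for \<xi>
        unfolding H_def by (rule INF_lower2[of q]) (use q in auto)
      then have "(\<integral>\<^sup>+\<xi>\<in>B. H \<xi> t \<partial>?So) \<le> (\<integral>\<^sup>+\<xi>\<in>B. F q \<xi> \<partial>?So)"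
        by (intro nn_integral_mono mult_right_mono) auto
      also have "\<dots> \<le> emeasure M {y \<in> space M. d y \<in> B \<and> r y \<le> s}"
        unfolding FM[OF B] using q by (intro emeasure_mono) auto
      finally show ?thesis .
    qed
    have "(\<integral>\<^sup>+\<xi>\<in>B. H \<xi> t \<partial>?So) \<le> (INF n. emeasure M {y \<in> space M. d y \<in> B \<and> r y \<le> t + inverse (real (Suc n))})"
      by (intro INF_greatest le) simp
    also have "\<dots> = emeasure M (\<Inter>n. {y \<in> space M. d y \<in> B \<and> r y \<le> t + inverse (real (Suc n))})"
    proof (rule INF_emeasure_decseq)
      show "decseq (\<lambda>n. {y \<in> space M. d y \<in> B \<and> r y \<le> t + inverse (real (Suc n))})"
      proof (rule decseq_SucI)
        fix n
        have "inverse (real (Suc (Suc n))) \<le> inverse (real (Suc n))"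
          by (intro le_imp_inverse_le) auto
        from add_left_mono[OF this, of t]
        show "{y \<in> space M. d y \<in> B \<and> r y \<le> t + inverse (real (Suc (Suc n)))}
            \<subseteq> {y \<in> space M. d y \<in> B \<and> r y \<le> t + inverse (real (Suc n))}"
          by (auto simp del: of_nat_Suc intro: order_trans)
      qed
    qed (use M.emeasure_finite in auto)
    also have "(\<Inter>n. {y \<in> space M. d y \<in> B \<and> r y \<le> t + inverse (real (Suc n))}) = {y \<in> space M. d y \<in> B \<and> r y \<le> t}"
    proof -
      have "u \<le> t" if "\<forall>n. u \<le> t + inverse (real (Suc n))" for u
      proof (rule ccontr)
        assume "\<not> u \<le> t"
        then obtain n where "inverse (real (Suc n)) < u - t"
          using reals_Archimedean[of "u - t"] by (auto simp del: of_nat_Suc)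
        moreover have "u \<le> t + inverse (real (Suc n))" using that by blast
        ultimately show False by linarith
      qed
      then show ?thesis by (auto intro: add_increasing2)
    qed
    finally show "(\<integral>\<^sup>+\<xi>\<in>B. H \<xi> t \<partial>?So) \<le> emeasure M {y \<in> space M. d y \<in> B \<and> r y \<le> t}" .
    \<comment> \<open>Countability of the rationals matters here: one null set has to serve all
      \<open>q > t\<close> at once.\<close>
    have "AE \<xi> in ?So. \<forall>q\<in>\<rat> \<inter> {t<..}. F t \<xi> \<le> F q \<xi>"
      by (subst AE_ball_countable) (auto simp: countable_rat intro!: mono)
    with le1[of t] have "AE \<xi> in ?So. F t \<xi> \<le> H \<xi> t"
      by eventually_elim (auto simp: H_def intro!: INF_greatest)
    then have "(\<integral>\<^sup>+\<xi>\<in>B. F t \<xi> \<partial>?So) \<le> (\<integral>\<^sup>+\<xi>\<in>B. H \<xi> t \<partial>?So)"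
      by (intro nn_integral_mono_AE) (auto intro: mult_right_mono elim!: eventually_mono)
    then show "emeasure M {y \<in> space M. d y \<in> B \<and> r y \<le> t} \<le> (\<integral>\<^sup>+\<xi>\<in>B. H \<xi> t \<partial>?So)"
      unfolding FM[OF B] .
  qed
  show ?thesis
  proof (rule that[of "\<lambda>\<xi> t. enn2real (H \<xi> t)"])
    show "0 \<le> enn2real (H \<xi> t) \<and> enn2real (H \<xi> t) \<le> 1" for \<xi> t
      using enn2real_mono[OF H1[of \<xi> t]] by simp
    show "enn2real (H \<xi> s) \<le> enn2real (H \<xi> t)" if "s \<le> t" for \<xi> s t
      using Hmono[OF that] Htop by (intro enn2real_mono) (auto simp: less_top)
    show "continuous (at_right t) (\<lambda>t. enn2real (H \<xi> t))" for \<xi> t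
      unfolding continuous_within using Hright[of \<xi> t] Htop[of \<xi> t]
      by (intro tendsto_enn2real) (auto simp: less_top)
    show "(\<integral>\<^sup>+\<xi>\<in>B. ennreal (enn2real (H \<xi> t)) \<partial>?So) = emeasure M {y \<in> space M. d y \<in> B \<and> r y \<le> t}"
      if "B \<in> sets S" for t B
      using HM[OF that] Htop by (simp add: less_top)
  qed simp
qed

text \<open>Being monotone and right-continuous, \<open>G \<xi>\<close> is the distribution function
  of a measure \<open>k \<xi>\<close>. It need not run from 0 to 1 for every \<open>\<xi>\<close>,
  so \<open>k\<close> is only a subprobability kernel. The claim is that the law of
  \<open>(d, r)\<close> is the composition of the law of \<open>d\<close> with
  \<open>k\<close>.\<close>

lemma disintegration_real:
  assumes ne: "space S \<noteq> {}"
  obtains k where "k \<in> measurable S (subprob_algebra borel)"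
    and "\<And>g. g \<in> borel_measurable (S \<Otimes>\<^sub>M borel) \<Longrightarrow>
      (\<integral>\<^sup>+y. g (d y, r y) \<partial>M) = (\<integral>\<^sup>+\<xi>. (\<integral>\<^sup>+t. g (\<xi>, t) \<partial>k \<xi>) \<partial>distr M S d)"
proof -
  interpret M: finite_measure M by (fact fin)
  interpret So: finite_measure "distr M S d" by (rule M.finite_measure_distr) simp
  let ?So = "distr M S d"
  obtain G :: "'b \<Rightarrow> real \<Rightarrow> real"
  where G[measurable]: "\<And>t. (\<lambda>\<xi>. G \<xi> t) \<in> borel_measurable S"
    and G01: "\<And>\<xi> t. 0 \<le> G \<xi> t \<and> G \<xi> t \<le> 1" and Gmono: "\<And>\<xi> s t. s \<le> t \<Longrightarrow> G \<xi> s \<le> G \<xi> t"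
    and Gcont: "\<And>\<xi> t. continuous (at_right t) (G \<xi>)"
    and GM: "\<And>t B. B \<in> sets S \<Longrightarrow>
      (\<integral>\<^sup>+\<xi>\<in>B. ennreal (G \<xi> t) \<partial>?So) = emeasure M {y \<in> space M. d y \<in> B \<and> r y \<le> t}"
    by (rule right_continuous_conditional_distribution_function) (rule that)
  define k where "k \<xi> = interval_measure (G \<xi>)" for \<xi>
  have sets_k[simp, measurable_cong]: "sets (k \<xi>) = sets borel" for \<xi> by (simp add: k_def)
  have space_k[simp]: "space (k \<xi>) = UNIV" for \<xi> by (simp add: k_def)
  have kIoc: "emeasure (k \<xi>) {a<..b} = (if a \<le> b then ennreal (G \<xi> b - G \<xi> a) else 0)" for \<xi> a b
    unfolding k_def by (subst emeasure_interval_measure_Ioc_eq) (auto intro: Gmono Gcont)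
  have cover: "(\<Union>n::nat. {- real n<..real n}) = UNIV"
  proof -
    have "\<exists>n::nat. - real n < x \<and> x \<le> real n" for x
      using reals_Archimedean2[of "\<bar>x\<bar>"] by (metis abs_less_iff less_imp_le minus_less_iff)
    then show ?thesis by auto
  qed
  have kUNIV: "emeasure (k \<xi>) UNIV = (SUP n::nat. emeasure (k \<xi>) {- real n<..real n})" for \<xi>
    unfolding cover[symmetric] by (rule SUP_emeasure_incseq[symmetric]) (auto simp: incseq_def)
  have k_sub: "subprob_space (k \<xi>)" for \<xi>
  proof
    have "emeasure (k \<xi>) {- real n<..real n} \<le> 1" for n
      using G01[of \<xi> "real n"] G01[of \<xi> "- real n"] by (simp add: kIoc)
    then show "emeasure (k \<xi>) (space (k \<xi>)) \<le> 1" by (simp add: kUNIV SUP_le_iff)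
  qed auto
  have kIoc_meas[measurable]: "(\<lambda>\<xi>. emeasure (k \<xi>) {a<..b}) \<in> borel_measurable S" for a b
    unfolding kIoc by measurable
  have Int_Ioc: "Int_stable (range (\<lambda>(a, b). {a<..b::real}))"
    by (auto simp: Int_stable_def image_iff)
  have k[measurable]: "k \<in> measurable S (subprob_algebra borel)"
  proof (rule measurable_subprob_algebra_generated[where G = "range (\<lambda>(a, b). {a<..b::real})" and \<Omega> = UNIV])
    show "sets borel = sigma_sets UNIV (range (\<lambda>(a, b). {a<..b::real}))"
      by (subst borel_sigma_sets_Ioc) simp
    show "(\<lambda>\<xi>. emeasure (k \<xi>) UNIV) \<in> borel_measurable S" unfolding kUNIV by measurable
  qed (auto simp: k_sub Int_Ioc)
  \<comment> \<open>The composition of the law of \<open>d\<close> with the kernel \<open>k\<close>,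
    carried by the product space; the Giry monad supplies its measurability and its integration rule
    \<open>P\<close>.\<close>
  define P where "P = ?So \<bind> (\<lambda>\<xi>. distr (k \<xi>) (S \<Otimes>\<^sub>M borel) (Pair \<xi>))"
  have kd: "(\<lambda>\<xi>. distr (k \<xi>) (S \<Otimes>\<^sub>M borel) (Pair \<xi>)) \<in> measurable ?So (subprob_algebra (S \<Otimes>\<^sub>M borel))"
    by (subst measurable_distr_eq1) (intro measurable_distr2[OF _ k], simp)
  have P: "(\<integral>\<^sup>+z. g z \<partial>P) = (\<integral>\<^sup>+\<xi>. (\<integral>\<^sup>+t. g (\<xi>, t) \<partial>k \<xi>) \<partial>?So)"
    if [measurable]: "g \<in> borel_measurable (S \<Otimes>\<^sub>M borel)" for g :: "'b \<times> real \<Rightarrow> ennreal"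
  proof -
    have "(\<integral>\<^sup>+z. g z \<partial>P) = (\<integral>\<^sup>+\<xi>. (\<integral>\<^sup>+z. g z \<partial>distr (k \<xi>) (S \<Otimes>\<^sub>M borel) (Pair \<xi>)) \<partial>?So)"
      unfolding P_def by (intro nn_integral_bind[OF _ kd]) simp
    also have "\<dots> = (\<integral>\<^sup>+\<xi>. (\<integral>\<^sup>+t. g (\<xi>, t) \<partial>k \<xi>) \<partial>?So)"
      by (intro nn_integral_cong nn_integral_distr) auto
    finally show ?thesis .
  qed
  have sets_P[measurable_cong]: "sets P = sets (S \<Otimes>\<^sub>M borel)"
    unfolding P_def using ne by (subst sets_bind) auto
  \<comment> \<open>Rectangles \<open>B \<times> {s<..t}\<close> generate the product and are stable
    under intersection. For \<open>s \<le> t\<close> both measures of such a rectangle are the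
    difference of the two values that \<open>GM\<close> gives at \<open>t\<close> and at
    \<open>s\<close>.\<close>
  have DP: "distr M (S \<Otimes>\<^sub>M borel) (\<lambda>y. (d y, r y)) = P" (is "?D = P")
  proof (rule measure_eqI_generator_eq)
    let ?E = "{a \<times> b | a b. a \<in> sets S \<and> b \<in> range (\<lambda>(a, b). {a<..b::real})}"
    have "sets (S \<Otimes>\<^sub>M borel) = sets (sigma (space S \<times> space borel) ?E)"
    proof (rule sets_pair_eq[where Ca = "{space S}"])
      show "sets S = sigma_sets (space S) (sets S)" by (simp add: sets.sigma_sets_eq)
      show "sets S \<subseteq> Pow (space S)" by (rule sets.space_closed)
      show "sets borel = sigma_sets (space borel) (range (\<lambda>(a, b). {a<..b::real}))"
        by (subst borel_sigma_sets_Ioc) simp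
      show "\<Union> (range (\<lambda>n::nat. {- real n<..real n})) = space borel" using cover by simp
    qed auto
    also have "\<dots> = sigma_sets (space S \<times> UNIV) ?E"
      by (subst sets_measure_of) (auto dest: sets.sets_into_space)
    finally have S: "sets (S \<Otimes>\<^sub>M borel) = sigma_sets (space S \<times> UNIV) ?E" .
    show "sets ?D = sigma_sets (space S \<times> UNIV) ?E" by (rule trans[OF sets_distr S])
    show "sets P = sigma_sets (space S \<times> UNIV) ?E" by (rule trans[OF sets_P S])
    show "Int_stable ?E"
    proof (rule Int_stableI)
      fix X Y assume "X \<in> ?E" "Y \<in> ?E"
      moreover obtain A s t where "X = A \<times> {s<..t}" "A \<in> sets S" using \<open>X \<in> ?E\<close> by auto
      moreover obtain B u v where "Y = B \<times> {u<..v}" "B \<in> sets S" using \<open>Y \<in> ?E\<close> by auto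
      ultimately have "X \<inter> Y = (A \<inter> B) \<times> {max s u<..min t v}" "A \<inter> B \<in> sets S" by auto
      moreover have "{max s u<..min t v} \<in> range (\<lambda>(a, b). {a<..b::real})" by auto
      ultimately show "X \<inter> Y \<in> ?E" by (intro CollectI exI conjI)
    qed
    show "?E \<subseteq> Pow (space S \<times> UNIV)" by (auto dest: sets.sets_into_space)
    show "range (\<lambda>n::nat. space S \<times> {- real n<..real n}) \<subseteq> ?E" by auto
    show "(\<Union>n::nat. space S \<times> {- real n<..real n}) = space S \<times> UNIV" using cover by auto
    show "emeasure ?D (space S \<times> {- real n<..real n}) \<noteq> \<infinity>" for n
      by (subst emeasure_distr) (auto simp: M.emeasure_finite)
    fix X assume "X \<in> ?E"
    then obtain B s t where X: "X = B \<times> {s<..t}" and B[measurable]: "B \<in> sets S" by auto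
    then have Xs: "X \<in> sets (S \<Otimes>\<^sub>M borel)" by auto
    have "emeasure ?D X = emeasure M {y \<in> space M. d y \<in> B \<and> s < r y \<and> r y \<le> t}"
      unfolding X by (subst emeasure_distr) (auto intro!: arg_cong[where f = "emeasure M"])
    also have "\<dots> = (\<integral>\<^sup>+\<xi>. emeasure (k \<xi>) {s<..t} * indicator B \<xi> \<partial>?So)"
    proof (cases "s \<le> t")
      case True
      have "(\<integral>\<^sup>+\<xi>. emeasure (k \<xi>) {s<..t} * indicator B \<xi> \<partial>?So)
          = (\<integral>\<^sup>+\<xi>. ennreal (G \<xi> t) * indicator B \<xi> - ennreal (G \<xi> s) * indicator B \<xi> \<partial>?So)"
        using True G01 by (intro nn_integral_cong) (auto simp: kIoc indicator_def ennreal_minus)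
      also have "\<dots> = (\<integral>\<^sup>+\<xi>\<in>B. ennreal (G \<xi> t) \<partial>?So) - (\<integral>\<^sup>+\<xi>\<in>B. ennreal (G \<xi> s) \<partial>?So)"
        using True by (intro nn_integral_diff)
          (auto simp: GM M.emeasure_finite intro!: AE_I2 mult_right_mono ennreal_leI Gmono)
      also have "\<dots> = emeasure M ({y \<in> space M. d y \<in> B \<and> r y \<le> t} - {y \<in> space M. d y \<in> B \<and> r y \<le> s})"
        using True by (subst emeasure_Diff) (auto simp: GM M.emeasure_finite)
      also have "{y \<in> space M. d y \<in> B \<and> r y \<le> t} - {y \<in> space M. d y \<in> B \<and> r y \<le> s}
          = {y \<in> space M. d y \<in> B \<and> s < r y \<and> r y \<le> t}" by auto
      finally show ?thesis ..
    next
      case False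
      then have *: "{y \<in> space M. d y \<in> B \<and> s < r y \<and> r y \<le> t} = {}" by auto
      show ?thesis using False unfolding * by (simp add: kIoc)
    qed
    also have "\<dots> = (\<integral>\<^sup>+\<xi>. (\<integral>\<^sup>+u. indicator X (\<xi>, u) \<partial>k \<xi>) \<partial>?So)"
    proof (intro nn_integral_cong)
      fix \<xi>
      have "(\<integral>\<^sup>+u. indicator X (\<xi>, u) \<partial>k \<xi>) = (\<integral>\<^sup>+u. indicator {s<..t} u * indicator B \<xi> \<partial>k \<xi>)"
        by (intro nn_integral_cong) (auto simp: X indicator_def)
      also have "\<dots> = emeasure (k \<xi>) {s<..t} * indicator B \<xi>"
        using nn_integral_multc[of "indicator {s<..t}" "k \<xi>" "indicator B \<xi>"]
        by (simp add: borel_measurable_indicator)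
      finally show "emeasure (k \<xi>) {s<..t} * indicator B \<xi> = (\<integral>\<^sup>+u. indicator X (\<xi>, u) \<partial>k \<xi>)" ..
    qed
    also have "\<dots> = (\<integral>\<^sup>+z. indicator X z \<partial>P)"
      using Xs by (intro P[of "indicator X", symmetric] borel_measurable_indicator)
    also have "\<dots> = emeasure P X"
      using Xs by (intro nn_integral_indicator) (simp add: sets_P)
    finally show "emeasure ?D X = emeasure P X" .
  qed
  have D: "(\<integral>\<^sup>+z. g z \<partial>P) = (\<integral>\<^sup>+y. g (d y, r y) \<partial>M)"
    if "g \<in> borel_measurable (S \<Otimes>\<^sub>M borel)" for g :: "'b \<times> real \<Rightarrow> ennreal"
    using that unfolding DP[symmetric] by (intro nn_integral_distr) auto
  show ?thesis by (rule that[OF k]) (simp add: D[symmetric] P)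
qed

end

section \<open>Weights that make a measure finite\<close>

lemma ennreal_weight_cancel:
  "0 < (c::ennreal) \<Longrightarrow> c < \<top> \<Longrightarrow> c * (x / c) = x" "0 < (c::ennreal) \<Longrightarrow> c < \<top> \<Longrightarrow> 1 / c * (c * x) = x"
proof -
  assume c: "0 < c" "c < \<top>"
  show "c * (x / c) = x"
    using c by (simp add: ennreal_times_divide ennreal_divide_times mult_divide_eq_ennreal mult.commute[of c])
  show "1 / c * (c * x) = x"
    using c ennreal_divide_self[of c] by (simp add: mult.assoc[symmetric] divide_ennreal_def mult.commute[of _ c])
qed

text \<open>\<open>density M w\<close> is a finite measure, and \<open>M\<close> is recovered from
  it by the density \<open>1 / w\<close>. This density is finite almost everywhere because
  \<open>w\<close> is positive, and a finite density preserves sigma-finiteness.\<close>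

lemma sigma_finite_if_nn_integral_finite:
  assumes [measurable]: "w \<in> borel_measurable M" and pos: "AE x in M. 0 < w x"
    and fin: "(\<integral>\<^sup>+x. w x \<partial>M) < \<infinity>"
  shows "sigma_finite_measure M"
proof -
  have fin_ae: "AE x in M. w x \<noteq> \<infinity>" using fin by (intro nn_integral_PInf_AE) auto
  interpret W: finite_measure "density M w"
  proof
    have "emeasure (density M w) (space M) = (\<integral>\<^sup>+x. w x \<partial>M)"
      by (subst emeasure_density) (auto intro!: nn_integral_cong)
    then show "emeasure (density M w) (space (density M w)) \<noteq> \<infinity>" using fin by simp
  qed
  have "density (density M w) (\<lambda>x. 1 / w x) = density M (\<lambda>x. w x * (1 / w x))"
    by (intro density_density_eq) auto
  also have "\<dots> = density M (\<lambda>_. 1)"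
    by (rule density_cong) (use pos fin_ae in \<open>auto simp: ennreal_weight_cancel less_top elim: eventually_elim2\<close>)
  also have "\<dots> = M" by (rule density_1)
  finally have "M = density (density M w) (\<lambda>x. 1 / w x)" ..
  moreover have "AE x in density M w. 1 / w x \<noteq> \<infinity>"
    by (subst AE_density) (auto simp: divide_ennreal_def)
  ultimately show ?thesis
    using W.sigma_finite_iff_density_finite[of "\<lambda>x. 1 / w x"] by simp
qed

section \<open>Polar decompositions\<close>


text \<open>Disintegration determines its kernel only up to a null set of directions, whereas here
  every radial part has to be nonzero and to integrate \<open>w\<close>. Integrability in every
  direction is available because \<open>k \<xi>\<close> has mass at most 1; positivity in every
  direction needs a repair on a null set.\<close>

lemma exists_polar_decomposition:
  fixes Q :: "(real^'d::finite) measure" and w :: "real \<Rightarrow> real"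
  assumes Q[measurable_cong]: "sets Q = sets borel" and Q0: "emeasure Q {0} = 0"
    and w[measurable]: "w \<in> borel_measurable borel" and w_pos: "\<forall>r>0. 0 < w r"
    and fin: "(\<integral>\<^sup>+y. ennreal (w (norm y)) \<partial>Q) < \<infinity>"
  shows "\<exists>So R. polar_decomposition Q So R \<and> (\<forall>\<xi>\<in>sphere 0 1. (\<integral>\<^sup>+r. ennreal (w r) \<partial>R \<xi>) < \<infinity>)"
proof -
  define S where "S = restrict_space (borel :: (real^'d) measure) (sphere 0 1)"
  define M where "M = density Q (\<lambda>y. ennreal (w (norm y)))"
  obtain e :: "real^'d" where e: "norm e = 1" using norm_axis_1 by blast
  \<comment> \<open>\<open>sgn 0 = 0\<close> lies off the sphere, so the origin, a null set of
    \<open>Q\<close>, is sent to an arbitrary unit vector.\<close>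
  define d where "d y = (if y = 0 then e else sgn y)" for y :: "real^'d"
  have nd: "norm (d y) = 1" for y by (simp add: d_def e norm_sgn)
  have space_S: "space S = sphere 0 1" by (simp add: S_def space_restrict_space)
  have spaceQ: "space Q = UNIV" using sets_eq_imp_space_eq[OF Q] by simp
  have sets_M[measurable_cong]: "sets M = sets borel" by (simp add: M_def Q)
  have spaceM: "space M = UNIV" by (simp add: M_def spaceQ)
  have [measurable]: "d \<in> borel_measurable borel" unfolding d_def sgn_div_norm by measurable
  have d[measurable]: "d \<in> measurable M S"
    unfolding S_def by (rule measurable_restrict_space2) (auto simp: nd)
  have finM: "finite_measure M"
  proof
    show "emeasure M (space M) \<noteq> \<infinity>"
      using fin by (simp add: M_def emeasure_density Q spaceQ)
  qed
  have AEQ: "AE y in Q. y \<noteq> 0"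
    using Q0 by (intro AE_I[where N = "{0}"]) (auto simp: Q)
  have AEM: "AE y in M. y \<noteq> 0"
    unfolding M_def by (subst AE_density) (use AEQ in auto)
  define So where "So = distr M S d"
  have sets_So[measurable_cong]: "sets So = sets S" by (simp add: So_def)
  have space_So: "space So = sphere 0 1" by (simp add: So_def space_S)
  obtain k where k[measurable]: "k \<in> measurable S (subprob_algebra borel)"
    and kM: "\<And>g. g \<in> borel_measurable (S \<Otimes>\<^sub>M borel) \<Longrightarrow>
      (\<integral>\<^sup>+y. g (d y, norm y) \<partial>M) = (\<integral>\<^sup>+\<xi>. (\<integral>\<^sup>+t. g (\<xi>, t) \<partial>k \<xi>) \<partial>So)"
    unfolding So_def
  proof (rule disintegration_real[OF finM d, of norm])
    show "space S \<noteq> {}" using e by (auto simp: space_S)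
  qed auto
  have sets_k: "sets (k \<xi>) = sets borel" and space_k: "space (k \<xi>) = UNIV"
    and sub_k: "emeasure (k \<xi>) UNIV \<le> 1" if "\<xi> \<in> sphere 0 1" for \<xi>
  proof -
    have "k \<xi> \<in> space (subprob_algebra borel)" using measurable_space[OF k] that space_S by auto
    then show *: "sets (k \<xi>) = sets borel" by (simp add: space_subprob_algebra)
    then show **: "space (k \<xi>) = UNIV" using sets_eq_imp_space_eq by fastforce
    show "emeasure (k \<xi>) UNIV \<le> 1"
      using \<open>k \<xi> \<in> space _\<close> subprob_space.emeasure_space_le_1[of "k \<xi>"] by (simp add: space_subprob_algebra **)
  qed
  define p where "p \<xi> = emeasure (k \<xi>) {0<..}" for \<xi>
  have [measurable]: "p \<in> borel_measurable S"
    unfolding p_def by (rule measurable_compose[OF k measurable_emeasure_subprob_algebra]) simp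
  \<comment> \<open>The \<open>So\<close>-mass of the bad directions can be computed under the extra
    condition \<open>0 < norm y\<close>, since the origin is null for \<open>M\<close>. The
    disintegration then turns it into the integral of \<open>p\<close> over the set where
    \<open>p\<close> vanishes.\<close>
  have p_AE: "AE \<xi> in So. p \<xi> \<noteq> 0"
  proof (rule AE_I)
    let ?B = "{\<xi> \<in> space S. p \<xi> = 0}"
    have B[measurable]: "?B \<in> sets S" by measurable
    then show "?B \<in> sets So" by (simp add: sets_So)
    show "{\<xi> \<in> space So. \<not> p \<xi> \<noteq> 0} \<subseteq> ?B" by (auto simp: space_So space_S)
    let ?g = "\<lambda>(\<xi>, t). indicator ?B \<xi> * indicator {0<..} t :: ennreal"
    have "emeasure So ?B = (\<integral>\<^sup>+y. indicator ?B (d y) \<partial>M)"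
    proof -
      have "emeasure So ?B = (\<integral>\<^sup>+\<xi>. indicator ?B \<xi> \<partial>So)" using B by (simp add: sets_So)
      also have "\<dots> = (\<integral>\<^sup>+y. indicator ?B (d y) \<partial>M)"
        unfolding So_def by (rule nn_integral_distr) measurable
      finally show ?thesis .
    qed
    also have "\<dots> = (\<integral>\<^sup>+y. ?g (d y, norm y) \<partial>M)"
      using AEM by (intro nn_integral_cong_AE) (auto elim: eventually_mono)
    also have "\<dots> = (\<integral>\<^sup>+\<xi>. (\<integral>\<^sup>+t. ?g (\<xi>, t) \<partial>k \<xi>) \<partial>So)"
      by (rule kM) measurable
    also have "\<dots> = (\<integral>\<^sup>+\<xi>. indicator ?B \<xi> * p \<xi> \<partial>So)"
      by (intro nn_integral_cong) (auto simp: p_def space_So sets_k nn_integral_cmult_indicator)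
    also have "\<dots> = (\<integral>\<^sup>+\<xi>. 0 \<partial>So)"
      by (intro nn_integral_cong) (auto simp: indicator_def)
    finally show "emeasure So ?B = 0" by simp
  qed
  define P where "P = restrict_space (borel :: real measure) {0<..}"
  have sets_kP: "sets (restrict_space (k \<xi>) {0<..}) = sets P" if "\<xi> \<in> sphere 0 1" for \<xi>
    unfolding P_def by (rule sets_restrict_space_cong[OF sets_k[OF that]])
  \<comment> \<open>Where \<open>k \<xi>\<close> misses the half-line, a point mass at radius 1 is
    substituted; by \<open>p_AE\<close> this affects no integral over \<open>So\<close>, and its
    \<open>w\<close>-integral \<open>w 1\<close> is finite. Elsewhere the factor
    \<open>1 / w\<close> undoes the weight that was put into \<open>M\<close>.\<close>
  define R where "R \<xi> = (if p \<xi> = 0 then return P 1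
      else density (restrict_space (k \<xi>) {0<..}) (\<lambda>r. 1 / ennreal (w r)))" for \<xi>
  have space_P: "space P = {0<..}" by (simp add: P_def space_restrict_space)
  have sets_R: "sets (R \<xi>) = sets P" if "\<xi> \<in> sphere 0 1" for \<xi>
    by (simp add: R_def sets_kP[OF that])
  have space_R: "space (R \<xi>) = {0<..}" if "\<xi> \<in> sphere 0 1" for \<xi>
    using sets_eq_imp_space_eq[OF sets_R[OF that]] space_P by simp
  have meas_P: "f \<in> borel_measurable P" if "f \<in> borel_measurable borel" for f :: "real \<Rightarrow> ennreal"
    unfolding P_def by (rule measurable_restrict_space1[OF that])
  have R_int: "(\<integral>\<^sup>+r. g r \<partial>R \<xi>) = (\<integral>\<^sup>+r. indicator {0<..} r * (1 / ennreal (w r)) * g r \<partial>k \<xi>)"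
    if \<xi>: "\<xi> \<in> sphere 0 1" and p: "p \<xi> \<noteq> 0" and [measurable]: "g \<in> borel_measurable borel"
    for \<xi> and g :: "real \<Rightarrow> ennreal"
  proof -
    have "(\<integral>\<^sup>+r. g r \<partial>R \<xi>) = (\<integral>\<^sup>+r. 1 / ennreal (w r) * g r \<partial>restrict_space (k \<xi>) {0<..})"
      using p by (simp add: R_def) (intro nn_integral_density; simp cong: measurable_cong_sets[OF sets_kP[OF \<xi>] refl] add: meas_P)
    also have "\<dots> = (\<integral>\<^sup>+r. 1 / ennreal (w r) * g r * indicator {0<..} r \<partial>k \<xi>)"
      by (rule nn_integral_restrict_space) (simp add: sets_k[OF \<xi>] space_k[OF \<xi>])
    finally show ?thesis by (simp add: mult_ac)
  qed
  have fin_w: "(\<integral>\<^sup>+r. ennreal (w r) \<partial>R \<xi>) < \<infinity>" if \<xi>: "\<xi> \<in> sphere 0 1" for \<xi>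
  proof (cases "p \<xi> = 0")
    case True
    then show ?thesis
      by (simp add: R_def) (subst nn_integral_return; simp add: space_P meas_P)
  next
    case False
    have "(\<integral>\<^sup>+r. ennreal (w r) \<partial>R \<xi>) = (\<integral>\<^sup>+r. indicator {0<..} r * (1 / ennreal (w r)) * ennreal (w r) \<partial>k \<xi>)"
      by (rule R_int[OF \<xi> False]) simp
    also have "\<dots> \<le> (\<integral>\<^sup>+r. 1 \<partial>k \<xi>)"
      using w_pos by (intro nn_integral_mono)
        (auto simp: indicator_def ennreal_weight_cancel(2)[of _ 1, simplified])
    also have "\<dots> \<le> 1" using sub_k[OF \<xi>] by (simp add: space_k[OF \<xi>])
    finally show ?thesis by (simp add: order.strict_trans1)
  qed
  have meas_k: "(\<lambda>\<xi>. \<integral>\<^sup>+r. g \<xi> r \<partial>k \<xi>) \<in> borel_measurable S"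
    if "case_prod g \<in> borel_measurable (S \<Otimes>\<^sub>M borel)" for g
    by (rule nn_integral_measurable_subprob_algebra2[OF that k])
  have "polar_decomposition Q So R"
    unfolding polar_decomposition_def
  proof (intro conjI ballI)
    show "sets So = sets (restrict_space borel (sphere 0 1))" by (simp add: sets_So S_def)
    show "finite_measure So"
      unfolding So_def by (rule finite_measure.finite_measure_distr[OF finM]) simp
    show "sets (R \<xi>) = sets (restrict_space borel {0<..})" if "\<xi> \<in> sphere 0 1" for \<xi>
      using sets_R[OF that] by (simp add: P_def)
    show "sigma_finite_measure (R \<xi>)" if \<xi>: "\<xi> \<in> sphere 0 1" for \<xi>
    proof (rule sigma_finite_if_nn_integral_finite)
      show "(\<lambda>r. ennreal (w r)) \<in> borel_measurable (R \<xi>)"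
        by (simp add: meas_P cong: measurable_cong_sets[OF sets_R[OF \<xi>] refl])
      show "AE r in R \<xi>. 0 < ennreal (w r)" by (rule AE_I2) (simp add: space_R[OF \<xi>] w_pos)
    qed (rule fin_w[OF \<xi>])
    show "0 < emeasure (R \<xi>) {0<..}" if \<xi>: "\<xi> \<in> sphere 0 1" for \<xi>
    proof (cases "p \<xi> = 0")
      case True
      have "{0<..} \<in> sets P" using sets.top[of P] by (simp add: space_P)
      then show ?thesis using True by (simp add: R_def)
    next
      case False
      have "emeasure (R \<xi>) {0<..} = (\<integral>\<^sup>+r. 1 \<partial>R \<xi>)" by (simp add: space_R[OF \<xi>])
      also have "\<dots> = (\<integral>\<^sup>+r. indicator {0<..} r * (1 / ennreal (w r)) \<partial>k \<xi>)"
        using R_int[OF \<xi> False, of "\<lambda>_. 1"] by simp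
      also have "\<dots> \<noteq> 0"
      proof
        assume "(\<integral>\<^sup>+r. indicator {0<..} r * (1 / ennreal (w r)) \<partial>k \<xi>) = 0"
        then have "AE r in k \<xi>. indicator {0<..} r * (1 / ennreal (w r)) = 0"
          by (subst (asm) nn_integral_0_iff_AE) (auto cong: measurable_cong_sets[OF sets_k[OF \<xi>] refl])
        then have "AE r in k \<xi>. r \<notin> {0<..}"
          by (rule eventually_mono) (auto simp: divide_ennreal_def split: if_splits)
        then have "p \<xi> = 0"
          unfolding p_def by (subst (asm) AE_iff_null_sets[symmetric]) (auto simp: sets_k[OF \<xi>])
        then show False using False by simp
      qed
      finally show ?thesis by (simp add: zero_less_iff_neq_zero)
    qed
    show "(\<lambda>\<xi>. emeasure (R \<xi>) C) \<in> borel_measurable So" if C: "C \<in> sets (restrict_space borel {0<..})" for C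
    proof -
      have CP: "C \<in> sets P" using C by (simp add: P_def)
      have [measurable]: "C \<in> sets borel"
        using C by (auto simp: sets_restrict_space_iff)
      have "(\<lambda>\<xi>. if p \<xi> = 0 then indicator C 1
          else \<integral>\<^sup>+r. indicator {0<..} r * (1 / ennreal (w r)) * indicator C r \<partial>k \<xi>) \<in> borel_measurable S"
        by (intro measurable_If meas_k) measurable
      also have "?this \<longleftrightarrow> ?thesis"
      proof (subst measurable_cong_sets[OF sets_So refl], rule measurable_cong)
        fix \<xi> assume "\<xi> \<in> space S"
        then have \<xi>: "\<xi> \<in> sphere 0 1" by (simp add: space_S)
        have "emeasure (R \<xi>) C = (\<integral>\<^sup>+r. indicator C r \<partial>R \<xi>)"
          using CP by (simp add: sets_R[OF \<xi>])
        then show "(if p \<xi> = 0 then indicator C 1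
          else \<integral>\<^sup>+r. indicator {0<..} r * (1 / ennreal (w r)) * indicator C r \<partial>k \<xi>) = emeasure (R \<xi>) C"
          using R_int[OF \<xi>, of "indicator C"] CP by (auto simp: R_def)
      qed
      finally show ?thesis .
    qed
    show "emeasure Q B = (\<integral>\<^sup>+\<xi>. (\<integral>\<^sup>+r. indicator B (r *\<^sub>R \<xi>) \<partial>R \<xi>) \<partial>So)" if [measurable]: "B \<in> sets borel" for B
    proof -
      let ?g = "\<lambda>(\<xi>, r). indicator {0<..} r * (1 / ennreal (w r)) * indicator B (r *\<^sub>R \<xi>)"
      have g: "?g \<in> borel_measurable (S \<Otimes>\<^sub>M borel)"
      proof -
        have [measurable]: "(\<lambda>\<xi>. \<xi>) \<in> borel_measurable S"
          unfolding S_def by (rule measurable_restrict_space1) simp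
        show ?thesis by measurable
      qed
      have "(\<integral>\<^sup>+\<xi>. (\<integral>\<^sup>+r. indicator B (r *\<^sub>R \<xi>) \<partial>R \<xi>) \<partial>So) = (\<integral>\<^sup>+\<xi>. (\<integral>\<^sup>+r. ?g (\<xi>, r) \<partial>k \<xi>) \<partial>So)"
      proof (rule nn_integral_cong_AE)
        show "AE \<xi> in So. (\<integral>\<^sup>+r. indicator B (r *\<^sub>R \<xi>) \<partial>R \<xi>) = (\<integral>\<^sup>+r. ?g (\<xi>, r) \<partial>k \<xi>)"
          using p_AE AE_space
        proof eventually_elim
          case (elim \<xi>)
          then show ?case using R_int[of \<xi> "\<lambda>r. indicator B (r *\<^sub>R \<xi>)"] by (simp add: space_So)
        qed
      qed
      also have "\<dots> = (\<integral>\<^sup>+y. ?g (d y, norm y) \<partial>M)" by (rule kM[OF g, symmetric])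
      also have "\<dots> = (\<integral>\<^sup>+y. ennreal (w (norm y)) * ?g (d y, norm y) \<partial>Q)"
        unfolding M_def
      proof (rule nn_integral_density)
        show "(\<lambda>y. ?g (d y, norm y)) \<in> borel_measurable Q"
          by (rule measurable_compose[OF _ g]) measurable
      qed measurable
      also have "\<dots> = (\<integral>\<^sup>+y. indicator B y \<partial>Q)"
      proof (rule nn_integral_cong_AE)
        show "AE y in Q. ennreal (w (norm y)) * ?g (d y, norm y) = indicator B y"
          using AEQ
        proof eventually_elim
          case (elim y)
          then have "norm y *\<^sub>R d y = y" by (simp add: d_def sgn_div_norm)
          then show ?case
            using elim w_pos by (simp add: ennreal_weight_cancel(1)[of _ 1] mult.assoc[symmetric])
        qed
      qed
      also have "\<dots> = emeasure Q B" by (simp add: Q)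
      finally show ?thesis ..
    qed
  qed
  then show ?thesis using fin_w by blast
qed

section \<open>Integration with respect to a given polar decomposition\<close>

context
  fixes Q :: "(real^'d::finite) measure" and So :: "(real^'d) measure" and R :: "real^'d \<Rightarrow> real measure"
    and w :: "real \<Rightarrow> real"
  assumes Q[measurable_cong]: "sets Q = sets borel" and polar: "polar_decomposition Q So R"
    and w[measurable]: "w \<in> borel_measurable borel" and w_pos: "\<forall>r>0. 0 < w r"
    and w_fin: "\<forall>\<xi>\<in>sphere 0 1. (\<integral>\<^sup>+r. ennreal (w r) \<partial>R \<xi>) < \<infinity>"
begin

lemma polar_sets_spherical: "sets So = sets (restrict_space borel (sphere 0 1))"
  and polar_space_spherical: "space So = sphere 0 1"
  using polar sets_eq_imp_space_eq[of So "restrict_space borel (sphere 0 1)"]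
  unfolding polar_decomposition_def by (auto simp: space_restrict_space)

lemma polar_sets_radial: "\<xi> \<in> sphere 0 1 \<Longrightarrow> sets (R \<xi>) = sets (restrict_space borel {0<..})"
  and polar_sigma_finite_radial: "\<xi> \<in> sphere 0 1 \<Longrightarrow> sigma_finite_measure (R \<xi>)"
  and polar_radial_pos: "\<xi> \<in> sphere 0 1 \<Longrightarrow> 0 < emeasure (R \<xi>) {0<..}"
  using polar unfolding polar_decomposition_def by auto

lemma polar_space_radial: "\<xi> \<in> sphere 0 1 \<Longrightarrow> space (R \<xi>) = {0<..}"
  using sets_eq_imp_space_eq[OF polar_sets_radial] by (simp add: space_restrict_space)

lemma polar_measurable_radial:
  assumes "\<xi> \<in> sphere 0 1" "f \<in> measurable borel N"
  shows "f \<in> measurable (R \<xi>) N"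
  unfolding measurable_cong_sets[OF polar_sets_radial[OF assms(1)] refl]
  by (rule measurable_restrict_space1[OF assms(2)])

lemma polar_measurable_spherical:
  "f \<in> measurable borel N \<Longrightarrow> f \<in> measurable So N"
  unfolding measurable_cong_sets[OF polar_sets_spherical refl] by (rule measurable_restrict_space1)

text \<open>The definition of a polar decomposition gives measurability in the direction for sets
  only. This extension to functions of the radius makes the normalising constant \<open>c\<close> of
  the next lemma measurable.\<close>

lemma polar_nn_integral_measurable1:
  assumes "f \<in> borel_measurable (restrict_space borel {0<..})"
  shows "(\<lambda>\<xi>. \<integral>\<^sup>+r. f r \<partial>R \<xi>) \<in> borel_measurable So"
  using assms
proof (induction rule: borel_measurable_induct)
  case (cong f g)
  have "(\<integral>\<^sup>+r. f r \<partial>R \<xi>) = (\<integral>\<^sup>+r. g r \<partial>R \<xi>)" if "\<xi> \<in> space So" for \<xi>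
    using cong(3) that by (intro nn_integral_cong) (simp add: polar_space_radial polar_space_spherical space_restrict_space)
  then show ?case using cong(4) by (simp cong: measurable_cong)
next
  case (set A)
  have "(\<integral>\<^sup>+r. indicator A r \<partial>R \<xi>) = emeasure (R \<xi>) A" if "\<xi> \<in> space So" for \<xi>
    using set that by (simp add: polar_sets_radial polar_space_spherical)
  moreover have "(\<lambda>\<xi>. emeasure (R \<xi>) A) \<in> borel_measurable So"
    using polar set unfolding polar_decomposition_def by blast
  ultimately show ?case by (simp cong: measurable_cong)
next
  case (mult u c)
  have "(\<integral>\<^sup>+r. c * u r \<partial>R \<xi>) = c * (\<integral>\<^sup>+r. u r \<partial>R \<xi>)" if "\<xi> \<in> space So" for \<xi>
    using mult(2) that by (intro nn_integral_cmult)
      (simp add: polar_space_spherical measurable_cong_sets[OF polar_sets_radial refl])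
  then show ?case using mult by (simp cong: measurable_cong)
next
  case (add u v)
  have "(\<integral>\<^sup>+r. v r + u r \<partial>R \<xi>) = (\<integral>\<^sup>+r. v r \<partial>R \<xi>) + (\<integral>\<^sup>+r. u r \<partial>R \<xi>)" if "\<xi> \<in> space So" for \<xi>
    using add(1,3) that by (intro nn_integral_add)
      (simp_all add: polar_space_spherical measurable_cong_sets[OF polar_sets_radial refl])
  then show ?case using add by (simp cong: measurable_cong)
next
  case (seq U)
  have "(\<integral>\<^sup>+r. (SUP i. U i) r \<partial>R \<xi>) = (SUP i. \<integral>\<^sup>+r. U i r \<partial>R \<xi>)" if "\<xi> \<in> space So" for \<xi>
    unfolding SUP_apply using seq(1,3) that by (intro nn_integral_monotone_convergence_SUP)
      (simp_all add: polar_space_spherical measurable_cong_sets[OF polar_sets_radial refl])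
  moreover have "(\<lambda>\<xi>. SUP i. \<integral>\<^sup>+r. U i r \<partial>R \<xi>) \<in> borel_measurable So"
    using seq by (intro borel_measurable_SUP) auto
  ultimately show ?case by (simp cong: measurable_cong)
qed

text \<open>The radial parts need not be finite; weighting with \<open>w\<close> and normalising turns them into
  a Markov kernel, to which the theory of the Giry monad applies.\<close>

lemma polar_nn_integral_measurable:
  assumes g[measurable]: "case_prod g \<in> borel_measurable (So \<Otimes>\<^sub>M borel)"
  shows "(\<lambda>\<xi>. \<integral>\<^sup>+r. g \<xi> r \<partial>R \<xi>) \<in> borel_measurable So"
proof -
  define P where "P = restrict_space (borel :: real measure) {0<..}"
  have wP[measurable]: "w \<in> borel_measurable P" unfolding P_def by (rule measurable_restrict_space1[OF w])
  have idP[measurable]: "(\<lambda>x. x) \<in> measurable P borel" unfolding P_def by (rule measurable_restrict_space1) simp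
  have wR: "(\<lambda>r. ennreal (w r)) \<in> borel_measurable (R \<xi>)" if "\<xi> \<in> sphere 0 1" for \<xi>
    by (rule polar_measurable_radial[OF that]) measurable
  define c where "c \<xi> = (\<integral>\<^sup>+r. ennreal (w r) \<partial>R \<xi>)" for \<xi>
  have c[measurable]: "c \<in> borel_measurable So"
    unfolding c_def using wP by (intro polar_nn_integral_measurable1) (simp add: P_def)
  have c_fin: "c \<xi> < \<top>" if "\<xi> \<in> sphere 0 1" for \<xi> using w_fin that by (simp add: c_def)
  \<comment> \<open>\<open>R \<xi>\<close> charges the half-line and \<open>w\<close> is positive
    there. Together with finiteness this allows division by \<open>c \<xi>\<close>.\<close>
  have c_pos: "0 < c \<xi>" if \<xi>: "\<xi> \<in> sphere 0 1" for \<xi>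
  proof (rule ccontr)
    assume "\<not> 0 < c \<xi>"
    then have "AE r in R \<xi>. ennreal (w r) = 0"
      using nn_integral_0_iff_AE[OF wR[OF \<xi>]] by (simp add: c_def)
    with AE_space have "AE r in R \<xi>. False"
    proof eventually_elim
      case (elim r)
      then show ?case using w_pos by (auto simp: polar_space_radial[OF \<xi>])
    qed
    then have "space (R \<xi>) \<in> null_sets (R \<xi>)"
      by (subst AE_iff_null_sets) (auto elim: eventually_mono)
    then have "emeasure (R \<xi>) {0<..} = 0"
      by (simp add: null_sets_def polar_space_radial[OF \<xi>])
    then show False using polar_radial_pos[OF \<xi>] by simp
  qed
  define k where "k \<xi> = density (R \<xi>) (\<lambda>r. ennreal (w r) / c \<xi>)" for \<xi>
  have k[measurable]: "k \<in> measurable So (subprob_algebra P)"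
  proof (rule measurable_subprob_algebra)
    fix \<xi> assume "\<xi> \<in> space So"
    then have \<xi>: "\<xi> \<in> sphere 0 1" by (simp add: polar_space_spherical)
    show "sets (k \<xi>) = sets P" by (simp add: k_def polar_sets_radial[OF \<xi>] P_def)
    show "subprob_space (k \<xi>)"
    proof
      have "emeasure (k \<xi>) (space (k \<xi>)) = (\<integral>\<^sup>+r. ennreal (w r) / c \<xi> \<partial>R \<xi>)"
        using wR[OF \<xi>] by (simp add: k_def emeasure_density cong: nn_integral_cong)
      also have "\<dots> = c \<xi> / c \<xi>"
        using wR[OF \<xi>] by (subst nn_integral_divide) (auto simp: c_def)
      also have "\<dots> = 1" using c_pos[OF \<xi>] c_fin[OF \<xi>] by (intro ennreal_divide_self) auto
      finally show "emeasure (k \<xi>) (space (k \<xi>)) \<le> 1" by simp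
      show "space (k \<xi>) \<noteq> {}" by (auto simp: k_def polar_space_radial[OF \<xi>] intro: exI[of _ 1])
    qed
  next
    fix C assume C[measurable]: "C \<in> sets P"
    have "(\<lambda>\<xi>. (\<integral>\<^sup>+r. ennreal (w r) * indicator C r \<partial>R \<xi>) / c \<xi>) \<in> borel_measurable So"
      using C wP by (intro borel_measurable_divide_ennreal polar_nn_integral_measurable1 c) (simp add: P_def[symmetric])
    also have "?this \<longleftrightarrow> (\<lambda>\<xi>. emeasure (k \<xi>) C) \<in> borel_measurable So"
    proof (rule measurable_cong)
      fix \<xi> assume "\<xi> \<in> space So"
      then have \<xi>: "\<xi> \<in> sphere 0 1" by (simp add: polar_space_spherical)
      have C': "C \<in> sets (R \<xi>)" using C by (simp add: P_def polar_sets_radial[OF \<xi>])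
      have "emeasure (k \<xi>) C = (\<integral>\<^sup>+r. ennreal (w r) * indicator C r / c \<xi> \<partial>R \<xi>)"
        using wR[OF \<xi>] C' by (simp add: k_def emeasure_density ennreal_divide_times ennreal_times_divide)
      then show "(\<integral>\<^sup>+r. ennreal (w r) * indicator C r \<partial>R \<xi>) / c \<xi> = emeasure (k \<xi>) C"
        using wR[OF \<xi>] C' by (simp add: nn_integral_divide)
    qed
    finally show "(\<lambda>\<xi>. emeasure (k \<xi>) C) \<in> borel_measurable So" .
  qed
  \<comment> \<open>The factor \<open>c / w\<close> in the integrand undoes the density
    \<open>w / c\<close> of \<open>k\<close>, so this is the wanted integral with respect to
    \<open>R \<xi>\<close>, now written over a subprobability kernel.\<close>
  have "(\<lambda>\<xi>. \<integral>\<^sup>+r. c \<xi> * g \<xi> r / ennreal (w r) \<partial>k \<xi>) \<in> borel_measurable So"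
    by (rule nn_integral_measurable_subprob_algebra2[OF _ k]) measurable
  also have "?this \<longleftrightarrow> ?thesis"
  proof (rule measurable_cong)
    fix \<xi> assume \<xi>': "\<xi> \<in> space So"
    then have \<xi>: "\<xi> \<in> sphere 0 1" by (simp add: polar_space_spherical)
    have g\<xi>: "g \<xi> \<in> borel_measurable borel"
      using measurable_compose[OF measurable_Pair1'[OF \<xi>', of borel] g] by simp
    have "(\<integral>\<^sup>+r. c \<xi> * g \<xi> r / ennreal (w r) \<partial>k \<xi>)
        = (\<integral>\<^sup>+r. (ennreal (w r) / c \<xi>) * (c \<xi> * g \<xi> r / ennreal (w r)) \<partial>R \<xi>)"
      unfolding k_def by (intro nn_integral_density polar_measurable_radial[OF \<xi>]) (use g\<xi> in measurable)
    also have "\<dots> = (\<integral>\<^sup>+r. g \<xi> r \<partial>R \<xi>)"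
    proof (rule nn_integral_cong)
      fix r assume "r \<in> space (R \<xi>)"
      then have "0 < w r" using w_pos by (simp add: polar_space_radial[OF \<xi>])
      then have "ennreal (w r) \<noteq> 0" "ennreal (w r) \<noteq> \<top>" by auto
      moreover have "c \<xi> \<noteq> 0" "c \<xi> \<noteq> \<top>" using c_pos[OF \<xi>] c_fin[OF \<xi>] by auto
      moreover have "(ennreal (w r) / c \<xi>) * (c \<xi> * g \<xi> r / ennreal (w r))
          = (c \<xi> / c \<xi>) * ((ennreal (w r) / ennreal (w r)) * g \<xi> r)"
        unfolding divide_ennreal_def by (simp only: mult_ac)
      ultimately show "(ennreal (w r) / c \<xi>) * (c \<xi> * g \<xi> r / ennreal (w r)) = g \<xi> r"
        by (simp add: ennreal_divide_self less_top[symmetric])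
    qed
    finally show "(\<integral>\<^sup>+r. c \<xi> * g \<xi> r / ennreal (w r) \<partial>k \<xi>) = (\<integral>\<^sup>+r. g \<xi> r \<partial>R \<xi>)" .
  qed
  finally show ?thesis .
qed

text \<open>The defining identity covers indicators. To pull sums and increasing limits through the
  outer integral, the inner one must be measurable in the direction (\<open>m1\<close>), even though
  its integrand \<open>h (r *\<^sub>R \<xi>)\<close> mixes radius and direction.\<close>

lemma polar_nn_integral:
  assumes "h \<in> borel_measurable borel"
  shows "(\<integral>\<^sup>+y. h y \<partial>Q) = (\<integral>\<^sup>+\<xi>. (\<integral>\<^sup>+r. h (r *\<^sub>R \<xi>) \<partial>R \<xi>) \<partial>So)"
proof -
  have m1: "(\<lambda>\<xi>. \<integral>\<^sup>+r. h (r *\<^sub>R \<xi>) \<partial>R \<xi>) \<in> borel_measurable So"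
    if [measurable]: "h \<in> borel_measurable borel" for h :: "real^'d \<Rightarrow> ennreal"
  proof (rule polar_nn_integral_measurable)
    have [measurable]: "(\<lambda>\<xi>. \<xi>) \<in> measurable So borel" by (rule polar_measurable_spherical) simp
    show "(\<lambda>(\<xi>, r). h (r *\<^sub>R \<xi>)) \<in> borel_measurable (So \<Otimes>\<^sub>M borel)" by measurable
  qed
  have m2: "(\<lambda>r. h (r *\<^sub>R \<xi>)) \<in> borel_measurable (R \<xi>)"
    if [measurable]: "h \<in> borel_measurable borel" and "\<xi> \<in> space So" for h :: "real^'d \<Rightarrow> ennreal" and \<xi>
    using that(2) by (intro polar_measurable_radial) (auto simp: polar_space_spherical)
  from assms show ?thesis
  proof (induction rule: borel_measurable_induct)
    case (cong f g)
    then show ?case by (simp cong: nn_integral_cong)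
  next
    case (set A)
    then have "emeasure Q A = (\<integral>\<^sup>+\<xi>. (\<integral>\<^sup>+r. indicator A (r *\<^sub>R \<xi>) \<partial>R \<xi>) \<partial>So)"
      using polar unfolding polar_decomposition_def by blast
    then show ?case using set by (simp add: Q)
  next
    case (mult u c)
    have "(\<integral>\<^sup>+y. c * u y \<partial>Q) = c * (\<integral>\<^sup>+y. u y \<partial>Q)"
      using mult(2) by (intro nn_integral_cmult) (simp add: measurable_cong_sets[OF Q refl])
    also have "\<dots> = (\<integral>\<^sup>+\<xi>. c * (\<integral>\<^sup>+r. u (r *\<^sub>R \<xi>) \<partial>R \<xi>) \<partial>So)"
      using mult by (simp add: nn_integral_cmult m1)
    also have "\<dots> = (\<integral>\<^sup>+\<xi>. (\<integral>\<^sup>+r. c * u (r *\<^sub>R \<xi>) \<partial>R \<xi>) \<partial>So)"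
      using mult(2) by (intro nn_integral_cong) (simp add: nn_integral_cmult m2)
    finally show ?case .
  next
    case (add u v)
    have "(\<integral>\<^sup>+y. v y + u y \<partial>Q) = (\<integral>\<^sup>+y. v y \<partial>Q) + (\<integral>\<^sup>+y. u y \<partial>Q)"
      using add by (intro nn_integral_add) (simp_all add: measurable_cong_sets[OF Q refl])
    also have "\<dots> = (\<integral>\<^sup>+\<xi>. (\<integral>\<^sup>+r. v (r *\<^sub>R \<xi>) \<partial>R \<xi>) + (\<integral>\<^sup>+r. u (r *\<^sub>R \<xi>) \<partial>R \<xi>) \<partial>So)"
      using add by (simp add: nn_integral_add m1)
    also have "\<dots> = (\<integral>\<^sup>+\<xi>. (\<integral>\<^sup>+r. v (r *\<^sub>R \<xi>) + u (r *\<^sub>R \<xi>) \<partial>R \<xi>) \<partial>So)"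
      using add by (intro nn_integral_cong) (simp add: nn_integral_add m2)
    finally show ?case .
  next
    case (seq U)
    have inc: "incseq (\<lambda>i. \<integral>\<^sup>+r. U i (r *\<^sub>R \<xi>) \<partial>R \<xi>)" for \<xi>
      using seq(3) by (auto simp: incseq_def le_fun_def intro!: nn_integral_mono)
    have "(\<integral>\<^sup>+y. (SUP i. U i) y \<partial>Q) = (SUP i. \<integral>\<^sup>+y. U i y \<partial>Q)"
      unfolding SUP_apply using seq by (intro nn_integral_monotone_convergence_SUP)
        (simp_all add: measurable_cong_sets[OF Q refl])
    also have "\<dots> = (SUP i. \<integral>\<^sup>+\<xi>. (\<integral>\<^sup>+r. U i (r *\<^sub>R \<xi>) \<partial>R \<xi>) \<partial>So)" using seq by simp
    also have "\<dots> = (\<integral>\<^sup>+\<xi>. (SUP i. \<integral>\<^sup>+r. U i (r *\<^sub>R \<xi>) \<partial>R \<xi>) \<partial>So)"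
      using seq inc by (intro nn_integral_monotone_convergence_SUP[symmetric] m1)
        (auto simp: incseq_def le_fun_def)
    also have "\<dots> = (\<integral>\<^sup>+\<xi>. (\<integral>\<^sup>+r. (SUP i. U i) (r *\<^sub>R \<xi>) \<partial>R \<xi>) \<partial>So)"
      unfolding SUP_apply using seq by (intro nn_integral_cong nn_integral_monotone_convergence_SUP[symmetric] m2)
        (auto simp: incseq_def le_fun_def)
    finally show ?case .
  qed
qed

end

section \<open>Integrated tails\<close>

text \<open>Each jump \<open>y\<close> is spread along its own ray: the point at signed distance
  \<open>z\<close> from the origin in direction \<open>sgn y\<close> receives density
  \<open>u z (norm y)\<close>. Neither spherical nor radial parts occur, so equality with a tail
  shows that the tail does not depend on the decomposition chosen.\<close>

definition radial_smear ::
    "(real^'d::finite) measure \<Rightarrow> (real \<Rightarrow> real \<Rightarrow> real) \<Rightarrow> (real^'d) measure" where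
  "radial_smear Q u = distr (density (Q \<Otimes>\<^sub>M lborel) (\<lambda>(y, z). ennreal (u z (norm y)))) borel
     (\<lambda>(y, z). z *\<^sub>R sgn y)"

text \<open>The density in \<open>z\<close>, as seen from a jump of size \<open>r\<close>, of the integrated tail for \<open>m = 0\<close> and
  of the double integrated tail for \<open>m = 1\<close>.\<close>

definition tail_weight :: "nat \<Rightarrow> real \<Rightarrow> real \<Rightarrow> real" where
  "tail_weight m z r = (if 0 < z \<and> z < r then (r - z) ^ m else 0)"

lemma tail_weight_measurable[measurable]: "case_prod (tail_weight m) \<in> borel_measurable (borel \<Otimes>\<^sub>M borel)"
  unfolding tail_weight_def by measurable

lemma tail_weight_nonneg: "0 \<le> tail_weight m z r"
  by (simp add: tail_weight_def)

text \<open>For \<open>y = r *\<^sub>R \<xi>\<close> with \<open>0 < r\<close> one has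
  \<open>norm y = r\<close> and \<open>sgn y = \<xi>\<close>. In polar coordinates the left side is
  therefore an integral over direction, radius and \<open>z\<close>, and the right side is the same
  with the last two exchanged, which is the shape in which the tails are defined.\<close>

lemma emeasure_radial_smear:
  fixes Q :: "(real^'d::finite) measure" and w :: "real \<Rightarrow> real"
  assumes Q[measurable_cong]: "sets Q = sets borel" and polar: "polar_decomposition Q So R"
    and w: "w \<in> borel_measurable borel" "\<forall>r>0. 0 < w r"
      "\<forall>\<xi>\<in>sphere 0 1. (\<integral>\<^sup>+r. ennreal (w r) \<partial>R \<xi>) < \<infinity>"
    and u[measurable]: "case_prod u \<in> borel_measurable (borel \<Otimes>\<^sub>M borel)"
    and B[measurable]: "B \<in> sets borel"
  shows "emeasure (radial_smear Q u) B
    = (\<integral>\<^sup>+\<xi>. (\<integral>\<^sup>+z. indicator B (z *\<^sub>R \<xi>) * (\<integral>\<^sup>+r. ennreal (u z r) \<partial>R \<xi>) \<partial>lborel) \<partial>So)"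
proof -
  note pol = Q polar w
  have spaceQ: "space Q = UNIV" using sets_eq_imp_space_eq[OF Q] by simp
  define h where "h y = (\<integral>\<^sup>+z. ennreal (u z (norm y)) * indicator B (z *\<^sub>R sgn y) \<partial>lborel)" for y :: "real^'d"
  have [measurable]: "h \<in> borel_measurable borel" unfolding h_def by measurable
  have meas_u: "(\<lambda>(y, z). ennreal (u z (norm y))) \<in> borel_measurable (Q \<Otimes>\<^sub>M lborel)" by measurable
  have meas_s: "(\<lambda>(y, z). z *\<^sub>R sgn y) \<in> measurable (Q \<Otimes>\<^sub>M lborel) borel" by measurable
  have "emeasure (radial_smear Q u) B
      = (\<integral>\<^sup>+p. indicator B p \<partial>radial_smear Q u)"
    by (simp add: radial_smear_def)
  also have "\<dots> = (\<integral>\<^sup>+p. indicator B ((\<lambda>(y, z). z *\<^sub>R sgn y) p)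
      \<partial>density (Q \<Otimes>\<^sub>M lborel) (\<lambda>(y, z). ennreal (u z (norm y))))"
    unfolding radial_smear_def using meas_s by (intro nn_integral_distr) auto
  also have "\<dots> = (\<integral>\<^sup>+p. (\<lambda>(y, z). ennreal (u z (norm y))) p * indicator B ((\<lambda>(y, z). z *\<^sub>R sgn y) p) \<partial>(Q \<Otimes>\<^sub>M lborel))"
    using meas_u meas_s by (intro nn_integral_density) auto
  also have "\<dots> = (\<integral>\<^sup>+y. h y \<partial>Q)"
    unfolding h_def by (subst lborel.nn_integral_fst[symmetric]) auto
  also have "\<dots> = (\<integral>\<^sup>+\<xi>. (\<integral>\<^sup>+r. h (r *\<^sub>R \<xi>) \<partial>R \<xi>) \<partial>So)"
    by (rule polar_nn_integral[OF pol]) measurable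
  also have "\<dots> = (\<integral>\<^sup>+\<xi>. (\<integral>\<^sup>+z. indicator B (z *\<^sub>R \<xi>) * (\<integral>\<^sup>+r. ennreal (u z r) \<partial>R \<xi>) \<partial>lborel) \<partial>So)"
  proof (rule nn_integral_cong)
    fix \<xi> assume "\<xi> \<in> space So"
    then have \<xi>: "\<xi> \<in> sphere 0 1" by (simp add: polar_space_spherical[OF pol])
    have idR[measurable]: "(\<lambda>r. r) \<in> measurable (R \<xi>) borel"
      by (rule polar_measurable_radial[OF pol \<xi>]) simp
    interpret sigma_finite_measure "R \<xi>" by (rule polar_sigma_finite_radial[OF pol \<xi>])
    interpret pair_sigma_finite "R \<xi>" lborel ..
    have "(\<integral>\<^sup>+r. h (r *\<^sub>R \<xi>) \<partial>R \<xi>)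
        = (\<integral>\<^sup>+r. (\<integral>\<^sup>+z. indicator B (z *\<^sub>R \<xi>) * ennreal (u z r) \<partial>lborel) \<partial>R \<xi>)"
    proof (rule nn_integral_cong)
      fix r assume "r \<in> space (R \<xi>)"
      then have "0 < r" using polar_space_radial[OF pol \<xi>] by simp
      then have "norm (r *\<^sub>R \<xi>) = r" "sgn (r *\<^sub>R \<xi>) = \<xi>" using \<xi> by (auto simp: sgn_scaleR sgn_div_norm)
      then show "h (r *\<^sub>R \<xi>) = (\<integral>\<^sup>+z. indicator B (z *\<^sub>R \<xi>) * ennreal (u z r) \<partial>lborel)"
        by (simp add: h_def mult.commute)
    qed
    also have "\<dots> = (\<integral>\<^sup>+z. (\<integral>\<^sup>+r. indicator B (z *\<^sub>R \<xi>) * ennreal (u z r) \<partial>R \<xi>) \<partial>lborel)"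
      by (rule Fubini'[symmetric]) measurable
    also have "\<dots> = (\<integral>\<^sup>+z. indicator B (z *\<^sub>R \<xi>) * (\<integral>\<^sup>+r. ennreal (u z r) \<partial>R \<xi>) \<partial>lborel)"
      by (intro nn_integral_cong nn_integral_cmult) measurable
    finally show "(\<integral>\<^sup>+r. h (r *\<^sub>R \<xi>) \<partial>R \<xi>)
        = (\<integral>\<^sup>+z. indicator B (z *\<^sub>R \<xi>) * (\<integral>\<^sup>+r. ennreal (u z r) \<partial>R \<xi>) \<partial>lborel)" .
  qed
  finally show ?thesis .
qed

text \<open>\<open>measure_of\<close> falls back to the zero measure when its set function is not
  countably additive. Agreement with an actual measure on all Borel sets supplies the additivity of
  \<open>F\<close>.\<close>

lemma measure_of_eq_radial_smear:
  assumes "\<And>B. B \<in> sets borel \<Longrightarrow> F B = emeasure (radial_smear Q u) B"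
  shows "measure_of UNIV (sets borel) F = radial_smear Q u"
proof -
  have "measure_of UNIV (sets borel) F = measure_of UNIV (sets borel) (emeasure (radial_smear Q u))"
    using sets.sigma_sets_eq[of "borel :: (real^'a) measure"] assms by (intro measure_of_eq) auto
  also have "\<dots> = radial_smear Q u"
    using measure_of_of_measure[of "radial_smear Q u"] by (simp add: radial_smear_def)
  finally show ?thesis .
qed

text \<open>The existence theorem, applied with the weight from \<open>levy_polar\<close>,
  guarantees that SOME picks a genuine polar decomposition; the formula for
  \<open>radial_smear\<close> holds for whichever one it is.\<close>

lemma integrated_tail_eq:
  fixes Q :: "(real^'d::finite) measure"
  assumes Q: "sets Q = sets borel" and Q0: "emeasure Q {0} = 0"
    and fin: "(\<integral>\<^sup>+y. ennreal (min 1 ((norm y)\<^sup>2)) \<partial>Q) < \<infinity>"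
  shows "integrated_tail Q = radial_smear Q (tail_weight 0)"
proof -
  obtain So R where pair: "levy_polar Q = (So, R)" by fastforce
  have w: "(\<lambda>r::real. min 1 (r\<^sup>2)) \<in> borel_measurable borel" "\<forall>r::real>0. 0 < min 1 (r\<^sup>2)"
    by auto
  have "\<exists>p. case p of (So, R) \<Rightarrow> polar_decomposition Q So R \<and>
      (\<forall>\<xi>\<in>sphere 0 1. (\<integral>\<^sup>+r. ennreal (min 1 (r\<^sup>2)) \<partial>R \<xi>) < \<infinity>)"
    using exists_polar_decomposition[OF Q Q0 w fin] by auto
  from someI_ex[OF this] pair have polar: "polar_decomposition Q So R"
    and fin': "\<forall>\<xi>\<in>sphere 0 1. (\<integral>\<^sup>+r. ennreal (min 1 (r\<^sup>2)) \<partial>R \<xi>) < \<infinity>"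
    unfolding levy_polar_def by auto
  note pol = Q polar w fin'
  show ?thesis
    unfolding integrated_tail_def pair prod.case
  proof (rule measure_of_eq_radial_smear)
    fix B :: "(real^'d) set" assume B: "B \<in> sets borel"
    have "(\<integral>\<^sup>+z\<in>{0<..}. indicator B (z *\<^sub>R \<xi>) * emeasure (R \<xi>) {z<..} \<partial>lborel)
        = (\<integral>\<^sup>+z. indicator B (z *\<^sub>R \<xi>) * (\<integral>\<^sup>+r. ennreal (tail_weight 0 z r) \<partial>R \<xi>) \<partial>lborel)"
      if "\<xi> \<in> space So" for \<xi>
    proof (rule nn_integral_cong)
      fix z :: real
      have \<xi>: "\<xi> \<in> sphere 0 1" using that by (simp add: polar_space_spherical[OF pol])
      show "indicator B (z *\<^sub>R \<xi>) * emeasure (R \<xi>) {z<..} * indicator {0<..} z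
          = indicator B (z *\<^sub>R \<xi>) * (\<integral>\<^sup>+r. ennreal (tail_weight 0 z r) \<partial>R \<xi>)"
      \<comment> \<open>For \<open>z \<le> 0\<close> both sides are cut off to 0. The case
        distinction is needed because \<open>R \<xi>\<close> lives on the positive half-line, where
        \<open>{z<..}\<close> with negative \<open>z\<close> is not a measurable set.\<close>
      proof (cases "0 < z")
        case True
        then have "(\<integral>\<^sup>+r. ennreal (tail_weight 0 z r) \<partial>R \<xi>) = (\<integral>\<^sup>+r. indicator {z<..} r \<partial>R \<xi>)"
          by (intro nn_integral_cong) (auto simp: tail_weight_def indicator_def)
        moreover have "{z<..} \<in> sets (R \<xi>)"
          using True by (auto simp: polar_sets_radial[OF pol \<xi>] sets_restrict_space_iff)
        ultimately show ?thesis using True by simp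
      qed (simp add: tail_weight_def)
    qed
    then show "(\<integral>\<^sup>+\<xi>. (\<integral>\<^sup>+z\<in>{0<..}. indicator B (z *\<^sub>R \<xi>) * emeasure (R \<xi>) {z<..} \<partial>lborel) \<partial>So)
        = emeasure (radial_smear Q (tail_weight 0)) B"
      unfolding emeasure_radial_smear[OF pol tail_weight_measurable B] by (rule nn_integral_cong)
  qed
qed

lemma double_integrated_tail_eq:
  fixes Q :: "(real^'d::finite) measure"
  assumes Q: "sets Q = sets borel" and Q0: "emeasure Q {0} = 0"
    and fin: "(\<integral>\<^sup>+y. ennreal (min (norm y) ((norm y)\<^sup>2)) \<partial>Q) < \<infinity>"
  shows "double_integrated_tail Q = radial_smear Q (tail_weight 1)"
proof -
  obtain So R where pair: "levy_polar_int Q = (So, R)" by fastforce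
  have w: "(\<lambda>r::real. min r (r\<^sup>2)) \<in> borel_measurable borel" "\<forall>r::real>0. 0 < min r (r\<^sup>2)"
    by auto
  have "\<exists>p. case p of (So, R) \<Rightarrow> polar_decomposition Q So R \<and>
      (\<forall>\<xi>\<in>sphere 0 1. (\<integral>\<^sup>+r. ennreal (min r (r\<^sup>2)) \<partial>R \<xi>) < \<infinity>)"
    using exists_polar_decomposition[OF Q Q0 w fin] by auto
  from someI_ex[OF this] pair have polar: "polar_decomposition Q So R"
    and fin': "\<forall>\<xi>\<in>sphere 0 1. (\<integral>\<^sup>+r. ennreal (min r (r\<^sup>2)) \<partial>R \<xi>) < \<infinity>"
    unfolding levy_polar_int_def by auto
  note pol = Q polar w fin'
  \<comment> \<open>For a fixed jump size \<open>r\<close>, the variable \<open>z\<^sub>1\<close>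
    runs through the interval from \<open>z\<^sub>2\<close> to \<open>r\<close>. Its length
    \<open>r - z\<^sub>2\<close> is the weight for \<open>m = 1\<close>.\<close>
  have inner: "(\<integral>\<^sup>+z\<^sub>1\<in>{z\<^sub>2<..}. emeasure (R \<xi>) {z\<^sub>1<..} \<partial>lborel) = (\<integral>\<^sup>+r. ennreal (tail_weight 1 z\<^sub>2 r) \<partial>R \<xi>)"
    if \<xi>: "\<xi> \<in> sphere 0 1" and z\<^sub>2: "0 < z\<^sub>2" for \<xi> z\<^sub>2
  proof -
    have idR[measurable]: "(\<lambda>r. r) \<in> measurable (R \<xi>) borel"
      by (rule polar_measurable_radial[OF pol \<xi>]) simp
    interpret sigma_finite_measure "R \<xi>" by (rule polar_sigma_finite_radial[OF pol \<xi>])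
    interpret pair_sigma_finite "R \<xi>" lborel ..
    have "(\<integral>\<^sup>+z\<^sub>1\<in>{z\<^sub>2<..}. emeasure (R \<xi>) {z\<^sub>1<..} \<partial>lborel)
        = (\<integral>\<^sup>+z\<^sub>1. (\<integral>\<^sup>+r. (if z\<^sub>2 < z\<^sub>1 \<and> z\<^sub>1 < r then 1 else 0) \<partial>R \<xi>) \<partial>lborel)"
    proof (rule nn_integral_cong)
      fix z\<^sub>1 :: real
      show "emeasure (R \<xi>) {z\<^sub>1<..} * indicator {z\<^sub>2<..} z\<^sub>1
          = (\<integral>\<^sup>+r. (if z\<^sub>2 < z\<^sub>1 \<and> z\<^sub>1 < r then 1 else 0) \<partial>R \<xi>)"
      proof (cases "z\<^sub>2 < z\<^sub>1")
        case True
        then have "(\<integral>\<^sup>+r. (if z\<^sub>2 < z\<^sub>1 \<and> z\<^sub>1 < r then 1 else 0) \<partial>R \<xi>) = (\<integral>\<^sup>+r. indicator {z\<^sub>1<..} r \<partial>R \<xi>)"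
          by (intro nn_integral_cong) (auto simp: indicator_def)
        moreover have "{z\<^sub>1<..} \<in> sets (R \<xi>)"
          using True z\<^sub>2 by (auto simp: polar_sets_radial[OF pol \<xi>] sets_restrict_space_iff)
        ultimately show ?thesis using True by simp
      qed simp
    qed
    also have "\<dots> = (\<integral>\<^sup>+r. (\<integral>\<^sup>+z\<^sub>1. (if z\<^sub>2 < z\<^sub>1 \<and> z\<^sub>1 < r then 1 else 0) \<partial>lborel) \<partial>R \<xi>)"
      by (rule Fubini') measurable
    also have "\<dots> = (\<integral>\<^sup>+r. ennreal (tail_weight 1 z\<^sub>2 r) \<partial>R \<xi>)"
    proof (rule nn_integral_cong)
      fix r :: real
      have "(\<integral>\<^sup>+z\<^sub>1. (if z\<^sub>2 < z\<^sub>1 \<and> z\<^sub>1 < r then 1 else 0) \<partial>lborel) = (\<integral>\<^sup>+z\<^sub>1. indicator {z\<^sub>2<..<r} z\<^sub>1 \<partial>lborel)"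
        by (intro nn_integral_cong) (auto simp: indicator_def)
      also have "\<dots> = ennreal (tail_weight 1 z\<^sub>2 r)"
        using z\<^sub>2 by (cases "z\<^sub>2 \<le> r") (auto simp: tail_weight_def)
      finally show "(\<integral>\<^sup>+z\<^sub>1. (if z\<^sub>2 < z\<^sub>1 \<and> z\<^sub>1 < r then 1 else 0) \<partial>lborel) = ennreal (tail_weight 1 z\<^sub>2 r)" .
    qed
    finally show ?thesis .
  qed
  show ?thesis
    unfolding double_integrated_tail_def pair prod.case
  proof (rule measure_of_eq_radial_smear)
    fix B :: "(real^'d) set" assume B: "B \<in> sets borel"
    have "(\<integral>\<^sup>+z\<^sub>2\<in>{0<..}. indicator B (z\<^sub>2 *\<^sub>R \<xi>) * (\<integral>\<^sup>+z\<^sub>1\<in>{z\<^sub>2<..}. emeasure (R \<xi>) {z\<^sub>1<..} \<partial>lborel) \<partial>lborel)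
        = (\<integral>\<^sup>+z. indicator B (z *\<^sub>R \<xi>) * (\<integral>\<^sup>+r. ennreal (tail_weight 1 z r) \<partial>R \<xi>) \<partial>lborel)"
      if "\<xi> \<in> space So" for \<xi>
    proof (rule nn_integral_cong)
      fix z :: real
      have \<xi>: "\<xi> \<in> sphere 0 1" using that by (simp add: polar_space_spherical[OF pol])
      show "indicator B (z *\<^sub>R \<xi>) * (\<integral>\<^sup>+z\<^sub>1\<in>{z<..}. emeasure (R \<xi>) {z\<^sub>1<..} \<partial>lborel) * indicator {0<..} z
          = indicator B (z *\<^sub>R \<xi>) * (\<integral>\<^sup>+r. ennreal (tail_weight 1 z r) \<partial>R \<xi>)"
        by (cases "0 < z") (simp_all add: inner[OF \<xi>], simp add: tail_weight_def)
    qed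
    then show "(\<integral>\<^sup>+\<xi>. (\<integral>\<^sup>+z\<^sub>2\<in>{0<..}. indicator B (z\<^sub>2 *\<^sub>R \<xi>) *
          (\<integral>\<^sup>+z\<^sub>1\<in>{z\<^sub>2<..}. emeasure (R \<xi>) {z\<^sub>1<..} \<partial>lborel) \<partial>lborel) \<partial>So)
        = emeasure (radial_smear Q (tail_weight 1)) B"
      unfolding emeasure_radial_smear[OF pol tail_weight_measurable B] by (rule nn_integral_cong)
  qed
qed

section \<open>Functions with bounded support\<close>

text \<open>Continuity is left out on purpose: the functions integrated against the tails contain
  factors such as \<open>p $ i / norm p\<close>, which have no limit at the origin.\<close>

definition compactly_bounded :: "('a::real_normed_vector \<Rightarrow> real) \<Rightarrow> bool" where
  "compactly_bounded g \<longleftrightarrow> (\<exists>C\<ge>0. \<exists>L\<ge>0. \<forall>y. \<bar>g y\<bar> \<le> C \<and> (L < norm y \<longrightarrow> g y = 0))"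

lemma compactly_boundedI:
  "0 \<le> C \<Longrightarrow> 0 \<le> L \<Longrightarrow> (\<And>y. \<bar>g y\<bar> \<le> C) \<Longrightarrow> (\<And>y. L < norm y \<Longrightarrow> g y = 0) \<Longrightarrow> compactly_bounded g"
  unfolding compactly_bounded_def by blast

lemma compactly_boundedE:
  assumes "compactly_bounded g"
  obtains C L where "0 \<le> C" "0 \<le> L" "\<And>y. \<bar>g y\<bar> \<le> C" "\<And>y. L < norm y \<Longrightarrow> g y = 0"
  using assms unfolding compactly_bounded_def by blast

lemma compactly_bounded_sum:
  assumes "\<And>i. i \<in> I \<Longrightarrow> compactly_bounded (g i)"
  shows "compactly_bounded (\<lambda>y. \<Sum>i\<in>I. g i y)"
  using assms
proof (induction I rule: infinite_finite_induct)
  case (insert i I)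
  obtain C L where 1: "0 \<le> C" "0 \<le> L" "\<And>y. \<bar>g i y\<bar> \<le> C" "\<And>y. L < norm y \<Longrightarrow> g i y = 0"
    using insert.prems compactly_boundedE by (metis insertI1)
  obtain C' L' where 2: "0 \<le> C'" "0 \<le> L'" "\<And>y. \<bar>\<Sum>i\<in>I. g i y\<bar> \<le> C'"
      "\<And>y. L' < norm y \<Longrightarrow> (\<Sum>i\<in>I. g i y) = 0"
    using compactly_boundedE[OF insert.IH] insert.prems by (metis insertI2)
  show ?case
  proof (rule compactly_boundedI[of "C + C'" "max L L'"])
    fix y
    show "\<bar>\<Sum>i\<in>insert i I. g i y\<bar> \<le> C + C'"
      using insert.hyps abs_triangle_ineq[of "g i y" "\<Sum>i\<in>I. g i y"] 1(3)[of y] 2(3)[of y] by simp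
    show "(\<Sum>i\<in>insert i I. g i y) = 0" if "max L L' < norm y"
      using insert.hyps that 1(4) 2(4) by simp
  qed (use 1 2 in auto)
qed (auto intro: compactly_boundedI[of 0 0])

lemma compactly_bounded_mult:
  fixes g :: "'a::real_normed_vector \<Rightarrow> real"
  assumes "compactly_bounded g" "\<And>y. \<bar>h y\<bar> \<le> 1"
  shows "compactly_bounded (\<lambda>y. g y * h y)"
proof -
  obtain C L where 1: "0 \<le> C" "0 \<le> L" "\<And>y. \<bar>g y\<bar> \<le> C" "\<And>y. L < norm y \<Longrightarrow> g y = 0"
    using compactly_boundedE[OF assms(1)] by blast
  show ?thesis
  proof (rule compactly_boundedI[OF 1(1,2)])
    fix y
    have "\<bar>g y\<bar> * \<bar>h y\<bar> \<le> C * 1" by (intro mult_mono 1 assms(2)) auto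
    then show "\<bar>g y * h y\<bar> \<le> C" by (simp add: abs_mult)
  qed (simp add: 1(4))
qed

lemma compactly_bounded_translate:
  fixes x :: "'a::real_normed_vector"
  assumes "compactly_bounded g"
  shows "compactly_bounded (\<lambda>y. g (x + y))"
proof -
  obtain C L where 1: "0 \<le> C" "0 \<le> L" "\<And>y. \<bar>g y\<bar> \<le> C" "\<And>y. L < norm y \<Longrightarrow> g y = 0"
    using compactly_boundedE[OF assms(1)] by blast
  show ?thesis
  proof (rule compactly_boundedI[of C "L + norm x"])
    fix y :: 'a assume "L + norm x < norm y"
    then have "L < norm (x + y)" using norm_triangle_ineq4[of "x + y" x] by simp
    then show "g (x + y) = 0" by (rule 1)
  qed (use 1 in auto)
qed

lemma compactly_bounded_integrable:
  assumes "finite_measure M" "g \<in> borel_measurable M" "compactly_bounded g"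
  shows "integrable M g"
proof -
  interpret finite_measure M by fact
  obtain C where "\<And>y. \<bar>g y\<bar> \<le> C" using compactly_boundedE[OF assms(3)] by metis
  then show ?thesis using assms(2) by (intro integrable_const_bound[of _ C]) auto
qed

section \<open>Integrals against radially smeared measures\<close>

text \<open>With \<open>r = norm y\<close>, the point \<open>z *\<^sub>R sgn y\<close> has norm
  \<open>z\<close>, so the integrand lives on \<open>{0<..min r L}\<close> and is at most
  \<open>C * r ^ m\<close> there. The estimate \<open>min r L \<le> max 1 L * min 1 r\<close> then
  produces a multiple of \<open>min (r ^ m) (r ^ Suc m)\<close>. For \<open>m = 0\<close> and
  \<open>m = 1\<close> this is exactly the moment assumed finite for \<open>\<mu>\<close> and for
  \<open>\<rho>\<close>.\<close>

lemma nn_integral_tail_weight_le: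
  fixes y :: "'a::real_normed_vector"
  assumes g: "0 \<le> C" "0 \<le> L" "\<And>y. \<bar>g y\<bar> \<le> C" "\<And>y. L < norm y \<Longrightarrow> g y = 0"
  shows "(\<integral>\<^sup>+z. ennreal \<bar>tail_weight m z (norm y) * g (z *\<^sub>R sgn y)\<bar> \<partial>lborel)
    \<le> ennreal (C * max 1 L * min (norm y ^ m) (norm y ^ Suc m))"
proof -
  define r where "r = norm y"
  have r: "0 \<le> r" by (simp add: r_def)
  have "ennreal \<bar>tail_weight m z r * g (z *\<^sub>R sgn y)\<bar> \<le> ennreal (C * r ^ m) * indicator {0<..min r L} z" for z
  proof (cases "0 < z \<and> z < r \<and> z \<le> L")
    case True
    have "(r - z) ^ m * \<bar>g (z *\<^sub>R sgn y)\<bar> \<le> r ^ m * C"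
      using True g by (intro mult_mono power_mono) auto
    then show ?thesis using True by (simp add: tail_weight_def abs_mult mult.commute ennreal_leI)
  next
    case False
    have "tail_weight m z r * g (z *\<^sub>R sgn y) = 0"
    proof (cases "0 < z \<and> z < r")
      case True
      then have "norm (sgn y) = 1" by (auto simp: r_def norm_sgn)
      then have "norm (z *\<^sub>R sgn y) = z" using True by simp
      then show ?thesis using g(4)[of "z *\<^sub>R sgn y"] True False by simp
    qed (auto simp: tail_weight_def)
    then show ?thesis by (simp only: abs_zero ennreal_0 zero_le)
  qed
  then have "(\<integral>\<^sup>+z. ennreal \<bar>tail_weight m z r * g (z *\<^sub>R sgn y)\<bar> \<partial>lborel)
      \<le> (\<integral>\<^sup>+z. ennreal (C * r ^ m) * indicator {0<..min r L} z \<partial>lborel)"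
    by (intro nn_integral_mono)
  also have "\<dots> = ennreal (C * r ^ m * min r L)"
    using r g by (simp add: nn_integral_cmult_indicator ennreal_mult)
  also have "\<dots> \<le> ennreal (C * max 1 L * min (r ^ m) (r ^ Suc m))"
  proof (rule ennreal_leI)
    have "min r L \<le> max 1 L * min 1 r"
      using r g(2) mult_right_mono[of 1 "max 1 L" r] by (auto simp: min_def)
    then have "r ^ m * min r L \<le> r ^ m * (max 1 L * min 1 r)" using r by (intro mult_left_mono) auto
    also have "\<dots> = max 1 L * min (r ^ m) (r ^ Suc m)"
      using min_mult_distrib_left[of "r ^ m" 1 r] r by (simp add: mult.commute)
    finally show "C * r ^ m * min r L \<le> C * max 1 L * min (r ^ m) (r ^ Suc m)"
      using g(1) by (simp add: mult.assoc mult_left_mono)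
  qed
  finally show ?thesis by (simp add: r_def)
qed

text \<open>All three claims come from integrability of one function on the product of
  \<open>Q\<close> with Lebesgue measure, by change of variables and Fubini. The moment condition is
  used twice: for that integrability, and for sigma-finiteness of \<open>Q\<close>, since the moment
  function is positive off the origin.\<close>

lemma
  fixes Q :: "(real^'d::finite) measure"
  assumes Q[measurable_cong]: "sets Q = sets borel" and Q0: "emeasure Q {0} = 0"
    and fin: "(\<integral>\<^sup>+y. ennreal (min (norm y ^ m) (norm y ^ Suc m)) \<partial>Q) < \<infinity>"
    and g[measurable]: "g \<in> borel_measurable borel" and cb: "compactly_bounded g"
  shows integrable_radial_smear: "integrable (radial_smear Q (tail_weight m)) g"
    and integrable_tail_weight_integral:
      "integrable Q (\<lambda>y. \<integral>z. tail_weight m z (norm y) * g (z *\<^sub>R sgn y) \<partial>lborel)"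
    and integral_radial_smear: "(\<integral>p. g p \<partial>radial_smear Q (tail_weight m))
      = (\<integral>y. (\<integral>z. tail_weight m z (norm y) * g (z *\<^sub>R sgn y) \<partial>lborel) \<partial>Q)"
proof -
  obtain C L where g': "0 \<le> C" "0 \<le> L" "\<And>y. \<bar>g y\<bar> \<le> C" "\<And>y. L < norm y \<Longrightarrow> g y = 0"
    using compactly_boundedE[OF cb] by blast
  have AE0: "AE y in Q. y \<noteq> 0"
    using Q0 by (intro AE_I[where N = "{0}"]) (auto simp: Q)
  interpret Q: sigma_finite_measure Q
  proof (rule sigma_finite_if_nn_integral_finite[OF _ _ fin])
    show "AE y in Q. 0 < ennreal (min (norm y ^ m) (norm y ^ Suc m))"
      using AE0 by eventually_elim (auto simp: min_def)
  qed measurable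
  interpret pair_sigma_finite Q lborel ..
  let ?f = "\<lambda>(y, z). tail_weight m z (norm y) * g (z *\<^sub>R sgn y)"
  have f[measurable]: "?f \<in> borel_measurable (Q \<Otimes>\<^sub>M lborel)" by measurable
  have int: "integrable (Q \<Otimes>\<^sub>M lborel) ?f"
  proof (rule integrableI_bounded[OF f])
    have "(\<integral>\<^sup>+p. ennreal (norm (?f p)) \<partial>(Q \<Otimes>\<^sub>M lborel))
        = (\<integral>\<^sup>+y. (\<integral>\<^sup>+z. ennreal \<bar>tail_weight m z (norm y) * g (z *\<^sub>R sgn y)\<bar> \<partial>lborel) \<partial>Q)"
      by (subst lborel.nn_integral_fst[symmetric]) auto
    also have "\<dots> \<le> (\<integral>\<^sup>+y. ennreal (C * max 1 L * min (norm y ^ m) (norm y ^ Suc m)) \<partial>Q)"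
      by (intro nn_integral_mono nn_integral_tail_weight_le g')
    also have "\<dots> = ennreal (C * max 1 L) * (\<integral>\<^sup>+y. ennreal (min (norm y ^ m) (norm y ^ Suc m)) \<partial>Q)"
      using g' by (subst nn_integral_cmult[symmetric]) (auto simp: ennreal_mult)
    also have "\<dots> < \<infinity>" using fin by (simp add: ennreal_mult_less_top)
    finally show "(\<integral>\<^sup>+p. ennreal (norm (?f p)) \<partial>(Q \<Otimes>\<^sub>M lborel)) < \<infinity>" .
  qed
  define U where "U p = tail_weight m (snd p) (norm (fst p))" for p :: "(real^'d) \<times> real"
  define s where "s p = snd p *\<^sub>R sgn (fst p)" for p :: "(real^'d) \<times> real"
  have U[measurable]: "U \<in> borel_measurable (Q \<Otimes>\<^sub>M lborel)" unfolding U_def by measurable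
  have s[measurable]: "s \<in> measurable (Q \<Otimes>\<^sub>M lborel) borel" unfolding s_def by measurable
  have f_eq: "?f = (\<lambda>p. U p *\<^sub>R g (s p))" by (auto simp: U_def s_def fun_eq_iff)
  have smear: "radial_smear Q (tail_weight m) = distr (density (Q \<Otimes>\<^sub>M lborel) (\<lambda>p. ennreal (U p))) borel s"
    unfolding radial_smear_def U_def s_def by (simp add: case_prod_unfold)
  have s': "s \<in> measurable (density (Q \<Otimes>\<^sub>M lborel) (\<lambda>p. ennreal (U p))) borel" by simp
  have U0: "AE p in Q \<Otimes>\<^sub>M lborel. 0 \<le> U p" by (simp add: U_def tail_weight_nonneg)
  have gs: "(\<lambda>p. g (s p)) \<in> borel_measurable (Q \<Otimes>\<^sub>M lborel)" by measurable
  show "integrable (radial_smear Q (tail_weight m)) g"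
    unfolding smear integrable_distr_eq[OF s' g] integrable_density[OF gs U U0]
    using int by (simp add: f_eq)
  have "(\<integral>p. g p \<partial>radial_smear Q (tail_weight m)) = (\<integral>p. ?f p \<partial>(Q \<Otimes>\<^sub>M lborel))"
    unfolding smear integral_distr[OF s' g] integral_density[OF gs U U0] f_eq ..
  also have "\<dots> = (\<integral>y. (\<integral>z. tail_weight m z (norm y) * g (z *\<^sub>R sgn y) \<partial>lborel) \<partial>Q)"
    using integral_fst'[OF int] by simp
  finally show "(\<integral>p. g p \<partial>radial_smear Q (tail_weight m))
      = (\<integral>y. (\<integral>z. tail_weight m z (norm y) * g (z *\<^sub>R sgn y) \<partial>lborel) \<partial>Q)" .
  show "integrable Q (\<lambda>y. \<integral>z. tail_weight m z (norm y) * g (z *\<^sub>R sgn y) \<partial>lborel)"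
    using integrable_fst'[OF int] by simp
qed

text \<open>This is the fundamental theorem of calculus. The weight is supported in the open
  interval and the theorem speaks of the closed one; they differ by the null set
  \<open>{0, r}\<close>.\<close>

lemma integral_tail_weight:
  assumes r: "0 \<le> r" and F: "\<And>z. (F has_real_derivative (r - z) ^ m * G z) (at z)"
    and G: "\<And>z. isCont G z"
  shows "(\<integral>z. tail_weight m z r * G z \<partial>lborel) = F r - F 0"
proof -
  have "(\<integral>z. tail_weight m z r * G z \<partial>lborel) = (\<integral>z. ((r - z) ^ m * G z) * indicator {0..r} z \<partial>lborel)"
  proof (rule integral_cong_AE)
    have [measurable]: "G \<in> borel_measurable borel"
      using G by (intro borel_measurable_continuous_onI continuous_at_imp_continuous_on) auto
    show "(\<lambda>z. tail_weight m z r * G z) \<in> borel_measurable lborel" by measurable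
    show "(\<lambda>z. ((r - z) ^ m * G z) * indicator {0..r} z) \<in> borel_measurable lborel" by measurable
    show "AE z in lborel. tail_weight m z r * G z = ((r - z) ^ m * G z) * indicator {0..r} z"
      using AE_lborel_singleton[of 0] AE_lborel_singleton[of r]
      by eventually_elim (auto simp: tail_weight_def indicator_def)
  qed
  also have "\<dots> = F r - F 0"
    using r by (intro integral_FTC_Icc_real F) (auto intro!: continuous_intros G)
  finally show ?thesis .
qed

section \<open>Test functions\<close>

lemma test_function_differentiable:
  "f \<in> test_functions \<Longrightarrow> f differentiable (at x)"
  unfolding test_functions_def partials_def differentiable_on_def
  by (auto dest: spec[of _ "[]"])

lemma has_derivative_partial:
  fixes f :: "real^'d::finite \<Rightarrow> real"
  assumes "(f has_derivative f') (at x)"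
  shows "partial i f x = f' (axis i 1)"
proof -
  have "((\<lambda>t. x + t *\<^sub>R axis i (1::real)) has_derivative (\<lambda>t. t *\<^sub>R axis i 1)) (at 0)"
    by (auto intro!: derivative_eq_intros)
  moreover have "(f has_derivative f') (at (x + 0 *\<^sub>R axis i 1))" using assms by simp
  ultimately have "((\<lambda>t. f (x + t *\<^sub>R axis i 1)) has_derivative (\<lambda>t. f' (t *\<^sub>R axis i 1))) (at 0)"
    by (rule has_derivative_compose)
  moreover have "(\<lambda>t. f' (t *\<^sub>R axis i 1)) = (*) (f' (axis i 1))"
    using has_derivative_linear[OF assms] by (auto simp: linear_cmul mult.commute)
  ultimately have "((\<lambda>t. f (x + t *\<^sub>R axis i 1)) has_field_derivative f' (axis i 1)) (at 0)"
    by (simp add: has_field_derivative_def)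
  then show ?thesis unfolding partial_def by (rule DERIV_imp_deriv)
qed

lemma partial_eq_0:
  assumes "open U" "x \<in> U" "\<And>y. y \<in> U \<Longrightarrow> f y = 0"
  shows "partial i f x = 0"
proof -
  have "(f has_derivative (\<lambda>_. 0)) (at x)"
    by (rule has_derivative_transform_within_open[OF has_derivative_const[of 0] assms(1,2)])
      (simp add: assms(3))
  then show ?thesis using has_derivative_partial by blast
qed

lemma test_function_partial:
  assumes f: "f \<in> test_functions"
  shows "partial i f \<in> test_functions"
  unfolding test_functions_def
proof (intro CollectI conjI allI)
  fix "is"
  \<comment> \<open>\<open>foldr\<close> applies the last direction of the list first, so appending
    \<open>i\<close> means differentiating in direction \<open>i\<close> before all others.\<close>
  have "partials (is @ [i]) f differentiable_on UNIV" using f unfolding test_functions_def by blast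
  then show "partials is (partial i f) differentiable_on UNIV" by (simp add: partials_def)
next
  have "partial i f x = 0" if "x \<notin> closure {x. f x \<noteq> 0}" for x
    using that closure_subset[of "{x. f x \<noteq> 0}"]
    by (intro partial_eq_0[of "- closure {x. f x \<noteq> 0}"]) auto
  then have "{x. partial i f x \<noteq> 0} \<subseteq> closure {x. f x \<noteq> 0}" by auto
  then have "closure {x. partial i f x \<noteq> 0} \<subseteq> closure {x. f x \<noteq> 0}"
    by (rule closure_minimal) simp
  then show "compact (closure {x. partial i f x \<noteq> 0})"
    using f unfolding test_functions_def by (metis (mono_tags, lifting) closed_Int_compact closed_closure inf.absorb_iff1 mem_Collect_eq)
qed

lemma test_function_continuous: "f \<in> test_functions \<Longrightarrow> isCont f x"
  using test_function_differentiable differentiable_imp_continuous_within by blast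

lemma test_function_measurable: "f \<in> test_functions \<Longrightarrow> f \<in> borel_measurable borel"
  by (intro borel_measurable_continuous_onI continuous_at_imp_continuous_on ballI test_function_continuous)

lemma test_function_compactly_bounded:
  assumes f: "f \<in> test_functions"
  shows "compactly_bounded f"
proof -
  let ?K = "closure {x. f x \<noteq> 0}"
  have K: "compact ?K" using f unfolding test_functions_def by blast
  have out: "f x = 0" if "x \<notin> ?K" for x using that closure_subset[of "{x. f x \<noteq> 0}"] by auto
  have "compact (f ` ?K)"
    by (intro compact_continuous_image continuous_at_imp_continuous_on ballI test_function_continuous f K)
  then obtain C where C: "\<And>x. x \<in> ?K \<Longrightarrow> norm (f x) \<le> C"
    using compact_imp_bounded bounded_iff by (metis imageI)
  obtain L where L: "\<And>x. x \<in> ?K \<Longrightarrow> norm x \<le> L"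
    using compact_imp_bounded[OF K] bounded_iff by metis
  show ?thesis
  proof (rule compactly_boundedI[of "max 0 C" "max 0 L"])
    fix y
    show "\<bar>f y\<bar> \<le> max 0 C" using C[of y] out[of y] by (cases "y \<in> ?K") auto
    show "f y = 0" if "max 0 L < norm y" using L[of y] out[of y] that by fastforce
  qed auto
qed

section \<open>Derivatives along lines and Taylor's formula\<close>

lemma test_function_DERIV_line:
  assumes f: "f \<in> test_functions"
  shows "((\<lambda>z. f (x + z *\<^sub>R v)) has_real_derivative (\<Sum>i\<in>UNIV. partial i f (x + z *\<^sub>R v) * v $ i)) (at z)"
proof -
  obtain f' where f': "(f has_derivative f') (at (x + z *\<^sub>R v))"
    using test_function_differentiable[OF f] unfolding differentiable_def by blast
  note lin = has_derivative_linear[OF f']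
  have "((\<lambda>z. x + z *\<^sub>R v) has_derivative (\<lambda>t. t *\<^sub>R v)) (at z)"
    by (auto intro!: derivative_eq_intros)
  then have "((\<lambda>z. f (x + z *\<^sub>R v)) has_derivative (\<lambda>t. f' (t *\<^sub>R v))) (at z)"
    using f' by (rule has_derivative_compose[where f = "\<lambda>z. x + z *\<^sub>R v"])
  moreover have "f' v = (\<Sum>i\<in>UNIV. partial i f (x + z *\<^sub>R v) * v $ i)"
  proof -
    have "f' v = f' (\<Sum>i\<in>UNIV. (v $ i) *\<^sub>R axis i 1)"
      using basis_expansion[of v] by (simp add: scalar_mult_eq_scaleR)
    also have "\<dots> = (\<Sum>i\<in>UNIV. partial i f (x + z *\<^sub>R v) * v $ i)"
      using lin by (simp add: linear_sum linear_cmul has_derivative_partial[OF f'] mult.commute)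
    finally show ?thesis .
  qed
  moreover have "(\<lambda>t. f' (t *\<^sub>R v)) = (*) (f' v)"
    using lin by (auto simp: linear_cmul mult.commute)
  ultimately show ?thesis by (simp add: has_field_derivative_def)
qed

lemma test_function_isCont_line:
  "f \<in> test_functions \<Longrightarrow> isCont (\<lambda>z. f (x + z *\<^sub>R v)) z"
  using DERIV_isCont[OF test_function_DERIV_line] .

lemma abs_component_div_norm_le:
  fixes p :: "real^'d::finite"
  shows "\<bar>p $ i / norm p\<bar> \<le> 1" "\<bar>p $ i * p $ j / (norm p)\<^sup>2\<bar> \<le> 1"
proof -
  have *: "\<bar>p $ i / norm p\<bar> \<le> 1" for i
    using component_le_norm_cart[of p i] by (cases "p = 0") auto
  then show "\<bar>p $ i / norm p\<bar> \<le> 1" .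
  have "\<bar>p $ i * p $ j / (norm p)\<^sup>2\<bar> = \<bar>p $ i / norm p\<bar> * \<bar>p $ j / norm p\<bar>"
    by (simp add: abs_mult power2_eq_square)
  also have "\<dots> \<le> 1 * 1" by (intro mult_mono *) auto
  finally show "\<bar>p $ i * p $ j / (norm p)\<^sup>2\<bar> \<le> 1" by simp
qed

lemma component_measurable: "(\<lambda>p::real^'d::finite. p $ i) \<in> borel_measurable borel"
  by (intro borel_measurable_continuous_onI continuous_intros)

text \<open>The factors \<open>p $ i / norm p\<close> combine the partial derivatives at
  \<open>x + p\<close> into the derivative along the ray through \<open>p\<close>. Integrating it
  over the segment from \<open>x\<close> to \<open>x + y\<close> gives the increment of
  \<open>f\<close> for each single jump \<open>y\<close>, before any integration over
  \<open>\<mu>\<close>.\<close>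

lemma test_function_jump_eq_V:
  fixes f :: "real^'d::finite \<Rightarrow> real"
  assumes f: "f \<in> test_functions" and Q: "sets (\<mu> x) = sets borel" and Q0: "emeasure (\<mu> x) {0} = 0"
    and fin: "(\<integral>\<^sup>+y. ennreal (min 1 (norm y)) \<partial>\<mu> x) < \<infinity>"
  shows "integrable (\<mu> x) (\<lambda>y. f (x + y) - f x)"
    and "(\<integral>y. f (x + y) - f x \<partial>\<mu> x) = (\<Sum>i\<in>UNIV. V_inner \<mu> i (partial i f) x)"
proof -
  note [measurable] = component_measurable
  have fin0: "(\<integral>\<^sup>+y. ennreal (min (norm y ^ 0) (norm y ^ Suc 0)) \<partial>\<mu> x) < \<infinity>" using fin by simp
  have tail: "integrated_tail (\<mu> x) = radial_smear (\<mu> x) (tail_weight 0)"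
  proof (rule integrated_tail_eq[OF Q Q0])
    \<comment> \<open>The moment of \<open>\<mu>\<close> dominates the weaker one under which
      \<open>levy_polar\<close> makes its choice; the stronger bound is what integrability with
      \<open>m = 0\<close> uses.\<close>
    have "min 1 ((norm y)\<^sup>2) \<le> min 1 (norm y)" for y :: "real^'d"
      by (cases "norm y \<le> 1") (auto simp: power2_eq_square mult_left_le intro: min.coboundedI2)
    then have "(\<integral>\<^sup>+y. ennreal (min 1 ((norm y)\<^sup>2)) \<partial>\<mu> x) \<le> (\<integral>\<^sup>+y. ennreal (min 1 (norm y)) \<partial>\<mu> x)"
      by (intro nn_integral_mono ennreal_leI)
    then show "(\<integral>\<^sup>+y. ennreal (min 1 ((norm y)\<^sup>2)) \<partial>\<mu> x) < \<infinity>" using fin by (rule order.strict_trans1)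
  qed
  define g where "g i p = partial i f (x + p) * (p $ i / norm p)" for i p
  define G where "G p = (\<Sum>i\<in>UNIV. g i p)" for p
  have [measurable]: "partial i f \<in> borel_measurable borel" for i
    by (intro test_function_measurable test_function_partial f)
  have g[measurable]: "g i \<in> borel_measurable borel" for i unfolding g_def by measurable
  have g_cb: "compactly_bounded (g i)" for i
    unfolding g_def by (intro compactly_bounded_mult compactly_bounded_translate
        test_function_compactly_bounded test_function_partial f abs_component_div_norm_le)
  have G[measurable]: "G \<in> borel_measurable borel" unfolding G_def by measurable
  have G_cb: "compactly_bounded G" unfolding G_def by (intro compactly_bounded_sum g_cb)
  have inner: "(\<integral>z. tail_weight 0 z (norm y) * G (z *\<^sub>R sgn y) \<partial>lborel) = f (x + y) - f x" for y
  proof -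
    let ?D = "\<lambda>z. \<Sum>i\<in>UNIV. partial i f (x + z *\<^sub>R sgn y) * sgn y $ i"
    have "(\<integral>z. tail_weight 0 z (norm y) * G (z *\<^sub>R sgn y) \<partial>lborel)
        = (\<integral>z. tail_weight 0 z (norm y) * ?D z \<partial>lborel)"
    proof (rule Bochner_Integration.integral_cong[OF refl])
      fix z
      \<comment> \<open>Between 0 and \<open>norm y\<close> the unit vector of
        \<open>z *\<^sub>R sgn y\<close> is \<open>sgn y\<close>, so the angular factors are
        constant along the ray; outside this range the weight is 0.\<close>
      show "tail_weight 0 z (norm y) * G (z *\<^sub>R sgn y) = tail_weight 0 z (norm y) * ?D z"
        by (cases "0 < z \<and> z < norm y") (auto simp: tail_weight_def G_def g_def norm_sgn)
    qed
    also have "\<dots> = f (x + norm y *\<^sub>R sgn y) - f (x + 0 *\<^sub>R sgn y)"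
    proof (rule integral_tail_weight)
      show "((\<lambda>z. f (x + z *\<^sub>R sgn y)) has_real_derivative (norm y - z) ^ 0 * ?D z) (at z)" for z
        using test_function_DERIV_line[OF f] by simp
      show "isCont ?D z" for z
        by (intro continuous_intros test_function_isCont_line test_function_partial f)
    qed simp
    also have "norm y *\<^sub>R sgn y = y" by (cases "y = 0") (auto simp: sgn_div_norm)
    finally show ?thesis by simp
  qed
  show "integrable (\<mu> x) (\<lambda>y. f (x + y) - f x)"
    using integrable_tail_weight_integral[OF Q Q0 fin0 G G_cb] unfolding inner .
  have "(\<Sum>i\<in>UNIV. V_inner \<mu> i (partial i f) x) = (\<integral>p. G p \<partial>integrated_tail (\<mu> x))"
    unfolding V_inner_def G_def g_def[symmetric] tail
    by (rule Bochner_Integration.integral_sum[symmetric]) (rule integrable_radial_smear[OF Q Q0 fin0 g g_cb])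
  also have "\<dots> = (\<integral>y. f (x + y) - f x \<partial>\<mu> x)"
    using integral_radial_smear[OF Q Q0 fin0 G G_cb] unfolding inner tail .
  finally show "(\<integral>y. f (x + y) - f x \<partial>\<mu> x) = (\<Sum>i\<in>UNIV. V_inner \<mu> i (partial i f) x)" ..
qed

text \<open>The same scheme one order higher: the second derivative along the ray, weighted with
  \<open>norm y - z\<close>, integrates to the first-order Taylor remainder.\<close>

lemma test_function_jump_eq_W:
  fixes f :: "real^'d::finite \<Rightarrow> real"
  assumes f: "f \<in> test_functions" and Q: "sets (\<rho> x) = sets borel" and Q0: "emeasure (\<rho> x) {0} = 0"
    and fin: "(\<integral>\<^sup>+y. ennreal (min (norm y) ((norm y)\<^sup>2)) \<partial>\<rho> x) < \<infinity>"
  shows "integrable (\<rho> x) (\<lambda>y. f (x + y) - f x - grad f x \<bullet> y)"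
    and "(\<integral>y. f (x + y) - f x - grad f x \<bullet> y \<partial>\<rho> x)
      = (\<Sum>i\<in>UNIV. \<Sum>j\<in>UNIV. W_inner \<rho> i j (partial j (partial i f)) x)"
proof -
  note [measurable] = component_measurable
  have fin1: "(\<integral>\<^sup>+y. ennreal (min (norm y ^ 1) (norm y ^ Suc 1)) \<partial>\<rho> x) < \<infinity>"
    using fin by (simp add: power2_eq_square)
  note tail = double_integrated_tail_eq[OF Q Q0 fin]
  \<comment> \<open>The order \<open>partial j (partial i f)\<close> is the one that
    \<open>dist_hess\<close> produces, and also the one obtained by differentiating
    \<open>?D1\<close> below; mixed derivatives never have to be exchanged.\<close>
  define g where "g i j p = partial j (partial i f) (x + p) * (p $ i * p $ j / (norm p)\<^sup>2)" for i j p
  define G where "G p = (\<Sum>i\<in>UNIV. \<Sum>j\<in>UNIV. g i j p)" for p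
  have f2: "partial j (partial i f) \<in> test_functions" for i j
    by (intro test_function_partial f)
  have [measurable]: "partial j (partial i f) \<in> borel_measurable borel" for i j
    by (intro test_function_measurable f2)
  have g[measurable]: "g i j \<in> borel_measurable borel" for i j unfolding g_def by measurable
  have g_cb: "compactly_bounded (g i j)" for i j
    unfolding g_def by (intro compactly_bounded_mult compactly_bounded_translate
        test_function_compactly_bounded f2 abs_component_div_norm_le)
  have G[measurable]: "G \<in> borel_measurable borel" unfolding G_def by measurable
  have G_cb: "compactly_bounded G" unfolding G_def by (intro compactly_bounded_sum g_cb)
  have inner: "(\<integral>z. tail_weight 1 z (norm y) * G (z *\<^sub>R sgn y) \<partial>lborel) = f (x + y) - f x - grad f x \<bullet> y" for y
  proof -
    let ?D1 = "\<lambda>z. \<Sum>i\<in>UNIV. partial i f (x + z *\<^sub>R sgn y) * sgn y $ i"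
    let ?D = "\<lambda>z. \<Sum>i\<in>UNIV. (\<Sum>j\<in>UNIV. partial j (partial i f) (x + z *\<^sub>R sgn y) * sgn y $ j) * sgn y $ i"
    \<comment> \<open>Integration by parts written as an antiderivative: the two first-order terms
      in the derivative of \<open>?F\<close> cancel and \<open>(norm y - z) * ?D z\<close> remains.
      At \<open>norm y\<close> the value is \<open>f (x + y)\<close>, at 0 it is
      \<open>f x + grad f x \<bullet> y\<close>.\<close>
    let ?F = "\<lambda>z. (norm y - z) * ?D1 z + f (x + z *\<^sub>R sgn y)"
    have "(\<integral>z. tail_weight 1 z (norm y) * G (z *\<^sub>R sgn y) \<partial>lborel)
        = (\<integral>z. tail_weight 1 z (norm y) * ?D z \<partial>lborel)"
    proof (rule Bochner_Integration.integral_cong[OF refl])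
      fix z
      show "tail_weight 1 z (norm y) * G (z *\<^sub>R sgn y) = tail_weight 1 z (norm y) * ?D z"
        by (cases "0 < z \<and> z < norm y")
          (auto simp: tail_weight_def G_def g_def norm_sgn sum_distrib_left power2_eq_square mult_ac)
    qed
    also have "\<dots> = ?F (norm y) - ?F 0"
    proof (rule integral_tail_weight)
      show "(?F has_real_derivative (norm y - z) ^ 1 * ?D z) (at z)" for z
      proof -
        have "(?D1 has_real_derivative ?D z) (at z)"
          by (intro DERIV_sum DERIV_cmult_right test_function_DERIV_line test_function_partial f)
        moreover have "((\<lambda>z. norm y - z) has_real_derivative - 1) (at z)"
          by (auto intro!: derivative_eq_intros)
        ultimately have "(?F has_real_derivative (- 1 * ?D1 z + ?D z * (norm y - z)) + ?D1 z) (at z)"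
          by (intro DERIV_add DERIV_mult test_function_DERIV_line f)
        then show ?thesis by (rule DERIV_cong) simp
      qed
      show "isCont ?D z" for z
        by (intro continuous_intros test_function_isCont_line f2)
    qed simp
    also have "norm y *\<^sub>R sgn y = y" by (cases "y = 0") (auto simp: sgn_div_norm)
    moreover have "norm y * ?D1 0 = grad f x \<bullet> y"
    proof -
      have "norm y * sgn y $ i = y $ i" for i by (cases "y = 0") (auto simp: sgn_div_norm)
      then show ?thesis
        by (simp add: grad_def inner_vec_def sum_distrib_left mult.left_commute[of "norm y"])
    qed
    ultimately show ?thesis by simp
  qed
  show "integrable (\<rho> x) (\<lambda>y. f (x + y) - f x - grad f x \<bullet> y)"
    using integrable_tail_weight_integral[OF Q Q0 fin1 G G_cb] unfolding inner .
  have int_g: "integrable (radial_smear (\<rho> x) (tail_weight 1)) (g i j)" for i j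
    by (rule integrable_radial_smear[OF Q Q0 fin1 g g_cb])
  have "(\<Sum>i\<in>UNIV. \<Sum>j\<in>UNIV. W_inner \<rho> i j (partial j (partial i f)) x)
      = (\<integral>p. G p \<partial>double_integrated_tail (\<rho> x))"
    unfolding W_inner_def G_def g_def[symmetric] tail
    using int_g by (simp add: Bochner_Integration.integral_sum del: One_nat_def)
  also have "\<dots> = (\<integral>y. f (x + y) - f x - grad f x \<bullet> y \<partial>\<rho> x)"
    using integral_radial_smear[OF Q Q0 fin1 G G_cb] unfolding inner tail .
  finally show "(\<integral>y. f (x + y) - f x - grad f x \<bullet> y \<partial>\<rho> x)
      = (\<Sum>i\<in>UNIV. \<Sum>j\<in>UNIV. W_inner \<rho> i j (partial j (partial i f)) x)" ..
qed

section \<open>The operator on test functions\<close>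

lemma convenient_decompositionD:
  assumes "convenient_decomposition K \<nu> \<mu> \<rho>" "levy_kernel K"
  shows "sets (K x) = sets borel" "sets (\<nu> x) = sets borel" "sets (\<mu> x) = sets borel" "sets (\<rho> x) = sets borel"
    "emeasure (\<mu> x) {0} = 0" "emeasure (\<rho> x) {0} = 0" "finite_measure (\<nu> x)"
    "(\<integral>\<^sup>+y. ennreal (min 1 (norm y)) \<partial>\<mu> x) < \<infinity>"
    "(\<integral>\<^sup>+y. ennreal (min (norm y) ((norm y)\<^sup>2)) \<partial>\<rho> x) < \<infinity>"
proof -
  show K: "sets (K x) = sets borel" using assms(2) unfolding levy_kernel_def levy_measure_def by blast
  have K0: "emeasure (K x) {0} = 0" using assms(2) unfolding levy_kernel_def levy_measure_def by blast
  obtain h\<^sub>\<nu> h\<^sub>\<mu> h\<^sub>\<rho> where h: "\<And>x. \<nu> x = density (K x) (\<lambda>y. ennreal (h\<^sub>\<nu> y))"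
      "\<And>x. \<mu> x = density (K x) (\<lambda>y. ennreal (h\<^sub>\<mu> y))" "\<And>x. \<rho> x = density (K x) (\<lambda>y. ennreal (h\<^sub>\<rho> y))"
    using assms(1) unfolding convenient_decomposition_def by blast
  show \<nu>: "sets (\<nu> x) = sets borel" and "sets (\<mu> x) = sets borel" "sets (\<rho> x) = sets borel"
    by (simp_all add: h K)
  have "\<forall>B\<in>sets borel. emeasure (K x) B = emeasure (\<nu> x) B + emeasure (\<mu> x) B + emeasure (\<rho> x) B"
    using assms(1) unfolding convenient_decomposition_def by blast
  then have "emeasure (K x) {0} = emeasure (\<nu> x) {0} + emeasure (\<mu> x) {0} + emeasure (\<rho> x) {0}"
    by (rule bspec) simp
  then show "emeasure (\<mu> x) {0} = 0" "emeasure (\<rho> x) {0} = 0" using K0 by auto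
  have fin: "emeasure (\<nu> x) UNIV < \<infinity>" using assms(1) unfolding convenient_decomposition_def by blast
  show "finite_measure (\<nu> x)"
  proof
    show "emeasure (\<nu> x) (space (\<nu> x)) \<noteq> \<infinity>"
      using fin sets_eq_imp_space_eq[OF \<nu>] by simp
  qed
  show "(\<integral>\<^sup>+y. ennreal (min 1 (norm y)) \<partial>\<mu> x) < \<infinity>"
    "(\<integral>\<^sup>+y. ennreal (min (norm y) ((norm y)\<^sup>2)) \<partial>\<rho> x) < \<infinity>"
    using assms(1) unfolding convenient_decomposition_def by blast+
qed

text \<open>Instead of deducing that the sum \<open>H\<close> of the three densities is 1 almost
  everywhere, \<open>K x\<close> is replaced by the equal measure \<open>density (K x) H\<close>.
  Each density lies between 0 and \<open>H\<close>, so integrability of \<open>H * g\<close> carries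
  over to each product.\<close>

lemma integral_convenient_decomposition:
  fixes g :: "real^'d::finite \<Rightarrow> real"
  assumes cd: "convenient_decomposition K \<nu> \<mu> \<rho>" and levy: "levy_kernel K" and int: "integrable (K x) g"
  shows "integrable (\<nu> x) g" "integrable (\<mu> x) g" "integrable (\<rho> x) g"
    "(\<integral>y. g y \<partial>K x) = (\<integral>y. g y \<partial>\<nu> x) + (\<integral>y. g y \<partial>\<mu> x) + (\<integral>y. g y \<partial>\<rho> x)"
proof -
  have K: "sets (K x) = sets borel" using convenient_decompositionD(1)[OF cd levy] .
  obtain h\<^sub>\<nu> h\<^sub>\<mu> h\<^sub>\<rho> :: "real^'d \<Rightarrow> real" where cont: "continuous_on UNIV h\<^sub>\<nu>" "continuous_on UNIV h\<^sub>\<mu>" "continuous_on UNIV h\<^sub>\<rho>"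
    and nonneg: "\<And>y. 0 \<le> h\<^sub>\<nu> y" "\<And>y. 0 \<le> h\<^sub>\<mu> y" "\<And>y. 0 \<le> h\<^sub>\<rho> y"
    and h: "\<nu> x = density (K x) (\<lambda>y. ennreal (h\<^sub>\<nu> y))"
      "\<mu> x = density (K x) (\<lambda>y. ennreal (h\<^sub>\<mu> y))" "\<rho> x = density (K x) (\<lambda>y. ennreal (h\<^sub>\<rho> y))"
    using cd unfolding convenient_decomposition_def by blast
  have meas: "f \<in> borel_measurable (K x)" if "continuous_on UNIV f" for f :: "real^'d \<Rightarrow> real"
    using borel_measurable_continuous_onI[OF that] by (simp add: measurable_cong_sets[OF K refl])
  note [measurable] = meas[OF cont(1)] meas[OF cont(2)] meas[OF cont(3)]
  have g[measurable]: "g \<in> borel_measurable (K x)" using int by simp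
  define H where "H y = h\<^sub>\<nu> y + h\<^sub>\<mu> y + h\<^sub>\<rho> y" for y
  have H[measurable]: "H \<in> borel_measurable (K x)" unfolding H_def by measurable
  have H0: "AE y in K x. 0 \<le> H y" by (simp add: H_def nonneg)
  have KH: "density (K x) (\<lambda>y. ennreal (H y)) = K x"
  proof (rule measure_eqI)
    fix B assume "B \<in> sets (density (K x) (\<lambda>y. ennreal (H y)))"
    then have B[measurable]: "B \<in> sets (K x)" by simp
    have "emeasure (density (K x) (\<lambda>y. ennreal (H y))) B
        = (\<integral>\<^sup>+y. ennreal (h\<^sub>\<nu> y) * indicator B y + ennreal (h\<^sub>\<mu> y) * indicator B y + ennreal (h\<^sub>\<rho> y) * indicator B y \<partial>K x)"
      by (subst emeasure_density) (auto simp: H_def nonneg ennreal_plus distrib_right simp del: ennreal_plus[symmetric])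
    also have "\<dots> = emeasure (\<nu> x) B + emeasure (\<mu> x) B + emeasure (\<rho> x) B"
      by (simp add: nn_integral_add h emeasure_density)
    also have "\<dots> = emeasure (K x) B"
      using cd B unfolding convenient_decomposition_def by (simp add: K)
    finally show "emeasure (density (K x) (\<lambda>y. ennreal (H y))) B = emeasure (K x) B" .
  qed simp
  have "integrable (density (K x) (\<lambda>y. ennreal (H y))) g" using int by (simp only: KH)
  then have Hg: "integrable (K x) (\<lambda>y. H y *\<^sub>R g y)" by (simp only: integrable_density[OF g H H0])
  have hg: "integrable (K x) (\<lambda>y. h y *\<^sub>R g y)"
    if "h \<in> borel_measurable (K x)" "\<And>y. 0 \<le> h y" "\<And>y. h y \<le> H y" for h
  proof (rule Bochner_Integration.integrable_bound[OF Hg])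
    show "(\<lambda>y. h y *\<^sub>R g y) \<in> borel_measurable (K x)" using that by measurable
    show "AE y in K x. norm (h y *\<^sub>R g y) \<le> norm (H y *\<^sub>R g y)"
    proof (rule AE_I2)
      fix y
      have "\<bar>h y\<bar> \<le> \<bar>H y\<bar>" using that(2,3)[of y] by linarith
      then show "norm (h y *\<^sub>R g y) \<le> norm (H y *\<^sub>R g y)" by (simp add: abs_mult mult_right_mono)
    qed
  qed
  have i: "integrable (K x) (\<lambda>y. h\<^sub>\<nu> y *\<^sub>R g y)" "integrable (K x) (\<lambda>y. h\<^sub>\<mu> y *\<^sub>R g y)" "integrable (K x) (\<lambda>y. h\<^sub>\<rho> y *\<^sub>R g y)"
    by (intro hg; simp add: nonneg H_def add_nonneg_nonneg add_increasing add_increasing2)+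
  have ae: "AE y in K x. 0 \<le> h\<^sub>\<nu> y" "AE y in K x. 0 \<le> h\<^sub>\<mu> y" "AE y in K x. 0 \<le> h\<^sub>\<rho> y"
    by (simp_all add: nonneg)
  show "integrable (\<nu> x) g" "integrable (\<mu> x) g" "integrable (\<rho> x) g"
    unfolding h using i ae by (simp_all add: integrable_density)
  have "(\<integral>y. g y \<partial>K x) = (\<integral>y. g y \<partial>density (K x) (\<lambda>y. ennreal (H y)))" by (simp only: KH)
  also have "\<dots> = (\<integral>y. H y *\<^sub>R g y \<partial>K x)" by (rule integral_density[OF g H H0])
  also have "\<dots> = (\<integral>y. h\<^sub>\<nu> y *\<^sub>R g y + h\<^sub>\<mu> y *\<^sub>R g y + h\<^sub>\<rho> y *\<^sub>R g y \<partial>K x)"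
    by (simp add: H_def algebra_simps)
  also have "\<dots> = (\<integral>y. h\<^sub>\<nu> y *\<^sub>R g y \<partial>K x) + (\<integral>y. h\<^sub>\<mu> y *\<^sub>R g y \<partial>K x) + (\<integral>y. h\<^sub>\<rho> y *\<^sub>R g y \<partial>K x)"
    using i by (subst Bochner_Integration.integral_add, auto)+
  also have "\<dots> = (\<integral>y. g y \<partial>\<nu> x) + (\<integral>y. g y \<partial>\<mu> x) + (\<integral>y. g y \<partial>\<rho> x)"
    unfolding h using ae by (simp add: integral_density)
  finally show "(\<integral>y. g y \<partial>K x) = (\<integral>y. g y \<partial>\<nu> x) + (\<integral>y. g y \<partial>\<mu> x) + (\<integral>y. g y \<partial>\<rho> x)" .
qed

lemma integrable_if_norm_le_finite:
  fixes f :: "'a \<Rightarrow> 'b::{banach, second_countable_topology}"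
  assumes f: "f \<in> borel_measurable M" and fin: "(\<integral>\<^sup>+y. ennreal (w y) \<partial>M) < \<infinity>"
    and le: "\<And>y. norm (f y) \<le> w y"
  shows "integrable M f"
proof (rule integrableI_bounded[OF f])
  have "(\<integral>\<^sup>+y. ennreal (norm (f y)) \<partial>M) \<le> (\<integral>\<^sup>+y. ennreal (w y) \<partial>M)"
    by (intro nn_integral_mono ennreal_leI le)
  then show "(\<integral>\<^sup>+y. ennreal (norm (f y)) \<partial>M) < \<infinity>" using fin by (rule order.strict_trans1)
qed

text \<open>The compensator \<open>grad f x \<bullet> y\<close> for \<open>norm y < 1\<close> suits
  none of the three parts: \<open>\<nu>\<close> and \<open>\<mu>\<close> want none,
  \<open>\<rho>\<close> wants it for all jumps. Removing the small-jump term from the first two and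
  adding the large-jump term back for the third costs a multiple of the gradient, which is how the
  three terms of \<open>a_pi\<close> and their signs arise.\<close>

lemma jump_part_eq:
  fixes f :: "real^'d::finite \<Rightarrow> real"
  assumes cd: "convenient_decomposition K \<nu> \<mu> \<rho>" and levy: "levy_kernel K"
    and f: "f \<in> test_functions" and int: "integrable (K x) (jump_integrand f x)"
  shows "(\<integral>y. jump_integrand f x y \<partial>K x) = a_pi \<nu> \<mu> \<rho> x \<bullet> grad f x + U_inner \<nu> f x
    + (\<Sum>i\<in>UNIV. V_inner \<mu> i (partial i f) x)
    + (\<Sum>i\<in>UNIV. \<Sum>j\<in>UNIV. W_inner \<rho> i j (partial j (partial i f)) x)"
proof -
  note cdD = convenient_decompositionD[OF cd levy, of x]
  note V = test_function_jump_eq_V[where \<mu> = \<mu> and x = x, OF f cdD(3,5,8)]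
  note W = test_function_jump_eq_W[where \<rho> = \<rho> and x = x, OF f cdD(4,6,9)]
  note [measurable_cong] = cdD(2-4)
  note [measurable] = test_function_measurable[OF f]
  let ?s = "\<lambda>y::real^'d. indicator {y. norm y < 1} y *\<^sub>R y"
  let ?l = "\<lambda>y::real^'d. indicator {y. 1 \<le> norm y} y *\<^sub>R y"
  interpret \<nu>: finite_measure "\<nu> x" by (rule cdD(7))
  have space_\<nu>: "space (\<nu> x) = UNIV" using sets_eq_imp_space_eq[OF cdD(2)] by simp
  have j_s: "jump_integrand f x y = f (x + y) - f x - grad f x \<bullet> ?s y" for y
    by (simp add: jump_integrand_def mult.commute)
  have j_l: "jump_integrand f x y = (f (x + y) - f x - grad f x \<bullet> y) + grad f x \<bullet> ?l y" for y
    by (auto simp: jump_integrand_def indicator_def)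
  \<comment> \<open>Each correction converges by the moment condition of its own part:
    \<open>\<nu> x\<close> is finite, \<open>\<mu> x\<close> integrates
    \<open>min 1 (norm y)\<close>, and for large jumps \<open>min (norm y) ((norm y)^2)\<close>
    equals \<open>norm y\<close>.\<close>
  have s_\<nu>: "integrable (\<nu> x) ?s"
    by (rule \<nu>.integrable_const_bound[of _ 1]) (auto simp: indicator_def)
  have f_\<nu>: "integrable (\<nu> x) (\<lambda>y. f (x + y))"
    by (intro compactly_bounded_integrable compactly_bounded_translate test_function_compactly_bounded f cdD(7)) measurable
  have s_\<mu>: "integrable (\<mu> x) ?s"
    by (rule integrable_if_norm_le_finite[OF _ cdD(8)]) (measurable, simp add: indicator_def)
  have l_\<rho>: "integrable (\<rho> x) ?l"
  proof (rule integrable_if_norm_le_finite[OF _ cdD(9)])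
    fix y :: "real^'d"
    show "norm (?l y) \<le> min (norm y) ((norm y)\<^sup>2)"
      using mult_right_mono[of 1 "norm y" "norm y"] by (auto simp: indicator_def power2_eq_square)
  qed measurable
  have "(\<integral>y. jump_integrand f x y \<partial>\<nu> x) = (\<integral>y. f (x + y) \<partial>\<nu> x) - f x * measure (\<nu> x) UNIV - grad f x \<bullet> (\<integral>y. ?s y \<partial>\<nu> x)"
    unfolding j_s using s_\<nu> f_\<nu> by (simp add: space_\<nu> mult.commute del: inner_scaleR_right)
  moreover have "(\<integral>y. jump_integrand f x y \<partial>\<mu> x) = (\<Sum>i\<in>UNIV. V_inner \<mu> i (partial i f) x) - grad f x \<bullet> (\<integral>y. ?s y \<partial>\<mu> x)"
    unfolding j_s V(2)[symmetric]
    using s_\<mu> V(1)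
    by (simp del: inner_scaleR_right)
  moreover have "(\<integral>y. jump_integrand f x y \<partial>\<rho> x)
      = (\<Sum>i\<in>UNIV. \<Sum>j\<in>UNIV. W_inner \<rho> i j (partial j (partial i f)) x) + grad f x \<bullet> (\<integral>y. ?l y \<partial>\<rho> x)"
    unfolding j_l W(2)[symmetric]
    using l_\<rho> W(1)
    by (subst Bochner_Integration.integral_add) (simp_all del: inner_scaleR_right)
  ultimately show ?thesis
    unfolding integral_convenient_decomposition(4)[OF cd levy int]
    by (simp add: a_pi_def set_lebesgue_integral_def U_inner_def inner_commute[of _ "grad f x"]
        inner_add_right inner_diff_right)
qed

section \<open>The adjoint\<close>

lemma partial_add:
  assumes "has_partial i f x" "has_partial i g x"
  shows "partial i (\<lambda>x. f x + g x) x = partial i f x + partial i g x"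
  using assms unfolding has_partial_def partial_def
  by (intro DERIV_imp_deriv DERIV_add) (simp_all add: DERIV_deriv_iff_field_differentiable)

lemma partial_cmult:
  assumes "has_partial i f x"
  shows "partial i (\<lambda>x. c * f x) x = c * partial i f x"
  using assms unfolding has_partial_def partial_def
  by (intro DERIV_imp_deriv DERIV_cmult) (simp add: DERIV_deriv_iff_field_differentiable)

text \<open>Neither \<open>deriv\<close> nor the Bochner integral is additive without existence. The
  derivatives and integrals that \<open>levy_type_operator\<close> guarantees on its domain are
  exactly what makes every term of the formula additive.\<close>

lemma levy_type_operator_add:
  assumes L: "levy_type_operator E D A a b K" and f: "f \<in> D" and g: "g \<in> D"
  shows "A (\<lambda>x. f x + g x) = (\<lambda>x. A f x + A g x)"
proof
  fix x
  have D: "fun_subspace D" using L by (simp add: levy_type_operator_def)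
  note fg = fun_subspace_add[OF D f g]
  have hp: "has_partial i h z" if "h \<in> D" for h i z
    using L that unfolding levy_type_operator_def by blast
  have de: "div_form_exists b h x" "integrable (K x) (jump_integrand h x)"
    "A h x = a x \<bullet> grad h x + 1/2 * div_form b h x + (\<integral>y. jump_integrand h x y \<partial>K x)" if "h \<in> D" for h
    using L that unfolding levy_type_operator_def by blast+
  have gr: "grad (\<lambda>x. f x + g x) x = grad f x + grad g x"
    by (simp add: grad_def vec_eq_iff partial_add hp f g)
  \<comment> \<open>The diffusion term differentiates this function once more, so the inner
    derivative must split at every \<open>z\<close>, not only at \<open>x\<close>.\<close>
  have "(\<lambda>z. b z $ i $ j * partial j (\<lambda>x. f x + g x) z)
      = (\<lambda>z. b z $ i $ j * partial j f z + b z $ i $ j * partial j g z)" for i j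
    by (simp add: partial_add hp f g distrib_left)
  then have "div_form b (\<lambda>x. f x + g x) x = div_form b f x + div_form b g x"
    using de(1)[OF f] de(1)[OF g] unfolding div_form_def div_form_exists_def
    by (simp add: partial_add sum.distrib)
  moreover have "jump_integrand (\<lambda>x. f x + g x) x = (\<lambda>y. jump_integrand f x y + jump_integrand g x y)"
    by (auto simp: jump_integrand_def gr inner_add_left algebra_simps)
  ultimately show "A (\<lambda>x. f x + g x) x = A f x + A g x"
    using de(2)[OF f] de(2)[OF g]
    by (simp add: de(3)[OF f] de(3)[OF g] de(3)[OF fg] gr inner_add_right)
qed

lemma levy_type_operator_cmult:
  assumes L: "levy_type_operator E D A a b K" and f: "f \<in> D"
  shows "A (\<lambda>x. c * f x) = (\<lambda>x. c * A f x)"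
proof
  fix x
  have D: "fun_subspace D" using L by (simp add: levy_type_operator_def)
  note cf = fun_subspace_scale[OF D f, of c]
  have hp: "has_partial i f z" for i z
    using L f unfolding levy_type_operator_def by blast
  have de: "div_form_exists b h x" "integrable (K x) (jump_integrand h x)"
    "A h x = a x \<bullet> grad h x + 1/2 * div_form b h x + (\<integral>y. jump_integrand h x y \<partial>K x)" if "h \<in> D" for h
    using L that unfolding levy_type_operator_def by blast+
  have gr: "grad (\<lambda>x. c * f x) x = c *\<^sub>R grad f x"
    by (simp add: grad_def vec_eq_iff partial_cmult hp)
  have "(\<lambda>z. b z $ i $ j * partial j (\<lambda>x. c * f x) z) = (\<lambda>z. c * (b z $ i $ j * partial j f z))" for i j
    by (simp add: partial_cmult hp mult.left_commute)
  then have "div_form b (\<lambda>x. c * f x) x = c * div_form b f x"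
    using de(1)[OF f] unfolding div_form_def div_form_exists_def
    by (simp add: partial_cmult sum_distrib_left)
  moreover have "jump_integrand (\<lambda>x. c * f x) x = (\<lambda>y. c * jump_integrand f x y)"
    by (auto simp: jump_integrand_def gr algebra_simps)
  ultimately show "A (\<lambda>x. c * f x) x = c * A f x"
    by (simp add: de(3)[OF f] de(3)[OF cf] gr distrib_left)
qed

text \<open>The bound in \<open>adjoint_domain\<close> is relative to \<open>N f\<close> rather than
  \<open>N (A f)\<close>, which is what the extension lemma asks of the functional sending
  \<open>f\<close> to \<open>T (A f)\<close>.\<close>

lemma adjoint_op_eq:
  assumes B: "banach_function_space E N" and L: "levy_type_operator E D A a b K"
    and dense: "dense_in N E D" and T: "T \<in> adjoint_domain E N D A" and f: "f \<in> D"
  shows "adjoint_op E N D A T f = T (A f)"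
proof -
  have D: "fun_subspace D" and AE: "\<And>f. f \<in> D \<Longrightarrow> A f \<in> E"
    using L by (simp_all add: levy_type_operator_def)
  have lin: "\<And>f g. f \<in> E \<Longrightarrow> g \<in> E \<Longrightarrow> T (\<lambda>x. f x + g x) = T f + T g"
    "\<And>f c. f \<in> E \<Longrightarrow> T (\<lambda>x. c * f x) = c * T f"
    using T by (simp_all add: adjoint_domain_def dual_space_def)
  obtain c where c: "0 \<le> c" "\<And>f. f \<in> D \<Longrightarrow> \<bar>T (A f)\<bar> \<le> c * N f"
    using T unfolding adjoint_domain_def by blast
  have "\<exists>!S. S \<in> dual_space E N \<and> (\<forall>f\<in>D. S f = T (A f))"
    by (rule bounded_extension[OF B dense D, of "\<lambda>f. T (A f)" c])
      (simp_all add: levy_type_operator_add[OF L] levy_type_operator_cmult[OF L] lin AE c)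
  from theI'[OF this] f show ?thesis unfolding adjoint_op_def by blast
qed

theorem corollary7p1:
  fixes E D :: "(real^'d::finite \<Rightarrow> real) set"
    and N :: "(real^'d \<Rightarrow> real) \<Rightarrow> real"
    and A :: "(real^'d \<Rightarrow> real) \<Rightarrow> real^'d \<Rightarrow> real"
    and a :: "real^'d \<Rightarrow> real^'d"
    and b :: "real^'d \<Rightarrow> real^'d^'d"
    and K \<nu> \<mu> \<rho> :: "real^'d \<Rightarrow> (real^'d) measure"
    and \<phi> :: "(real^'d) measure"
  assumes "banach_function_space E N"
    and "levy_type_operator E D A a b K"
    and "dense_in N E D"
    and "test_functions \<subseteq> D"
    and "convenient_decomposition K \<nu> \<mu> \<rho>"
    and "\<forall>g\<in>E. integrable \<phi> g"
    and "measure_functional E \<phi> \<in> adjoint_domain E N D A"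
    and "\<phi> \<in> M_space a b \<nu> \<mu> \<rho>"
  shows "restrict (adjoint_op E N D A (measure_functional E \<phi>)) test_functions =
    (\<lambda>f\<in>test_functions.
       - dist_div (vector_measure (\<lambda>x. a x + a_pi \<nu> \<mu> \<rho> x) \<phi>) f
       + diffusion_functional b \<phi> f
       + U_functional \<nu> \<phi> f
       - dist_div (V_functional \<mu> \<phi>) f
       + dist_hess (W_functional \<rho> \<phi>) f)"
proof (rule restrict_ext)
  fix f :: "real^'d \<Rightarrow> real" assume f: "f \<in> test_functions"
  note L = assms(2)
  have fD: "f \<in> D" using f assms(4) by blast
  have AE: "A f \<in> E" and levy: "levy_kernel K"
    using L fD unfolding levy_type_operator_def characteristic_triplet_def by blast+
  have Af: "A f x = a x \<bullet> grad f x + 1/2 * div_form b f x + (\<integral>y. jump_integrand f x y \<partial>K x)"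
    and int: "integrable (K x) (jump_integrand f x)" for x
    using L fD unfolding levy_type_operator_def by blast+
  let ?c = "\<lambda>x. a x + a_pi \<nu> \<mu> \<rho> x"
  \<comment> \<open>These conditions from \<open>M_space\<close> are what permits splitting the
    integral of \<open>A f\<close> with respect to \<open>\<phi>\<close> into its individual
    terms.\<close>
  have M: "integrable \<phi> (\<lambda>x. partial i f x * ?c x $ i)" "integrable \<phi> (\<lambda>x. 1/2 * div_form b f x)"
    "integrable \<phi> (U_inner \<nu> f)" "integrable \<phi> (V_inner \<mu> i (partial i f))"
    "integrable \<phi> (W_inner \<rho> i j (partial j (partial i f)))" for i j
    using assms(8) f unfolding M_space_def by blast+
  have "adjoint_op E N D A (measure_functional E \<phi>) f = measure_functional E \<phi> (A f)"
    by (rule adjoint_op_eq[OF assms(1-3,7) fD])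
  also have "\<dots> = (\<integral>x. A f x \<partial>\<phi>)" using AE by (simp add: measure_functional_def)
  also have "\<dots> = (\<integral>x. (\<Sum>i\<in>UNIV. partial i f x * ?c x $ i) + 1/2 * div_form b f x + U_inner \<nu> f x
      + (\<Sum>i\<in>UNIV. V_inner \<mu> i (partial i f) x)
      + (\<Sum>i\<in>UNIV. \<Sum>j\<in>UNIV. W_inner \<rho> i j (partial j (partial i f)) x) \<partial>\<phi>)"
  proof (rule Bochner_Integration.integral_cong[OF refl])
    fix x
    have "a x \<bullet> grad f x + a_pi \<nu> \<mu> \<rho> x \<bullet> grad f x = (\<Sum>i\<in>UNIV. partial i f x * ?c x $ i)"
      unfolding inner_add_left[symmetric] by (simp add: inner_vec_def grad_def mult.commute)
    then show "A f x = (\<Sum>i\<in>UNIV. partial i f x * ?c x $ i) + 1/2 * div_form b f x + U_inner \<nu> f x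
      + (\<Sum>i\<in>UNIV. V_inner \<mu> i (partial i f) x)
      + (\<Sum>i\<in>UNIV. \<Sum>j\<in>UNIV. W_inner \<rho> i j (partial j (partial i f)) x)"
      unfolding Af jump_part_eq[where x = x, OF assms(5) levy f int] by linarith
  qed
  also have "\<dots> = (\<Sum>i\<in>UNIV. \<integral>x. partial i f x * ?c x $ i \<partial>\<phi>) + (\<integral>x. 1/2 * div_form b f x \<partial>\<phi>)
      + (\<integral>x. U_inner \<nu> f x \<partial>\<phi>) + (\<Sum>i\<in>UNIV. \<integral>x. V_inner \<mu> i (partial i f) x \<partial>\<phi>)
      + (\<Sum>i\<in>UNIV. \<Sum>j\<in>UNIV. \<integral>x. W_inner \<rho> i j (partial j (partial i f)) x \<partial>\<phi>)"
    using M by (simp add: Bochner_Integration.integral_sum)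
  \<comment> \<open>Every distributional derivative contributes one minus sign: the two first-order
    sums become negated divergences, while in the second-order sum the signs cancel.\<close>
  also have "\<dots> = - dist_div (vector_measure ?c \<phi>) f + diffusion_functional b \<phi> f
       + U_functional \<nu> \<phi> f - dist_div (V_functional \<mu> \<phi>) f + dist_hess (W_functional \<rho> \<phi>) f"
    by (simp add: dist_div_def dist_hess_def dist_partial_def vector_measure_def diffusion_functional_def
        U_functional_def V_functional_def W_functional_def sum_negf)
  finally show "adjoint_op E N D A (measure_functional E \<phi>) f
    = - dist_div (vector_measure ?c \<phi>) f + diffusion_functional b \<phi> f
       + U_functional \<nu> \<phi> f - dist_div (V_functional \<mu> \<phi>) f + dist_hess (W_functional \<rho> \<phi>) f" .
qed

end
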